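(* Let $E$ be an infinite-dimensional polyhedral real Banach space satisfying property $( ** )$ and let $\varepsilon>0$. Let $X$ be the Banach space obtained from $E$ and $\varepsilon$ by the construction described in the context. Then $X$ is an $\varepsilon$-equivalent polyhedral renorming of $E$ (that is, the set $B$ of the construction is the closed unit ball $B_X$ of an equivalent norm on $E$, one has $B_E\subset B_X\subset(1+\varepsilon)B_E$, and $X$ is polyhedral) and $$B_X=\overline{\mathrm{conv}}\bigl(\mathrm{ext}(B_X)\bigr).$$ Moreover, if $E$ is (IV)-polyhedral then $X$ is (V)-polyhedral.
   Context: **Notation.** For a real Banach space $E$: $B_E$, $S_E$ are the closed unit ball and unit sphere; $\mathrm{ext}(K)$ is the set of extreme points of $K$; $\overline{\mathrm{conv}}$ is the norm-closed convex hull; $\mathrm{dens}(E)$ is the density character. For $x\in S_E$, $D_E(x)=\{x^*\in S_{E^*}: x^*(x)=1\}$. For $\mathcal{A}\subset E^*$, $\mathcal{A}'$ is the set of $w^*$-cluster (accumulation) points of $\mathcal{A}$. **Polyhedrality.** $E$ is polyhedral if the unit ball of each finite-dimensional subspace is a polytope (convex hull of finitely many points). $E$ is (IV)-polyhedral if $f(x)<1$ whenever $x\in S_E$ and $f\in(\mathrm{ext}\,B_{E^*})'$. $E$ is (V)-polyhedral if $\sup\{f(x): f\in\mathrm{ext}\,B_{E^*}\setminus D_E(x)\}<1$ for each $x\in S_E$. **$\varepsilon$-equivalent renorming.** $E$ endowed with an equivalent norm with closed unit ball $B$ is an $\varepsilon$-equivalent renorming of $E$ if $B_E\subset B\subset(1+\varepsilon)B_E$.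 **True faces.** A set $F\subset S_E$ is a true face of $B_E$ if there is $f\in S_{E^*}$ such that, with $H=f^{-1}(1)$, $F=H\cap B_E$ and the relative interior $\mathrm{int}_H F$ of $F$ in $H$ is nonempty. If $E$ is an infinite-dimensional polyhedral space, the minimal boundary of $E$ is $\mathcal{B}_0=\{f\in S_{E^*}: f^{-1}(1)\cap B_E \text{ is a true face of } B_E\}$; it is known that for each $x\in E$ some $f\in\mathcal{B}_0$ satisfies $f(x)=\|x\|$, and that $\mathrm{card}(\mathcal{B}_0)=\mathrm{dens}(E)=\mathrm{dens}(E^* )$. **Property $( ** )$.** A polyhedral space $E$ satisfies $( ** )$ if $\sup\{f(x): f\in\mathcal{B}_0\setminus D_E(x)\}<1$ for every $x\in S_E$ at which the norm of $E$ is Fréchet differentiable. **Construction of $X$.** Let $E$ be infinite-dimensional, polyhedral, with $( ** )$, norm $\|\cdot\|$, and $\varepsilon>0$. Let $\Gamma=\mathrm{card}(\mathcal{B}_0)$, an infinite cardinal identified with the interval of ordinals $[0,\Gamma)$. Write $\mathcal{B}_0$ as the disjoint union of $\{f^+_\gamma\}_{\gamma<\Gamma}$ and $\{f^-_\gamma\}_{\gamma<\Gamma}$ (without repetitions) with $f^-_\gamma=-f^+_\gamma$; put $H^\pm_\gamma=(f^\pm_\gamma)^{-1}(1)$, $S^\pm_\gamma=H^\pm_\gamma\cap B_E$. Fix $\theta:[0,\Gamma)\to(0,\varepsilon)$ with $\inf_{\gamma\ge\eta}\theta(\gamma)=0$ for every $\eta<\Gamma$, and a family $\{x_\gamma\}_{\gamma<\Gamma}$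 dense in $B_E$. Let $J=(0,\omega)$ if $\Gamma=\omega$ and $J=(\omega,\Gamma)$ if $\Gamma>\omega$. By (transfinite) induction on $\gamma\in J$ do the following (all choices are possible). Let $W^\gamma=\{x_\eta:\eta<\gamma\}\cup\bigcup_{\delta\in J,\,\delta<\gamma}E_\delta$. If $\Gamma=\omega$, $W^\gamma$ is finite and we enumerate it as $\{z^\gamma_\eta\}_{\eta<\kappa_\gamma}$ with $\kappa_\gamma$ a positive integer; if $\Gamma>\omega$, $\mathrm{card}(W^\gamma)=\mathrm{card}(\gamma)$ and we enumerate it as $\{z^\gamma_\eta\}_{\eta<\kappa_\gamma}$ with $\kappa_\gamma=\gamma$. By induction on $\eta<\kappa_\gamma$ choose a finite nonempty set $A^\gamma_\eta\subset[0,\Gamma)$ disjoint from $\bigcup_{\delta\in J,\delta<\gamma}A_\delta\cup\bigcup_{v<\eta}A^\gamma_v$ and, for each $w\in A^\gamma_\eta$, points $e^+_w\in\mathrm{int}_{H^+_w}(S^+_w)$, $e^-_w\in\mathrm{int}_{H^-_w}(S^-_w)$ and numbers $\lambda^+_w,\lambda^-_w\ge0$ with $\sum_{w\in A^\gamma_\eta}(\lambda^+_w+\lambda^-_w)=1$ and $$z^\gamma_\eta\in\sum_{w\in A^\gamma_\eta}(\lambda^+_we^+_w+\lambda^-_we^-_w)+\theta(\gamma)B_E .$$ Set $A_\gamma=\bigcup_{\eta<\kappa_\gamma}A^\gamma_\eta$ and $E_\gamma=\{e^+_w,e^-_w: w\in A_\gamma\}$. Finally let $A=\bigcup_{\gamma\in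 J}A_\gamma$ and, for $\gamma<\Gamma$, let $e_\gamma=e^+_\gamma$ if $\gamma\in A$ and $\lambda^+_\gamma\ge\lambda^-_\gamma$; $e_\gamma=-e^-_\gamma$ if $\gamma\in A$ and $\lambda^+_\gamma<\lambda^-_\gamma$; and $e_\gamma$ an arbitrary element of $\mathrm{int}_{H^+_\gamma}(S^+_\gamma)$ if $\gamma\notin A$. By $( ** )$, $\mu_\gamma:=\sup_{\xi\ne\gamma}|f^+_\xi(e_\gamma)|<1$; choose $\theta_\gamma\in(0,\varepsilon)$ with $\theta_\gamma+\mu_\gamma+\theta_\gamma\mu_\gamma<1$. Put $$B=\overline{\mathrm{conv}}\bigl(\{\pm(1+\theta_\gamma)e_\gamma:\gamma\in[0,\Gamma)\}\bigr),$$ and let $X$ be $E$ with the norm whose closed unit ball is $B_X=B$. *)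

theory Defs
  imports "HOL-Analysis.Analysis"
begin

unbundle cardinal_syntax

section \<open>Geometry of equivalent norms\<close>

text \<open>
  The space \<open>E\<close> is a type of class \<open>banach\<close>, its norm being \<open>norm\<close>. A renorming of \<open>E\<close> is a
  function \<open>N :: 'a \<Rightarrow> real\<close> on the same type. All notions below take the norm as an argument and
  are meant for \<open>N\<close> satisfying \<open>equivalent_norm N\<close>; then \<open>(E, N)\<close> has the same continuous
  functionals, the same norm topology and the same weak-star topology as \<open>E\<close>, so the type
  \<open>'a \<Rightarrow>\<^sub>L real\<close> serves as the dual of all renormings (with its norm depending on \<open>N\<close>).
\<close>

definition equivalent_norm :: "('a::real_normed_vector \<Rightarrow> real) \<Rightarrow> bool" where
  "equivalent_norm N \<longleftrightarrow>
     (\<forall>x. 0 \<le> N x) \<and> (\<forall>x. N x = 0 \<longleftrightarrow> x = 0) \<and>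
     (\<forall>c x. N (c *\<^sub>R x) = \<bar>c\<bar> * N x) \<and> (\<forall>x y. N (x + y) \<le> N x + N y) \<and>
     (\<exists>m>0. \<exists>M>0. \<forall>x. m * norm x \<le> N x \<and> N x \<le> M * norm x)"

definition unit_ball :: "('a::real_normed_vector \<Rightarrow> real) \<Rightarrow> 'a set" where
  "unit_ball N = {x. N x \<le> 1}"

definition unit_sphere :: "('a::real_normed_vector \<Rightarrow> real) \<Rightarrow> 'a set" where
  "unit_sphere N = {x. N x = 1}"

definition dual_norm :: "('a::real_normed_vector \<Rightarrow> real) \<Rightarrow> ('a \<Rightarrow>\<^sub>L real) \<Rightarrow> real" where
  "dual_norm N f = (SUP x\<in>unit_ball N. \<bar>blinfun_apply f x\<bar>)"

definition eps_equivalent_renorming :: "real \<Rightarrow> ('a::real_normed_vector \<Rightarrow> real) \<Rightarrow> bool" where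
  "eps_equivalent_renorming \<epsilon> N \<longleftrightarrow>
     equivalent_norm N \<and> cball 0 1 \<subseteq> unit_ball N \<and>
     unit_ball N \<subseteq> (\<lambda>x. (1 + \<epsilon>) *\<^sub>R x) ` cball 0 1"

definition ext :: "'a::real_vector set \<Rightarrow> 'a set" where
  "ext K = {x. x extreme_point_of K}"

text \<open>\<open>D N x\<close> is the set of norm-one functionals supporting the unit ball at \<open>x\<close>.\<close>

definition D :: "('a::real_normed_vector \<Rightarrow> real) \<Rightarrow> 'a \<Rightarrow> ('a \<Rightarrow>\<^sub>L real) set" where
  "D N x = {f. dual_norm N f = 1 \<and> blinfun_apply f x = 1}"

text \<open>
  On functionals, \<open>strong_operator_topology\<close> is the topology of pointwise convergence, i.e. the
  weak-star topology.
\<close>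

definition weak_star_cluster_points :: "('a::real_normed_vector \<Rightarrow>\<^sub>L real) set \<Rightarrow> ('a \<Rightarrow>\<^sub>L real) set" where
  "weak_star_cluster_points \<A> = strong_operator_topology derived_set_of \<A>"

definition polyhedral :: "('a::real_normed_vector \<Rightarrow> real) \<Rightarrow> bool" where
  "polyhedral N \<longleftrightarrow> (\<forall>b. finite b \<longrightarrow> polytope (unit_ball N \<inter> span b))"

definition IV_polyhedral :: "('a::real_normed_vector \<Rightarrow> real) \<Rightarrow> bool" where
  "IV_polyhedral N \<longleftrightarrow>
     (\<forall>x\<in>unit_sphere N. \<forall>f\<in>weak_star_cluster_points (ext {g. dual_norm N g \<le> 1}).
        blinfun_apply f x < 1)"

text \<open>Suprema compared with \<open>1\<close> are taken in \<open>ereal\<close>, so that the supremum of the empty set is \<open>-\<infinity>\<close>.\<close>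

definition V_polyhedral :: "('a::real_normed_vector \<Rightarrow> real) \<Rightarrow> bool" where
  "V_polyhedral N \<longleftrightarrow>
     (\<forall>x\<in>unit_sphere N. (SUP f\<in>ext {g. dual_norm N g \<le> 1} - D N x. ereal (blinfun_apply f x)) < 1)"

definition hyperplane :: "('a::real_normed_vector \<Rightarrow>\<^sub>L real) \<Rightarrow> 'a set" where
  "hyperplane f = {x. blinfun_apply f x = 1}"

definition face_interior :: "('a::real_normed_vector \<Rightarrow> real) \<Rightarrow> ('a \<Rightarrow>\<^sub>L real) \<Rightarrow> 'a set" where
  "face_interior N f = top_of_set (hyperplane f) interior_of (hyperplane f \<inter> unit_ball N)"

definition true_face :: "('a::real_normed_vector \<Rightarrow> real) \<Rightarrow> 'a set \<Rightarrow> bool" where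
  "true_face N F \<longleftrightarrow> F \<subseteq> unit_sphere N \<and>
     (\<exists>f. dual_norm N f = 1 \<and> F = hyperplane f \<inter> unit_ball N \<and> face_interior N f \<noteq> {})"

definition minimal_boundary :: "('a::real_normed_vector \<Rightarrow> real) \<Rightarrow> ('a \<Rightarrow>\<^sub>L real) set" where
  "minimal_boundary N = {f. dual_norm N f = 1 \<and> true_face N (hyperplane f \<inter> unit_ball N)}"

text \<open>
  Property \<open>(**)\<close>. Here \<open>differentiable\<close> is Frechet differentiability with respect to \<open>norm\<close>,
  which is the same as with respect to any equivalent norm.
\<close>

definition property_starstar :: "('a::real_normed_vector \<Rightarrow> real) \<Rightarrow> bool" where
  "property_starstar N \<longleftrightarrow>
     (\<forall>x\<in>unit_sphere N. N differentiable (at x) \<longrightarrow>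
        (SUP f\<in>minimal_boundary N - D N x. ereal (blinfun_apply f x)) < 1)"

lemma unit_ball_norm: "unit_ball norm = cball 0 1"
  by (auto simp: unit_ball_def)

lemma unit_sphere_norm: "unit_sphere norm = sphere 0 1"
  by (auto simp: unit_sphere_def)

lemma equivalent_norm_norm: "equivalent_norm norm"
  unfolding equivalent_norm_def by (auto intro!: norm_triangle_ineq exI[of _ "1::real"])

lemma dual_norm_norm: "dual_norm norm f = norm f"
proof (rule antisym)
  have bd: "\<bar>blinfun_apply f x\<bar> \<le> norm f" if "norm x \<le> 1" for x
    using norm_blinfun[of f x] mult_left_le[OF that norm_ge_zero[of f]] by simp
  show "dual_norm norm f \<le> norm f"
    unfolding dual_norm_def unit_ball_norm by (rule cSUP_least) (auto intro: bd)
  have bdd: "bdd_above ((\<lambda>x. \<bar>blinfun_apply f x\<bar>) ` cball 0 1)"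
    by (rule bdd_aboveI2[where M = "norm f"]) (auto intro: bd)
  have *: "\<bar>blinfun_apply f x\<bar> \<le> dual_norm norm f" if "norm x \<le> 1" for x
    unfolding dual_norm_def unit_ball_norm by (rule cSUP_upper[OF _ bdd]) (use that in auto)
  show "norm f \<le> dual_norm norm f"
  proof (rule norm_blinfun_bound)
    show "0 \<le> dual_norm norm f" using *[of 0] by simp
    fix x
    show "norm (blinfun_apply f x) \<le> dual_norm norm f * norm x"
    proof (cases "x = 0")
      case False
      then show ?thesis
        using *[of "inverse (norm x) *\<^sub>R x"]
        by (simp add: blinfun.scaleR_right abs_mult field_simps)
    qed simp
  qed
qed

section \<open>The construction\<close>

text \<open>
  The cardinal \<open>\<Gamma>\<close>, identified with the interval of ordinals \<open>[0, \<Gamma>)\<close>, is a cardinal order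
  relation on an arbitrary index type: the ordinals below \<open>\<Gamma>\<close> are the elements of \<open>Field \<Gamma>\<close>,
  \<open>(\<delta>, \<gamma>) \<in> \<Gamma>\<close> means \<open>\<delta> \<le> \<gamma>\<close>, and \<open>underS \<Gamma> \<gamma>\<close> is the set of all \<open>\<delta> < \<gamma>\<close>. The ordinal \<open>\<gamma>\<close>
  itself is the order type of \<open>Restr \<Gamma> (underS \<Gamma> \<gamma>)\<close>.

  Data of the construction:
  \<^item> \<open>f \<gamma>\<close> is \<open>f\<^sup>+\<^sub>\<gamma>\<close>, so that \<open>f\<^sup>-\<^sub>\<gamma>\<close> is \<open>- f \<gamma>\<close>;
  \<^item> \<open>\<theta>\<close> is the function \<open>[0, \<Gamma>) \<rightarrow> (0, \<epsilon>)\<close>, whereas \<open>\<tau> \<gamma>\<close> is the number written \<open>\<theta>\<^sub>\<gamma>\<close> with a subscript;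
  \<^item> \<open>x \<gamma>\<close> are the points of the dense family;
  \<^item> \<open>z \<gamma> \<eta>\<close>, for \<open>\<eta> < \<kappa> \<gamma>\<close>, is the enumeration of \<open>W\<^sup>\<gamma>\<close>;
  \<^item> \<open>Aset \<gamma> \<eta>\<close> is the finite set \<open>A\<^sup>\<gamma>\<^sub>\<eta>\<close>;
  \<^item> \<open>ep\<close>, \<open>em\<close>, \<open>lp\<close>, \<open>lm\<close> are \<open>e\<^sup>+\<close>, \<open>e\<^sup>-\<close>, \<open>\<lambda>\<^sup>+\<close>, \<open>\<lambda>\<^sup>-\<close>. They depend on \<open>w\<close> only, as the sets
    \<open>A\<^sup>\<gamma>\<^sub>\<eta>\<close> are pairwise disjoint;
  \<^item> \<open>e \<gamma>\<close> is \<open>e\<^sub>\<gamma>\<close>.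

  The values of the families outside their index ranges are irrelevant. The choices made by
  transfinite recursion are expressed by the conditions that the resulting families satisfy:
  each condition at \<open>(\<gamma>, \<eta>)\<close> refers to earlier stages only.
\<close>

locale renorming_data =
  fixes \<epsilon> :: real
    and \<Gamma> :: "'i rel"
    and f :: "'i \<Rightarrow> ('a::banach \<Rightarrow>\<^sub>L real)"
    and \<theta> :: "'i \<Rightarrow> real"
    and x :: "'i \<Rightarrow> 'a"
    and \<kappa> :: "'i \<Rightarrow> 'i"
    and z :: "'i \<Rightarrow> 'i \<Rightarrow> 'a"
    and Aset :: "'i \<Rightarrow> 'i \<Rightarrow> 'i set"
    and ep em :: "'i \<Rightarrow> 'a"
    and lp lm :: "'i \<Rightarrow> real"
    and e :: "'i \<Rightarrow> 'a"
    and \<tau> :: "'i \<Rightarrow> real"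
begin

text \<open>\<open>J\<close> is the open interval \<open>(0, \<omega>)\<close> if \<open>\<Gamma> = \<omega>\<close>, and \<open>(\<omega>, \<Gamma>)\<close> otherwise.\<close>

definition J :: "'i set" where
  "J = (if \<Gamma> =o natLeq then {\<gamma> \<in> Field \<Gamma>. underS \<Gamma> \<gamma> \<noteq> {}}
        else {\<gamma> \<in> Field \<Gamma>. natLeq <o Restr \<Gamma> (underS \<Gamma> \<gamma>)})"

definition A_stage :: "'i \<Rightarrow> 'i set" where
  "A_stage \<gamma> = (\<Union>\<eta>\<in>underS \<Gamma> (\<kappa> \<gamma>). Aset \<gamma> \<eta>)"

definition E_stage :: "'i \<Rightarrow> 'a set" where
  "E_stage \<gamma> = ep ` A_stage \<gamma> \<union> em ` A_stage \<gamma>"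

definition W :: "'i \<Rightarrow> 'a set" where
  "W \<gamma> = x ` underS \<Gamma> \<gamma> \<union> (\<Union>\<delta>\<in>J \<inter> underS \<Gamma> \<gamma>. E_stage \<delta>)"

definition A_total :: "'i set" where
  "A_total = (\<Union>\<gamma>\<in>J. A_stage \<gamma>)"

definition \<mu> :: "'i \<Rightarrow> real" where
  "\<mu> \<gamma> = (SUP \<xi>\<in>Field \<Gamma> - {\<gamma>}. \<bar>blinfun_apply (f \<xi>) (e \<gamma>)\<bar>)"

definition B :: "'a set" where
  "B = closure (convex hull
         ((\<lambda>\<gamma>. (1 + \<tau> \<gamma>) *\<^sub>R e \<gamma>) ` Field \<Gamma> \<union> (\<lambda>\<gamma>. - ((1 + \<tau> \<gamma>) *\<^sub>R e \<gamma>)) ` Field \<Gamma>))"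

end

text \<open>
  In \<open>kappa\<close>, if \<open>\<Gamma> = \<omega>\<close> then \<open>\<kappa> \<gamma>\<close> is a positive integer, i.e. an element of \<open>Field \<Gamma>\<close> having a
  predecessor. In \<open>enumeration\<close>, the family \<open>z \<gamma> \<eta>\<close> runs through \<open>W\<^sup>\<gamma>\<close>, possibly with repetitions.
\<close>

locale renorming_construction = renorming_data \<epsilon> \<Gamma> f \<theta> x \<kappa> z Aset ep em lp lm e \<tau>
  for \<epsilon> :: real
    and \<Gamma> :: "'i rel"
    and f :: "'i \<Rightarrow> ('a::banach \<Rightarrow>\<^sub>L real)"
    and \<theta> x \<kappa> z Aset ep em lp lm e \<tau> +
  assumes Gamma: "Card_order \<Gamma>" "\<Gamma> =o card_of (minimal_boundary (norm :: 'a \<Rightarrow> real))"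
    and f_inj: "inj_on f (Field \<Gamma>)"
    and f_disjoint: "f ` Field \<Gamma> \<inter> (\<lambda>\<gamma>. - f \<gamma>) ` Field \<Gamma> = {}"
    and f_range: "f ` Field \<Gamma> \<union> (\<lambda>\<gamma>. - f \<gamma>) ` Field \<Gamma> = minimal_boundary norm"
    and theta_range: "\<And>\<gamma>. \<gamma> \<in> Field \<Gamma> \<Longrightarrow> 0 < \<theta> \<gamma> \<and> \<theta> \<gamma> < \<epsilon>"
    and theta_inf: "\<And>\<eta>. \<eta> \<in> Field \<Gamma> \<Longrightarrow> (INF \<gamma>\<in>{\<gamma>. (\<eta>, \<gamma>) \<in> \<Gamma>}. \<theta> \<gamma>) = 0"
    and x_in: "x ` Field \<Gamma> \<subseteq> cball 0 1"
    and x_dense: "cball 0 1 \<subseteq> closure (x ` Field \<Gamma>)"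
    and kappa: "\<And>\<gamma>. \<gamma> \<in> J \<Longrightarrow>
      (if \<Gamma> =o natLeq then \<kappa> \<gamma> \<in> Field \<Gamma> \<and> underS \<Gamma> (\<kappa> \<gamma>) \<noteq> {} else \<kappa> \<gamma> = \<gamma>)"
    and enumeration: "\<And>\<gamma>. \<gamma> \<in> J \<Longrightarrow> z \<gamma> ` underS \<Gamma> (\<kappa> \<gamma>) = W \<gamma>"
    and Aset_finite: "\<And>\<gamma> \<eta>. \<gamma> \<in> J \<Longrightarrow> \<eta> \<in> underS \<Gamma> (\<kappa> \<gamma>) \<Longrightarrow>
      finite (Aset \<gamma> \<eta>) \<and> Aset \<gamma> \<eta> \<noteq> {} \<and> Aset \<gamma> \<eta> \<subseteq> Field \<Gamma>"
    and Aset_disjoint: "\<And>\<gamma> \<eta>. \<gamma> \<in> J \<Longrightarrow> \<eta> \<in> underS \<Gamma> (\<kappa> \<gamma>) \<Longrightarrow>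
      Aset \<gamma> \<eta> \<inter> ((\<Union>\<delta>\<in>J \<inter> underS \<Gamma> \<gamma>. A_stage \<delta>) \<union> (\<Union>v\<in>underS \<Gamma> \<eta>. Aset \<gamma> v)) = {}"
    and points: "\<And>w. w \<in> A_total \<Longrightarrow>
      ep w \<in> face_interior norm (f w) \<and> em w \<in> face_interior norm (- f w)"
    and coefficients_nonneg: "\<And>w. w \<in> A_total \<Longrightarrow> 0 \<le> lp w \<and> 0 \<le> lm w"
    and coefficients_sum: "\<And>\<gamma> \<eta>. \<gamma> \<in> J \<Longrightarrow> \<eta> \<in> underS \<Gamma> (\<kappa> \<gamma>) \<Longrightarrow>
      (\<Sum>w\<in>Aset \<gamma> \<eta>. lp w + lm w) = 1"
    and approximation: "\<And>\<gamma> \<eta>. \<gamma> \<in> J \<Longrightarrow> \<eta> \<in> underS \<Gamma> (\<kappa> \<gamma>) \<Longrightarrow>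
      z \<gamma> \<eta> \<in> cball (\<Sum>w\<in>Aset \<gamma> \<eta>. lp w *\<^sub>R ep w + lm w *\<^sub>R em w) (\<theta> \<gamma>)"
    and e_plus: "\<And>\<gamma>. \<gamma> \<in> A_total \<Longrightarrow> lp \<gamma> \<ge> lm \<gamma> \<Longrightarrow> e \<gamma> = ep \<gamma>"
    and e_minus: "\<And>\<gamma>. \<gamma> \<in> A_total \<Longrightarrow> lp \<gamma> < lm \<gamma> \<Longrightarrow> e \<gamma> = - em \<gamma>"
    and e_other: "\<And>\<gamma>. \<gamma> \<in> Field \<Gamma> - A_total \<Longrightarrow> e \<gamma> \<in> face_interior norm (f \<gamma>)"
    and tau_range: "\<And>\<gamma>. \<gamma> \<in> Field \<Gamma> \<Longrightarrow> 0 < \<tau> \<gamma> \<and> \<tau> \<gamma> < \<epsilon>"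
    and tau_mu: "\<And>\<gamma>. \<gamma> \<in> Field \<Gamma> \<Longrightarrow> \<tau> \<gamma> + \<mu> \<gamma> + \<tau> \<gamma> * \<mu> \<gamma> < 1"

end

theory Submission
  imports Defs
begin

text \<open>
  Baire category in \<open>E \<times> E\<close> shows that a polyhedral norm is linear near the points of a dense set; the
  local slopes belong to the minimal boundary, which is therefore norming. By the iterated
  approximation in the construction, \<open>B\<^sub>E\<close> is the closed convex hull of the points \<open>\<plusminus> e\<^sub>\<gamma>\<close>, so that
  \<open>B\<close> contains \<open>B\<^sub>E\<close>.

  The condition on \<open>\<theta>\<^sub>\<gamma>\<close> makes the segments between two different spikes meet \<open>B\<^sub>E\<close>. Hence \<open>B\<close> is the
  union of the sets \<open>conv (B\<^sub>E \<union> {\<plusminus> (1 + \<theta>\<^sub>\<gamma>) e\<^sub>\<gamma>})\<close>, and dually it is cut out by explicit functionals, one on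
  each edge from \<open>\<plusminus> f\<^sub>\<gamma>\<close> to another element of the minimal boundary. A finite-dimensional subspace
  meets only finitely many spikes, which gives polyhedrality. For a norm-one point \<open>x\<close> of \<open>X\<close>, under (IV),
  these functionals split into those with value \<open>1\<close> at \<open>x\<close> and those with values bounded away from
  \<open>1\<close>; by Hahn-Banach this dichotomy passes to the extreme points of the dual ball.
\<close>

text \<open>At a spike, its own functional has value \<open>1 + t\<close>, while all other boundary
  functionals stay below \<open>1 - t\<close>: gain and loss are balanced. For spikes of heights
  \<open>t\<close> and \<open>t'\<close>, the point of the joining segment with weights in the ratio
  \<open>t' : t\<close> therefore lies in the old ball. The obstacle to (V) is that the dual ball of
  the new norm is only the weak-star closed hull of the explicit functionals, so an extreme
  functional could be a limit without a formula. No such limit is computed. For a fixed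
  \<open>x\<close>, the new norm is the maximum of two sublinear functionals, one collecting the
  explicit functionals with value 1 at \<open>x\<close>, the other the rest. Extremality forces a
  functional to be controlled by one of the two. This splitting destroys the symmetry under change
  of sign, which is why sublinear functionals appear in place of seminorms.\<close>

section \<open>Sections of polytopes\<close>

text \<open>The index sets are joined as a disjoint sum, so that an index occurring in both keeps
  two separate weights.\<close>

lemma convex_two_sums:
  fixes C :: "'b::real_vector set"
  assumes "convex C" "finite S" "finite T"
    and "\<And>i. i \<in> S \<Longrightarrow> 0 \<le> a i \<and> p i \<in> C"
    and "\<And>j. j \<in> T \<Longrightarrow> 0 \<le> b j \<and> q j \<in> C"
    and "sum a S + sum b T = 1"
  shows "(\<Sum>i\<in>S. a i *\<^sub>R p i) + (\<Sum>j\<in>T. b j *\<^sub>R q j) \<in> C"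
proof -
  have "(\<Sum>k\<in>S <+> T. case_sum a b k *\<^sub>R case_sum p q k) \<in> C"
    by (rule convex_sum) (use assms in \<open>auto simp: sum.Plus\<close>)
  then show ?thesis
    using assms(2,3) by (simp add: sum.Plus)
qed

text \<open>The vertices of the section are found among the old ones on the hyperplane and the
  points \<open>c p q\<close> where a segment from the positive to the negative side crosses it. A
  convex combination with value 0 has moments of equal size \<open>S\<close> on both sides, so its
  mass can be paired off along these segments.\<close>

lemma polytope_Int_kernel:
  fixes K :: "'b::real_vector set" and g :: "'b \<Rightarrow> real"
  assumes "polytope K" and g: "linear g"
  shows "polytope (K \<inter> {x. g x = 0})"
proof -
  obtain V where V: "finite V" "K = convex hull V"
    using assms(1) by (auto simp: polytope_def)
  define Z where "Z = {v\<in>V. g v = 0}"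
  define P where "P = {v\<in>V. g v > 0}"
  define Q where "Q = {v\<in>V. g v < 0}"
  define c where "c p q = (1 / (g p - g q)) *\<^sub>R ((- g q) *\<^sub>R p + g p *\<^sub>R q)" for p q
  define W where "W = Z \<union> (\<lambda>(p, q). c p q) ` (P \<times> Q)"
  have fin: "finite Z" "finite P" "finite Q"
    using V by (auto simp: Z_def P_def Q_def)
  have split_V: "sum h V = sum h Z + sum h P + sum h Q" for h :: "'b \<Rightarrow> 'c::comm_monoid_add"
  proof -
    have "V = Z \<union> (P \<union> Q)" by (auto simp: Z_def P_def Q_def)
    moreover have "Z \<inter> (P \<union> Q) = {}" "P \<inter> Q = {}" by (auto simp: Z_def P_def Q_def)
    ultimately show ?thesis using fin by (simp add: sum.union_disjoint add.assoc)
  qed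
  have c_in: "c p q \<in> K \<inter> {x. g x = 0}" if "p \<in> P" "q \<in> Q" for p q
  proof -
    have pq: "g p > 0" "g q < 0" "p \<in> K" "q \<in> K"
      using that V(2) by (auto simp: P_def Q_def hull_inc)
    have "c p q = (- g q / (g p - g q)) *\<^sub>R p + (g p / (g p - g q)) *\<^sub>R q"
      by (simp add: c_def algebra_simps)
    also have "\<dots> \<in> K"
    proof (rule convexD)
      show "convex K" by (simp add: V(2))
      show "- g q / (g p - g q) + g p / (g p - g q) = 1"
        using pq by (simp add: diff_divide_distrib[symmetric])
    qed (use pq in \<open>auto simp: divide_nonpos_pos\<close>)
    moreover have "g (c p q) = 0"
      by (simp add: c_def linear_add[OF g] linear_diff[OF g] linear_scale[OF g] algebra_simps)
    ultimately show ?thesis by simp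
  qed
  have "K \<inter> {x. g x = 0} = convex hull W"
  proof
    show "convex hull W \<subseteq> K \<inter> {x. g x = 0}"
    proof (rule hull_minimal)
      show "W \<subseteq> K \<inter> {x. g x = 0}"
        using c_in V(2) by (auto simp: W_def Z_def hull_inc)
      have "convex {x. g x = 0}"
        by (auto simp: convex_def linear_add[OF g] linear_scale[OF g])
      then show "convex (K \<inter> {x. g x = 0})" by (simp add: V(2) convex_Int)
    qed
  next
    show "K \<inter> {x. g x = 0} \<subseteq> convex hull W"
    proof
      fix x assume "x \<in> K \<inter> {x. g x = 0}"
      then obtain u where u: "\<And>v. v \<in> V \<Longrightarrow> 0 \<le> u v" "sum u V = 1"
        and x: "x = (\<Sum>v\<in>V. u v *\<^sub>R v)" and gx: "g x = 0"
        using V convex_hull_finite[OF V(1)] by auto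
      have uP: "p \<in> P \<Longrightarrow> 0 \<le> u p \<and> g p > 0" and uQ: "q \<in> Q \<Longrightarrow> 0 \<le> u q \<and> g q < 0" for p q
        using u by (auto simp: P_def Q_def)
      define S where "S = (\<Sum>p\<in>P. u p * g p)"
      have "(\<Sum>v\<in>V. u v * g v) = 0"
        using gx by (simp add: x linear_sum[OF g] linear_scale[OF g])
      moreover have "(\<Sum>v\<in>Z. u v * g v) = 0" by (rule sum.neutral) (simp add: Z_def)
      ultimately have SQ: "(\<Sum>q\<in>Q. u q * g q) = - S"
        by (simp add: split_V S_def)
      have S0: "0 \<le> S" unfolding S_def by (rule sum_nonneg) (use uP in fastforce)
      have ZW: "Z \<subseteq> convex hull W" by (auto simp: W_def hull_inc)
      show "x \<in> convex hull W"
      proof (cases "S = 0")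
        case True
        \<comment> \<open>With zero moment no weight sits off the hyperplane.\<close>
        have "\<forall>p\<in>P. u p * g p = 0"
          using sum_nonneg_eq_0_iff[OF fin(2), of "\<lambda>p. u p * g p"] True uP
          by (fastforce simp: S_def)
        then have p0: "\<forall>p\<in>P. u p = 0" using uP by fastforce
        have "(\<Sum>q\<in>Q. u q * (- g q)) = 0" using SQ True by (simp add: sum_negf)
        then have "\<forall>q\<in>Q. u q * (- g q) = 0"
          using sum_nonneg_eq_0_iff[OF fin(3), of "\<lambda>q. u q * (- g q)"] uQ
          by (smt (verit, ccfv_SIG) mult_nonneg_nonneg)
        then have q0: "\<forall>q\<in>Q. u q = 0" using uQ by fastforce
        have "x = (\<Sum>v\<in>Z. u v *\<^sub>R v)" "sum u Z = 1"
          using u(2) p0 q0 by (auto simp: x split_V)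
        moreover have "(\<Sum>v\<in>Z. u v *\<^sub>R v) \<in> convex hull W"
          by (rule convex_sum) (use fin u(1) ZW \<open>sum u Z = 1\<close> in \<open>auto simp: Z_def\<close>)
        ultimately show ?thesis by simp
      next
        case False
        then have S1: "S > 0" using S0 by simp
        \<comment> \<open>Product coupling of the two sides: the part of \<open>p\<close> used on
          the segment to \<open>q\<close> is \<open>u p\<close> times the fraction
          \<open>u q * (- g q) / S\<close> of the negative moment. These fractions add up to 1, so
          the parts sum back to \<open>u p\<close>, and symmetrically for \<open>q\<close>.\<close>
        define k where "k p q = u p * u q * (g p - g q) / S" for p q
        have k0: "0 \<le> k p q" if "p \<in> P" "q \<in> Q" for p q
          using uP[OF that(1)] uQ[OF that(2)] S1 by (auto simp: k_def)
        have kc: "k p q *\<^sub>R c p q = (u p * (u q * (- g q)) / S) *\<^sub>R p + (u q * (u p * g p) / S) *\<^sub>R q"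
          if "p \<in> P" "q \<in> Q" for p q
        proof -
          have "g p - g q \<noteq> 0" using uP[OF that(1)] uQ[OF that(2)] by simp
          have "k p q *\<^sub>R c p q = (u p * u q / S * ((g p - g q) / (g p - g q))) *\<^sub>R ((- g q) *\<^sub>R p + g p *\<^sub>R q)"
            by (simp add: k_def c_def)
          also have "(g p - g q) / (g p - g q) = 1"
            using \<open>g p - g q \<noteq> 0\<close> by simp
          finally show ?thesis by (simp add: scaleR_add_right scaleR_diff_right mult_ac)
        qed
        have sQ: "(\<Sum>q\<in>Q. u q * (- g q)) = S" using SQ by (simp add: sum_negf)
        have "(\<Sum>(p,q)\<in>P \<times> Q. k p q)
            = (\<Sum>p\<in>P. \<Sum>q\<in>Q. u p * (u q * (- g q)) / S + u q * (u p * g p) / S)"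
          unfolding sum.cartesian_product[symmetric] k_def
          by (intro sum.cong refl) (simp add: add_divide_distrib[symmetric] algebra_simps)
        also have "\<dots> = (\<Sum>p\<in>P. \<Sum>q\<in>Q. u p * (u q * (- g q)) / S) + (\<Sum>p\<in>P. \<Sum>q\<in>Q. u q * (u p * g p) / S)"
          by (simp only: sum.distrib)
        also have "(\<Sum>p\<in>P. \<Sum>q\<in>Q. u q * (u p * g p) / S) = (\<Sum>q\<in>Q. \<Sum>p\<in>P. u q * (u p * g p) / S)"
          by (rule sum.swap)
        also have "(\<Sum>p\<in>P. \<Sum>q\<in>Q. u p * (u q * (- g q)) / S) = sum u P"
          using S1 by (simp only: sum_distrib_left[symmetric] sum_divide_distrib[symmetric] sQ) (simp add: sum_distrib_right[symmetric])
        also have "(\<Sum>q\<in>Q. \<Sum>p\<in>P. u q * (u p * g p) / S) = sum u Q"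
          using S1 by (simp only: sum_distrib_left[symmetric] sum_divide_distrib[symmetric] S_def[symmetric]) (simp add: sum_distrib_right[symmetric])
        finally have k1: "(\<Sum>(p,q)\<in>P \<times> Q. k p q) = sum u P + sum u Q" .
        have "(\<Sum>(p,q)\<in>P \<times> Q. k p q *\<^sub>R c p q)
            = (\<Sum>p\<in>P. \<Sum>q\<in>Q. (u p * (u q * (- g q)) / S) *\<^sub>R p + (u q * (u p * g p) / S) *\<^sub>R q)"
          unfolding sum.cartesian_product[symmetric] by (intro sum.cong refl kc)
        also have "\<dots> = (\<Sum>p\<in>P. \<Sum>q\<in>Q. (u p * (u q * (- g q)) / S) *\<^sub>R p)
            + (\<Sum>p\<in>P. \<Sum>q\<in>Q. (u q * (u p * g p) / S) *\<^sub>R q)"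
          by (simp only: sum.distrib)
        also have "(\<Sum>p\<in>P. \<Sum>q\<in>Q. (u q * (u p * g p) / S) *\<^sub>R q) = (\<Sum>q\<in>Q. \<Sum>p\<in>P. (u q * (u p * g p) / S) *\<^sub>R q)"
          by (rule sum.swap)
        also have "(\<Sum>p\<in>P. \<Sum>q\<in>Q. (u p * (u q * (- g q)) / S) *\<^sub>R p) = (\<Sum>p\<in>P. u p *\<^sub>R p)"
          using S1 by (simp only: scaleR_sum_left[symmetric] sum_distrib_left[symmetric] sum_divide_distrib[symmetric] sQ) (simp add: sum_distrib_right[symmetric])
        also have "(\<Sum>q\<in>Q. \<Sum>p\<in>P. (u q * (u p * g p) / S) *\<^sub>R q) = (\<Sum>q\<in>Q. u q *\<^sub>R q)"
          using S1 by (simp only: scaleR_sum_left[symmetric] sum_distrib_left[symmetric] sum_divide_distrib[symmetric] S_def[symmetric]) (simp add: sum_distrib_right[symmetric])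
        finally have kx: "(\<Sum>(p,q)\<in>P \<times> Q. k p q *\<^sub>R c p q) = (\<Sum>p\<in>P. u p *\<^sub>R p) + (\<Sum>q\<in>Q. u q *\<^sub>R q)" .
        have "(\<Sum>v\<in>Z. u v *\<^sub>R v) + (\<Sum>r\<in>P\<times>Q. (case r of (p,q) \<Rightarrow> k p q) *\<^sub>R (case r of (p,q) \<Rightarrow> c p q)) \<in> convex hull W"
        proof (rule convex_two_sums)
          show "sum u Z + (\<Sum>r\<in>P\<times>Q. case r of (p,q) \<Rightarrow> k p q) = 1"
            using k1 u(2) by (simp add: split_V)
          show "0 \<le> u v \<and> v \<in> convex hull W" if "v \<in> Z" for v
            using that ZW u by (auto simp: Z_def)
          show "0 \<le> (case r of (p,q) \<Rightarrow> k p q) \<and> (case r of (p,q) \<Rightarrow> c p q) \<in> convex hull W"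
            if "r \<in> P \<times> Q" for r
            using that k0 by (auto simp: W_def intro!: hull_inc)
        qed (use fin in auto)
        moreover have "x = (\<Sum>v\<in>Z. u v *\<^sub>R v) + (\<Sum>r\<in>P\<times>Q. (case r of (p,q) \<Rightarrow> k p q) *\<^sub>R (case r of (p,q) \<Rightarrow> c p q))"
          using kx by (simp add: x split_V add.assoc case_prod_unfold)
        ultimately show ?thesis by simp
      qed
    qed
  qed
  moreover have "finite W" using fin by (simp add: W_def)
  ultimately show ?thesis by (auto simp: polytope_def)
qed

text \<open>The functional is 1 at \<open>a\<close> and 0 on a basis of \<open>span S\<close>. It
  turns the removal of one generator into a section by a kernel.\<close>

lemma span_eq_kernel_in_span_insert:
  fixes S :: "'b::real_vector set"
  assumes "a \<notin> span S"
  obtains g :: "'b \<Rightarrow> real" where "linear g" "\<And>x. x \<in> span (insert a S) \<Longrightarrow> g x = 0 \<longleftrightarrow> x \<in> span S"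
proof -
  obtain C where C: "C \<subseteq> S" "independent C" "span S = span C"
    using maximal_independent_subset[of S] by (metis span_eq subset_antisym span_superset span_mono span_span subset_trans)
  have "independent (insert a C)"
    using C assms by (auto simp: independent_insert)
  then obtain g :: "'b \<Rightarrow> real" where g: "linear g" "\<And>x. x \<in> insert a C \<Longrightarrow> g x = (if x = a then 1 else 0)"
    using linear_independent_extend[of "insert a C" "\<lambda>x. if x = a then 1 else 0"] by blast
  have aC: "a \<notin> C" using assms C span_superset by blast
  have zero: "g x = 0" if "x \<in> span S" for x
    using linear_eq_0_on_span[OF g(1), of C x] that C aC g(2) by fastforce
  show thesis
  proof (rule that[OF g(1)])
    fix x assume "x \<in> span (insert a S)"
    then obtain k where "x - k *\<^sub>R a \<in> span S" by (auto simp: span_insert)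
    moreover from this have "g x = k"
      using zero[of "x - k *\<^sub>R a"] g(2)[of a] by (simp add: linear_diff[OF g(1)] linear_scale[OF g(1)])
    ultimately show "g x = 0 \<longleftrightarrow> x \<in> span S" using zero[of x] by auto
  qed
qed

text \<open>The generators in \<open>V\<close> are dropped one at a time, each removal being a
  section by a kernel or no change at all.\<close>

lemma polytope_Int_span:
  fixes K :: "'b::real_vector set"
  assumes "finite V" "polytope K" "K \<subseteq> span (S \<union> V)"
  shows "polytope (K \<inter> span S)"
  using assms
proof (induction V arbitrary: S K rule: finite_induct)
  case empty
  then show ?case by (simp add: Int_absorb2)
next
  case (insert a V)
  have "polytope (K \<inter> span (insert a S))"
    using insert.IH[of K "insert a S"] insert.prems by simp
  show ?case
  proof (cases "a \<in> span S")
    case True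
    then show ?thesis using \<open>polytope (K \<inter> span (insert a S))\<close> by (simp add: span_redundant)
  next
    case False
    then obtain g :: "'b \<Rightarrow> real" where g: "linear g"
      "\<And>x. x \<in> span (insert a S) \<Longrightarrow> g x = 0 \<longleftrightarrow> x \<in> span S"
      using span_eq_kernel_in_span_insert by blast
    have "K \<inter> span S = K \<inter> span (insert a S) \<inter> {x. g x = 0}"
      using g(2) span_mono[of S "insert a S"] by blast
    then show ?thesis
      using polytope_Int_kernel[OF \<open>polytope (K \<inter> span (insert a S))\<close> g(1)] by simp
  qed
qed

section \<open>Local linearity of polyhedral norms\<close>

lemma infinite_real_three_points:
  fixes T :: "real set"
  assumes "infinite T"
  obtains t1 t2 t3 where "t1 \<in> T" "t2 \<in> T" "t3 \<in> T" "t1 < t2" "t2 < t3"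
proof -
  obtain S where S: "S \<subseteq> T" "finite S" "card S = 3"
    using infinite_arbitrarily_large[OF assms] by metis
  then have "S \<noteq> {}" by auto
  have "\<not> S \<subseteq> {Min S, Max S}"
  proof
    assume "S \<subseteq> {Min S, Max S}"
    then have "card S \<le> card {Min S, Max S}" by (intro card_mono) auto
    also have "\<dots> \<le> 2" by (simp add: card_insert_if)
    finally show False using S by simp
  qed
  then obtain t where t: "t \<in> S" "t \<noteq> Min S" "t \<noteq> Max S" by blast
  then have "Min S < t" "t < Max S"
    using Min_le[OF S(2) t(1)] Max_ge[OF S(2) t(1)] by auto
  then show thesis
    using that[of "Min S" t "Max S"] S \<open>S \<noteq> {}\<close> t Min_in Max_in by blast
qed

text \<open>A nonnegative vector \<open>p\<close> tolerates a small step in direction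
  \<open>- q\<close> as long as its zero coordinates do not decrease. This supplies the step length
  of the perturbation in \<open>polygon_affine_triple\<close>.\<close>

lemma finite_scale_dominated:
  fixes p q :: "'b \<Rightarrow> real"
  assumes "finite V" "\<And>v. v \<in> V \<Longrightarrow> 0 \<le> p v" "\<And>v. v \<in> V \<Longrightarrow> p v = 0 \<Longrightarrow> q v \<le> 0"
  shows "\<exists>c>0. \<forall>v\<in>V. c * q v \<le> p v"
  using assms
proof (induction V rule: finite_induct)
  case empty
  then show ?case by (auto intro: exI[of _ 1])
next
  case (insert w V)
  then obtain c where c: "c > 0" "\<forall>v\<in>V. c * q v \<le> p v" by auto
  show ?case
  proof (cases "q w \<le> 0")
    case True
    then have "c * q w \<le> p w"
      using c(1) insert.prems(1)[of w] by (smt (verit) insertCI mult_nonneg_nonpos)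
    then show ?thesis using c by auto
  next
    case False
    then have pw: "p w > 0" using insert.prems[of w] by force
    define d where "d = min c (p w / q w)"
    have d: "d > 0" "d \<le> c" "d \<le> p w / q w" using c pw False by (auto simp: d_def)
    have "d * q v \<le> p v" if "v \<in> V" for v
    proof (cases "q v \<le> 0")
      case True
      then show ?thesis using d(1) insert.prems(1)[of v] that
        by (smt (verit) insertCI mult_nonneg_nonpos)
    next
      case False
      then have "d * q v \<le> c * q v" using d(2) by simp
      then show ?thesis using c(2) that by fastforce
    qed
    moreover have "d * q w \<le> p w" using d(3) False by (simp add: field_simps)
    ultimately show ?thesis using d(1) by auto
  qed
qed

lemma affine_parameter:
  fixes a b c :: real
  assumes "a < b"
  shows "c = (1 - (c - a) / (b - a)) * a + (c - a) / (b - a) * b"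
proof -
  have "(c - a) / (b - a) * (b - a) = c - a" using assms by simp
  then show ?thesis by (simp only: left_diff_distrib right_diff_distrib mult_1)
qed

text \<open>On \<open>S\<close> the norm is the gauge of the section: the weights are those of the
  normalised vector, multiplied by \<open>norm x\<close>.\<close>

lemma norm_attaining_combination:
  fixes x :: "'a::real_normed_vector"
  assumes V: "finite V" "cball 0 1 \<inter> S = convex hull V" and S: "subspace S" "x \<in> S"
  obtains l where "\<And>v. v \<in> V \<Longrightarrow> 0 \<le> l v" "x = (\<Sum>v\<in>V. l v *\<^sub>R v)" "sum l V = norm x"
proof (cases "x = 0")
  case True
  then show thesis using that[of "\<lambda>_. 0"] by simp
next
  case False
  then have "inverse (norm x) *\<^sub>R x \<in> cball 0 1 \<inter> S"
    using S by (simp add: subspace_scale)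
  from this[unfolded V(2) convex_hull_finite[OF V(1)]]
  obtain u where u: "\<And>v. v \<in> V \<Longrightarrow> 0 \<le> u v" "sum u V = 1"
    "inverse (norm x) *\<^sub>R x = (\<Sum>v\<in>V. u v *\<^sub>R v)"
    by fastforce
  show thesis
  proof (rule that[of "\<lambda>v. norm x * u v"])
    have "x = norm x *\<^sub>R (inverse (norm x) *\<^sub>R x)" using False by simp
    also have "\<dots> = (\<Sum>v\<in>V. (norm x * u v) *\<^sub>R v)"
      unfolding u(3) by (simp add: scaleR_sum_right)
    finally show "x = (\<Sum>v\<in>V. (norm x * u v) *\<^sub>R v)" .
  qed (use u in \<open>auto simp: sum_distrib_left[symmetric]\<close>)
qed

text \<open>
  By pigeonhole, the norm-attaining combinations of vertices for the three points have the same
  support; if the norm were not affine, perturbing the combination of an end point would lower its norm.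
\<close>
lemma polygon_affine_triple:
  fixes a y :: "'a::real_normed_vector"
  assumes "polytope (cball 0 1 \<inter> span {a, y})" "infinite T"
  obtains t1 t2 t3 where "t1 \<in> T" "t2 \<in> T" "t3 \<in> T" "t1 < t2" "t2 < t3"
    "(t3 - t1) * norm (a + t2 *\<^sub>R y) = (t3 - t2) * norm (a + t1 *\<^sub>R y) + (t2 - t1) * norm (a + t3 *\<^sub>R y)"
proof -
  obtain V where V: "finite V" "cball 0 1 \<inter> span {a, y} = convex hull V"
    using assms(1) by (auto simp: polytope_def)
  define X where "X t = a + t *\<^sub>R y" for t
  have "X t \<in> span {a, y}" for t
    unfolding X_def by (intro span_add span_scale span_base) simp_all
  then have "\<exists>l. (\<forall>v\<in>V. 0 \<le> l v) \<and> X t = (\<Sum>v\<in>V. l v *\<^sub>R v) \<and> sum l V = norm (X t)" for t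
    using norm_attaining_combination[OF V subspace_span, of "X t"] by metis
  then obtain L where L: "\<And>t v. v \<in> V \<Longrightarrow> 0 \<le> L t v" "\<And>t. X t = (\<Sum>v\<in>V. L t v *\<^sub>R v)"
    "\<And>t. sum (L t) V = norm (X t)"
    by metis
  define I where "I t = {v\<in>V. L t v > 0}" for t
  have "finite (I ` T)"
    by (rule finite_subset[of _ "Pow V"]) (auto simp: I_def V(1))
  then obtain t0 where t0: "infinite {t\<in>T. I t = I t0}"
    using pigeonhole_infinite[OF assms(2)] by blast
  obtain t1 t2 t3 where t: "t1 \<in> T" "t2 \<in> T" "t3 \<in> T" "I t1 = I t0" "I t2 = I t0" "I t3 = I t0"
    "t1 < t2" "t2 < t3"
    by (rule infinite_real_three_points[OF t0]) auto
  define s where "s = (t2 - t1) / (t3 - t1)"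
  have s: "0 \<le> s" "s \<le> 1" "t2 = (1 - s) * t1 + s * t3"
    unfolding s_def using t affine_parameter[of t1 t3 t2] by (simp_all add: field_simps)
  have X2: "X t2 = (1 - s) *\<^sub>R X t1 + s *\<^sub>R X t3"
    by (simp add: X_def s(3) algebra_simps)
  have V_norm: "norm v \<le> 1" if "v \<in> V" for v
    using hull_inc[of v V convex] that V(2) by auto
  have "norm (X t2) = (1 - s) * norm (X t1) + s * norm (X t3)"
  proof (rule antisym)
    show "norm (X t2) \<le> (1 - s) * norm (X t1) + s * norm (X t3)"
      unfolding X2 using s norm_triangle_ineq[of "(1 - s) *\<^sub>R X t1" "s *\<^sub>R X t3"] by simp
    show "(1 - s) * norm (X t1) + s * norm (X t3) \<le> norm (X t2)"
    proof (rule ccontr)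
      assume neg: "\<not> ?thesis"
      define \<nu> where "\<nu> v = (1 - s) * L t1 v + s * L t3 v" for v
      have \<nu>: "sum \<nu> V > norm (X t2)"
        using neg by (simp add: \<nu>_def sum.distrib sum_distrib_left[symmetric] L(3))
      have \<nu>x: "(\<Sum>v\<in>V. \<nu> v *\<^sub>R v) = X t2"
        unfolding X2 L(2)[of t1] L(2)[of t3]
        by (simp add: \<nu>_def scaleR_add_left sum.distrib scaleR_sum_right)
      obtain c where c: "c > 0" "\<forall>v\<in>V. c * (\<nu> v - L t2 v) \<le> L t1 v"
      proof -
        \<comment> \<open>Here the common support is used: a vertex with weight 0 at
          \<open>t1\<close> has weight 0 at \<open>t2\<close> and \<open>t3\<close> too.\<close>
        have "\<nu> v - L t2 v \<le> 0" if v: "v \<in> V" "L t1 v = 0" for v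
        proof -
          have "v \<notin> I t1" using v by (simp add: I_def)
          then have "v \<notin> I t2" "v \<notin> I t3" using t(4-6) by simp_all
          then have "L t3 v = 0" "L t2 v = 0"
            using v(1) L(1)[OF v(1), of t2] L(1)[OF v(1), of t3] by (auto simp: I_def)
          then show ?thesis using v by (simp add: \<nu>_def)
        qed
        then show thesis
          using finite_scale_dominated[OF V(1), of "L t1" "\<lambda>v. \<nu> v - L t2 v"] L(1) that by blast
      qed
      \<comment> \<open>\<open>\<nu>\<close> and \<open>L t2\<close> represent the same point, but
        \<open>\<nu>\<close> has more mass. Exchanging \<open>c\<close> times one for the other
        keeps the point \<open>X t1\<close> and pushes the mass below its norm.\<close>
      have "norm (X t1) = norm (\<Sum>v\<in>V. (L t1 v + c * (L t2 v - \<nu> v)) *\<^sub>R v)"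
      proof -
        have "(\<Sum>v\<in>V. (L t1 v + c * (L t2 v - \<nu> v)) *\<^sub>R v)
            = (\<Sum>v\<in>V. L t1 v *\<^sub>R v) + c *\<^sub>R ((\<Sum>v\<in>V. L t2 v *\<^sub>R v) - (\<Sum>v\<in>V. \<nu> v *\<^sub>R v))"
          by (simp add: algebra_simps sum.distrib sum_subtractf scaleR_sum_right)
        also have "\<dots> = X t1" by (simp add: \<nu>x L(2)[symmetric])
        finally show ?thesis by simp
      qed
      also have "\<dots> \<le> (\<Sum>v\<in>V. norm ((L t1 v + c * (L t2 v - \<nu> v)) *\<^sub>R v))"
        by (rule norm_sum)
      also have "\<dots> \<le> (\<Sum>v\<in>V. L t1 v + c * (L t2 v - \<nu> v))"
      proof (rule sum_mono)
        fix v assume v: "v \<in> V"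
        have "0 \<le> L t1 v + c * (L t2 v - \<nu> v)"
          using c(2) v by (auto simp: algebra_simps)
        then show "norm ((L t1 v + c * (L t2 v - \<nu> v)) *\<^sub>R v) \<le> L t1 v + c * (L t2 v - \<nu> v)"
          using V_norm[OF v] by (simp add: mult_left_le)
      qed
      also have "\<dots> = norm (X t1) + c * (norm (X t2) - sum \<nu> V)"
        by (simp add: sum.distrib sum_distrib_left[symmetric] sum_subtractf L(3))
      also have "\<dots> < norm (X t1)"
        using c(1) \<nu> by (simp add: mult_pos_neg)
      finally show False by simp
    qed
  qed
  moreover have "(t3 - t1) * ((1 - s) * norm (X t1) + s * norm (X t3))
      = (t3 - t2) * norm (X t1) + (t2 - t1) * norm (X t3)"
  proof -
    have "(t3 - t1) * s = t2 - t1" "(t3 - t1) * (1 - s) = t3 - t2"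
      using t by (auto simp: s_def field_simps)
    then show ?thesis by (simp add: distrib_left mult.assoc[symmetric])
  qed
  ultimately show thesis
    using that[OF t(1-3) t(7,8)] by (simp add: X_def)
qed

text \<open>A convex function that meets a chord at an interior point agrees with it. Rational end
  points and a single midpoint equation are extracted because they give countably many closed
  conditions, as Baire category requires.\<close>

lemma polygon_affine_subinterval:
  fixes a y :: "'a::real_normed_vector"
  assumes "polytope (cball 0 1 \<inter> span {a, y})"
  obtains p q where "p \<in> \<rat>" "q \<in> \<rat>" "0 \<le> p" "p < q" "q \<le> 1"
    "norm (a + ((p + q) / 2) *\<^sub>R y) = (norm (a + p *\<^sub>R y) + norm (a + q *\<^sub>R y)) / 2"
proof -
  have "infinite {0..1::real}" by simp
  then obtain t1 t2 t3 where t: "t1 \<in> {0..1}" "t2 \<in> {0..1}" "t3 \<in> {0..1::real}" "t1 < t2" "t2 < t3"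
    and eq: "(t3 - t1) * norm (a + t2 *\<^sub>R y) = (t3 - t2) * norm (a + t1 *\<^sub>R y) + (t2 - t1) * norm (a + t3 *\<^sub>R y)"
    by (rule polygon_affine_triple[OF assms])
  define b where "b = (norm (a + t3 *\<^sub>R y) - norm (a + t1 *\<^sub>R y)) / (t3 - t1)"
  define \<psi> where "\<psi> s = norm (a + s *\<^sub>R y) - (norm (a + t1 *\<^sub>R y) + (s - t1) * b)" for s
  have conv: "\<psi> ((1 - u) * s + u * r) \<le> (1 - u) * \<psi> s + u * \<psi> r" if "0 \<le> u" "u \<le> 1" for u s r
  proof -
    have "a + ((1 - u) * s + u * r) *\<^sub>R y = (1 - u) *\<^sub>R (a + s *\<^sub>R y) + u *\<^sub>R (a + r *\<^sub>R y)"
      by (simp add: algebra_simps)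
    then have "norm (a + ((1 - u) * s + u * r) *\<^sub>R y) \<le> (1 - u) * norm (a + s *\<^sub>R y) + u * norm (a + r *\<^sub>R y)"
      using norm_triangle_ineq[of "(1 - u) *\<^sub>R (a + s *\<^sub>R y)" "u *\<^sub>R (a + r *\<^sub>R y)"] that by simp
    then show ?thesis by (simp add: \<psi>_def algebra_simps)
  qed
  have \<psi>1: "\<psi> t1 = 0" by (simp add: \<psi>_def)
  have \<psi>3: "\<psi> t3 = 0" using t by (simp add: \<psi>_def b_def)
  have \<psi>2: "\<psi> t2 = 0"
  proof -
    have "(t3 - t1) * \<psi> t2 = 0"
    proof -
      have "(t3 - t1) * b = norm (a + t3 *\<^sub>R y) - norm (a + t1 *\<^sub>R y)" using t by (simp add: b_def)
      moreover have "(t3 - t1) * \<psi> t2 = (t3 - t1) * norm (a + t2 *\<^sub>R y) - (t3 - t1) * norm (a + t1 *\<^sub>R y) - (t2 - t1) * ((t3 - t1) * b)"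
        by (simp add: \<psi>_def algebra_simps)
      ultimately show ?thesis by (simp only: eq) (simp add: algebra_simps)
    qed
    then show ?thesis using t by simp
  qed
  \<comment> \<open>Convexity between the zeros \<open>t1\<close> and \<open>t2\<close> gives
    \<open>\<psi> s \<le> 0\<close>. A negative value at \<open>s\<close> would make
    \<open>\<psi>\<close> negative at \<open>t2\<close>, which lies between \<open>s\<close> and the
    zero \<open>t3\<close>.\<close>
  have zero: "\<psi> s = 0" if s: "t1 \<le> s" "s < t2" for s
  proof -
    define u where "u = (s - t1) / (t2 - t1)"
    have u: "0 \<le> u" "u \<le> 1" "s = (1 - u) * t1 + u * t2"
      unfolding u_def using t s affine_parameter[of t1 t2 s] by simp_all
    have "\<psi> s \<le> 0" using conv[OF u(1,2), of t1 t2] \<psi>1 \<psi>2 u(3) by simp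
    define w where "w = (t2 - s) / (t3 - s)"
    have w: "0 \<le> w" "w < 1" "t2 = (1 - w) * s + w * t3"
      unfolding w_def using t s affine_parameter[of s t3 t2] by simp_all
    have "0 \<le> (1 - w) * \<psi> s" using conv[of w s t3] w \<psi>2 \<psi>3 by simp
    then have "0 \<le> \<psi> s" using w by (simp add: zero_le_mult_iff)
    then show ?thesis using \<open>\<psi> s \<le> 0\<close> by simp
  qed
  obtain p where p: "p \<in> \<rat>" "t1 < p" "p < t2" using Rats_dense_in_real[OF t(4)] by blast
  obtain q where q: "q \<in> \<rat>" "p < q" "q < t2" using Rats_dense_in_real[OF p(3)] by blast
  have "\<psi> p = 0" "\<psi> q = 0" "\<psi> ((p + q) / 2) = 0" using p q by (auto intro!: zero)
  then have "norm (a + ((p + q) / 2) *\<^sub>R y) = (norm (a + p *\<^sub>R y) + norm (a + q *\<^sub>R y)) / 2"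
    by (simp add: \<psi>_def field_simps)
  then show thesis using that[of p q] p q t by auto
qed

text \<open>
  The Baire category theorem, applied to the pairs \<open>(a, y)\<close> and the rational subintervals of the
  segment from \<open>a\<close> to \<open>a + y\<close>.
\<close>
lemma polyhedral_midpoint_box:
  fixes x0 :: "'a::banach"
  assumes "polyhedral (norm :: 'a \<Rightarrow> real)" "r > 0"
  obtains u0 v0 :: 'a and s where "s > 0" "(1/2) *\<^sub>R (u0 + v0) \<in> ball x0 r"
    "\<And>u v. u \<in> ball u0 s \<Longrightarrow> v \<in> ball v0 s \<Longrightarrow> norm ((1/2) *\<^sub>R (u + v)) = (norm u + norm v) / 2"
proof -
  define F where "F p q = {c::'a\<times>'a. norm (fst c + ((p + q) / 2) *\<^sub>R snd c)
      = (norm (fst c + p *\<^sub>R snd c) + norm (fst c + q *\<^sub>R snd c)) / 2}" for p q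
  \<comment> \<open>The direction \<open>y\<close> is kept small, so that the midpoint found later
    stays within \<open>r\<close> of \<open>x0\<close> for all admissible \<open>p\<close> and
    \<open>q\<close>.\<close>
  define P where "P = ball x0 (r/2) \<times> ball (0::'a) (r/2)"
  define I where "I = {(p, q). p \<in> \<rat> \<and> q \<in> \<rat> \<and> 0 \<le> p \<and> p < q \<and> q \<le> (1::real)}"
  have P: "open P" "(x0, 0) \<in> P" using assms(2) by (auto simp: P_def open_Times)
  have closed_F: "closed (F p q)" for p q
    unfolding F_def by (intro closed_Collect_eq continuous_intros) simp_all
  have "\<exists>(p, q)\<in>I. interior (F p q) \<inter> P \<noteq> {}"
  proof (rule ccontr)
    assume "\<not> ?thesis"
    then have none: "interior (F p q) \<inter> P = {}" if "(p, q) \<in> I" for p q using that by blast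
    \<comment> \<open>Adding the exterior of \<open>P\<close> makes these sets dense in the whole
      product, so that Baire applies to the full space and the resulting point can still be sought
      in \<open>P\<close>.\<close>
    define \<G> where "\<G> = (\<lambda>(p, q). - F p q \<union> - closure P) ` I"
    have "I \<subseteq> \<rat> \<times> \<rat>" by (auto simp: I_def)
    then have "countable I"
      by (rule countable_subset) (simp add: countable_rat countable_SIGMA)
    then have "countable \<G>" by (simp add: \<G>_def)
    have dense: "open T \<and> closure T = UNIV" if T: "T \<in> \<G>" for T
    proof -
      obtain c where c: "T = (\<lambda>(p, q). - F p q \<union> - closure P) c" "c \<in> I"
        using T unfolding \<G>_def by (rule imageE)
      obtain p q where "c = (p, q)" by (cases c)
      with c have pq: "(p, q) \<in> I" "T = - F p q \<union> - closure P" by simp_all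
      have "interior (F p q) \<inter> closure P = {}"
        using none[OF pq(1)] open_Int_closure_eq_empty[OF open_interior] by blast
      then have "closure T = UNIV"
        using closure_subset[of "- closure P"] by (auto simp: pq(2) closure_Un closure_complement[of "F p q"])
      then show ?thesis using closed_F[of p q] by (simp add: pq(2) open_Un open_Compl)
    qed
    have "Met_TC.mtopology closure_of \<Inter>\<G> = (UNIV :: ('a\<times>'a) set)"
    proof (rule Met_TC.metric_Baire_category[OF _ \<open>countable \<G>\<close>])
      show "Met_TC.mcomplete TYPE('a\<times>'a)"
        using complete_UNIV by (simp add: mcomplete_iff_complete)
    qed (use dense in auto)
    then have "closure (\<Inter>\<G>) = UNIV" by simp
    then have "\<Inter>\<G> \<inter> P \<noteq> {}"
      using open_Int_closure_eq_empty[OF P(1), of "\<Inter>\<G>"] P(2) by blast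
    then obtain a y where ay: "(a, y) \<in> P" "(a, y) \<in> \<Inter>\<G>" by auto
    have "polytope (cball 0 1 \<inter> span {a, y})"
      using assms(1) by (simp add: polyhedral_def unit_ball_norm)
    then obtain p q where "(p, q) \<in> I" "(a, y) \<in> F p q"
      by (rule polygon_affine_subinterval) (auto simp: I_def F_def)
    then show False using ay closure_subset[of P] by (auto simp: \<G>_def)
  qed
  then obtain p q a y where pq: "0 \<le> p" "p < q" "q \<le> 1" and ay: "(a, y) \<in> interior (F p q)" "(a, y) \<in> P"
    by (auto simp: I_def)
  define u0 where "u0 = a + p *\<^sub>R y"
  define v0 where "v0 = a + q *\<^sub>R y"
  \<comment> \<open>The linear inverse of the passage from \<open>(a, y)\<close> to the end points
    \<open>(a + p y, a + q y)\<close>. Through it an open set of pairs \<open>(a, y)\<close> becomes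
    a box in which the two end points vary independently.\<close>
  define k where "k c = (fst c - (p / (q - p)) *\<^sub>R (snd c - fst c), (1 / (q - p)) *\<^sub>R (snd c - fst c))"
    for c :: "'a \<times> 'a"
  have kuv: "u = fst (k (u, v)) + p *\<^sub>R snd (k (u, v))" "v = fst (k (u, v)) + q *\<^sub>R snd (k (u, v))" for u v
  proof -
    have "v = u + (q / (q - p) - p / (q - p)) *\<^sub>R (v - u)"
      using pq by (simp add: diff_divide_distrib[symmetric])
    then show "v = fst (k (u, v)) + q *\<^sub>R snd (k (u, v))"
      unfolding k_def by (simp add: algebra_simps)
  qed (simp add: k_def)
  have "continuous_on UNIV k" unfolding k_def by (intro continuous_intros)
  then have "open (k -` interior (F p q))" by (simp add: open_vimage)
  moreover have "k (u0, v0) = (a, y)"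
  proof -
    have "v0 - u0 = (q - p) *\<^sub>R y" by (simp add: u0_def v0_def algebra_simps)
    then show ?thesis using pq by (simp add: k_def u0_def)
  qed
  then have "(u0, v0) \<in> k -` interior (F p q)" using ay by simp
  ultimately obtain A C where AC: "open A" "open C" "u0 \<in> A" "v0 \<in> C" "A \<times> C \<subseteq> k -` interior (F p q)"
    by (auto elim!: open_prod_elim)
  obtain s1 where s1: "s1 > 0" "ball u0 s1 \<subseteq> A" using AC open_contains_ball by blast
  obtain s2 where s2: "s2 > 0" "ball v0 s2 \<subseteq> C" using AC open_contains_ball by blast
  show thesis
  proof (rule that[of "min s1 s2" u0 v0])
    show "min s1 s2 > 0" using s1 s2 by simp
    have "(1/2) *\<^sub>R (u0 + v0) = a + ((p + q) / 2) *\<^sub>R y"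
      by (simp add: u0_def v0_def algebra_simps add_divide_distrib flip: scaleR_add_left)
    moreover have "norm (((p + q) / 2) *\<^sub>R y) \<le> norm y"
      using pq mult_right_mono[of "(p + q) / 2" 1 "norm y"] by simp
    moreover have "norm (x0 - a) < r/2" "norm y < r/2" using ay(2) by (auto simp: P_def dist_norm)
    ultimately show "(1/2) *\<^sub>R (u0 + v0) \<in> ball x0 r"
      using norm_triangle_ineq4[of "x0 - a" "((p + q) / 2) *\<^sub>R y"] by (simp add: dist_norm algebra_simps)
    fix u v assume "u \<in> ball u0 (min s1 s2)" "v \<in> ball v0 (min s1 s2)"
    then have "u \<in> A" "v \<in> C" using s1(2) s2(2) by auto
    then have "(u, v) \<in> k -` interior (F p q)" using AC(5) by blast
    then have "k (u, v) \<in> F p q" using interior_subset by blast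
    moreover obtain a' y' where k_uv: "k (u, v) = (a', y')" by fastforce
    moreover have uv: "u = a' + p *\<^sub>R y'" "v = a' + q *\<^sub>R y'" using kuv(1)[where u = u and v = v] kuv(2)[where u = u and v = v] k_uv by simp_all
    moreover have "(1/2) *\<^sub>R ((a' + p *\<^sub>R y') + (a' + q *\<^sub>R y')) = a' + ((p + q) / 2) *\<^sub>R y'"
      by (simp add: algebra_simps add_divide_distrib flip: scaleR_add_left)
    ultimately show "norm ((1/2) *\<^sub>R (u + v)) = (norm u + norm v) / 2"
      by (simp add: F_def)
  qed
qed

text \<open>With independent end points the midpoint identity is a Pexider equation: its left side
  depends on \<open>h + h'\<close> only. Hence the increments \<open>k\<close> and \<open>l\<close>
  at the two ends coincide and are additive near 0, and convexity of the norm upgrades additivity to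
  linearity.\<close>

lemma polyhedral_locally_linear:
  fixes x0 :: "'a::banach"
  assumes "polyhedral (norm :: 'a \<Rightarrow> real)" "r > 0"
  obtains m \<rho> and L :: "'a \<Rightarrow>\<^sub>L real" where "m \<in> ball x0 r" "\<rho> > 0" "norm L \<le> 1"
    "\<And>h. norm h < \<rho> \<Longrightarrow> norm (m + h) = norm m + L h"
proof -
  obtain u0 v0 :: 'a and s where s: "s > 0" "(1/2) *\<^sub>R (u0 + v0) \<in> ball x0 r"
    and mid: "\<And>u v. u \<in> ball u0 s \<Longrightarrow> v \<in> ball v0 s \<Longrightarrow> norm ((1/2) *\<^sub>R (u + v)) = (norm u + norm v) / 2"
    using polyhedral_midpoint_box[OF assms] by metis
  define m where "m = (1/2) *\<^sub>R (u0 + v0)"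
  define k where "k h = norm (u0 + h) - norm u0" for h
  define l where "l h = norm (v0 + h) - norm v0" for h
  have mkl: "norm (m + (1/2) *\<^sub>R (h + h')) = norm m + (k h + l h') / 2" if "norm h < s" "norm h' < s" for h h'
  proof -
    have "norm ((1/2) *\<^sub>R ((u0 + h) + (v0 + h'))) = (norm (u0 + h) + norm (v0 + h')) / 2"
      by (rule mid) (use that in \<open>auto simp: dist_norm\<close>)
    moreover have "norm m = (norm u0 + norm v0) / 2"
      unfolding m_def by (rule mid) (use s in auto)
    moreover have "m + (1/2) *\<^sub>R (h + h') = (1/2) *\<^sub>R ((u0 + h) + (v0 + h'))"
      by (simp add: m_def algebra_simps)
    ultimately show ?thesis by (simp add: k_def l_def field_simps)
  qed
  have k0: "k 0 = 0" "l 0 = 0" by (simp_all add: k_def l_def)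
  have kl: "k h = l h" if "norm h < s" for h
    using mkl[of h 0] mkl[of 0 h] that s(1) k0 by simp
  have k_add: "k (h + h') = k h + k h'" if "norm h < s" "norm h' < s" "norm (h + h') < s" for h h'
    using mkl[of h h'] mkl[of "h + h'" 0] that s(1) k0 kl[of h'] by simp
  have k_minus: "k (- h) = - k h" if "norm h < s" for h
    using k_add[of h "- h"] that s(1) k0 by simp
  have k_le: "k (c *\<^sub>R h) \<le> c * k h" if "0 \<le> c" "c \<le> 1" for c h
  proof -
    have "u0 + c *\<^sub>R h = (1 - c) *\<^sub>R u0 + c *\<^sub>R (u0 + h)" by (simp add: algebra_simps)
    then have "norm (u0 + c *\<^sub>R h) \<le> (1 - c) * norm u0 + c * norm (u0 + h)"
      using norm_triangle_ineq[of "(1 - c) *\<^sub>R u0" "c *\<^sub>R (u0 + h)"] that by simp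
    then show ?thesis by (simp add: k_def algebra_simps)
  qed
  \<comment> \<open>Convexity gives one inequality for \<open>h\<close> and one for
    \<open>- h\<close>; oddness turns the second into the reverse of the first.\<close>
  have k_scale: "k (c *\<^sub>R h) = c * k h" if c: "0 \<le> c" "c \<le> 1" and h: "norm h < s" for c h
  proof -
    have "norm (c *\<^sub>R h) < s" using c h mult_left_le_one_le[of "norm h" c] by simp
    then have "k (c *\<^sub>R (- h)) = - k (c *\<^sub>R h)" using k_minus[of "c *\<^sub>R h"] by simp
    then show ?thesis using k_le[OF c, of h] k_le[OF c, of "- h"] k_minus[OF h] by simp
  qed
  \<comment> \<open>A positive factor that brings \<open>y\<close> into the ball of radius
    \<open>s\<close>, where \<open>k\<close> is additive; the summand 1 takes care of
    \<open>y = 0\<close>.\<close>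
  define c where "c y = s / (2 * (norm y + 1))" for y :: 'a
  define Lf where "Lf y = k (c y *\<^sub>R y) / c y" for y
  have c: "c y > 0" "norm (c y *\<^sub>R y) < s" for y
  proof -
    have pos: "2 * (norm y + 1) > 0" by (simp add: add_nonneg_pos)
    then show "c y > 0" using s by (simp add: c_def)
    have "norm y / (2 * (norm y + 1)) < 1" unfolding pos_divide_less_eq[OF pos] by (smt (verit) norm_ge_zero)
    then have "s * (norm y / (2 * (norm y + 1))) < s * 1" using s(1) by (rule mult_strict_left_mono)
    then show "norm (c y *\<^sub>R y) < s" using \<open>c y > 0\<close> s(1) by (simp add: c_def)
  qed
  have kL: "k (d *\<^sub>R y) = d * Lf y" if d: "d > 0" "norm (d *\<^sub>R y) < s" for d y
  proof (cases "d \<le> c y")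
    case True
    have "k ((d / c y) *\<^sub>R (c y *\<^sub>R y)) = d / c y * k (c y *\<^sub>R y)"
      by (rule k_scale) (use d c[of y] True in auto)
    then show ?thesis using c(1)[of y] by (simp add: Lf_def)
  next
    case False
    have "k ((c y / d) *\<^sub>R (d *\<^sub>R y)) = c y / d * k (d *\<^sub>R y)"
      by (rule k_scale) (use d c[of y] False in auto)
    then show ?thesis using c(1)[of y] d by (simp add: Lf_def)
  qed
  have small: "norm (d *\<^sub>R y) < s" if "0 < d" "d \<le> c y" for d y
    using that c(2)[of y] mult_right_mono[of d "c y" "norm y"] by simp
  have Lf_add: "Lf (x + y) = Lf x + Lf y" for x y
  proof -
    define d where "d = min (c x) (min (c y) (c (x + y)))"
    have d: "d > 0" "d \<le> c x" "d \<le> c y" "d \<le> c (x + y)" using c by (auto simp: d_def)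
    have "d * Lf (x + y) = k (d *\<^sub>R x + d *\<^sub>R y)"
      using kL[OF d(1) small[OF d(1,4)]] by (simp add: scaleR_add_right)
    also have "\<dots> = k (d *\<^sub>R x) + k (d *\<^sub>R y)"
      by (rule k_add) (use small d in \<open>auto simp flip: scaleR_add_right simp del: norm_scaleR\<close>)
    also have "\<dots> = d * (Lf x + Lf y)"
      using kL[OF d(1) small[OF d(1,2)]] kL[OF d(1) small[OF d(1,3)]] by (simp add: distrib_left)
    finally show ?thesis using d(1) by simp
  qed
  have Lf0: "Lf 0 = 0" by (simp add: Lf_def k0)
  have Lf_minus: "Lf (- y) = - Lf y" for y
    using Lf_add[of y "- y"] Lf0 by simp
  have Lf_pos: "Lf (a *\<^sub>R y) = a * Lf y" if "a > 0" for a y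
  proof -
    have "k (c (a *\<^sub>R y) *\<^sub>R a *\<^sub>R y) = (c (a *\<^sub>R y) * a) * Lf y"
      using kL[of "c (a *\<^sub>R y) * a" y] c[of "a *\<^sub>R y"] that by (simp add: mult.assoc)
    then show ?thesis
      using kL[OF c(1) c(2), of "a *\<^sub>R y"] c(1)[of "a *\<^sub>R y"] by simp
  qed
  have Lf_scale: "Lf (a *\<^sub>R y) = a * Lf y" for a y
    using Lf_pos[of a y] Lf_pos[of "- a" y] Lf_minus[of "a *\<^sub>R y"] Lf0
    by (cases "a = 0"; cases "a > 0") auto
  have Lf_bound: "\<bar>Lf y\<bar> \<le> norm y" for y
  proof -
    have "\<bar>k (c y *\<^sub>R y)\<bar> \<le> norm (c y *\<^sub>R y)"
      using norm_triangle_ineq3[of "u0 + c y *\<^sub>R y" u0] by (simp add: k_def)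
    then have "\<bar>k (c y *\<^sub>R y)\<bar> / c y \<le> norm y"
      using c(1)[of y] by (simp add: pos_divide_le_eq mult.commute)
    then show ?thesis using c(1)[of y] by (simp add: Lf_def)
  qed
  have "bounded_linear Lf"
    by (rule bounded_linear_intro[where K = 1]) (simp_all add: Lf_add Lf_scale Lf_bound)
  then have L: "blinfun_apply (Blinfun Lf) = Lf" by (simp add: bounded_linear_Blinfun_apply)
  show thesis
  proof (rule that[of m "s / 2" "Blinfun Lf"])
    show "m \<in> ball x0 r" using s(2) by (simp add: m_def)
    show "s / 2 > 0" using s by simp
    show "norm (Blinfun Lf) \<le> 1"
      by (rule norm_blinfun_bound) (auto simp: L Lf_bound)
    fix h :: 'a assume h: "norm h < s / 2"
    have "norm (m + h) = norm (m + (1/2) *\<^sub>R (2 *\<^sub>R h + 0))" by simp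
    also have "\<dots> = norm m + k (2 *\<^sub>R h) / 2"
      using mkl[of "2 *\<^sub>R h" 0] h k0 s(1) by simp
    also have "k (2 *\<^sub>R h) = 2 * Lf h" using kL[of 2 h] h by simp
    finally show "norm (m + h) = norm m + Blinfun Lf h" by (simp add: L)
  qed
qed

text \<open>Near \<open>m\<close> the norm changes only through \<open>L\<close>, so it is constant
  along the level hyperplane of \<open>L\<close> through \<open>m\<close>. After normalisation this
  is a relatively open piece of the face.\<close>

lemma locally_linear_in_minimal_boundary:
  fixes m :: "'a::banach" and L :: "'a \<Rightarrow>\<^sub>L real"
  assumes "m \<noteq> 0" "\<rho> > 0" "norm L \<le> 1" and lin: "\<And>h. norm h < \<rho> \<Longrightarrow> norm (m + h) = norm m + L h"
  shows "L \<in> minimal_boundary norm" "L m = norm m"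
proof -
  have L_le: "L y \<le> norm y" for y
  proof -
    have "norm L * norm y \<le> 1 * norm y" by (rule mult_right_mono[OF assms(3)]) simp
    then show ?thesis using norm_blinfun[of L y] by simp
  qed
  \<comment> \<open>A radial displacement inside the linear region: comparing
    \<open>(1 - t) * norm m\<close> with \<open>norm m - t * L m\<close> yields
    \<open>L m = norm m\<close>.\<close>
  define t where "t = min (1/2) (\<rho> / (2 * norm m))"
  have t: "0 < t" "t < 1" "t * norm m < \<rho>"
  proof -
    show "0 < t" "t < 1" using assms(1,2) by (auto simp: t_def)
    have "t * norm m \<le> \<rho> / (2 * norm m) * norm m" by (rule mult_right_mono) (auto simp: t_def)
    then show "t * norm m < \<rho>" using assms(1,2) by simp
  qed
  have "m + - (t *\<^sub>R m) = (1 - t) *\<^sub>R m" by (simp add: algebra_simps)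
  then have "norm (m + - (t *\<^sub>R m)) = (1 - t) * norm m" using t by simp
  moreover have "norm (m + - (t *\<^sub>R m)) = norm m - t * L m"
    using lin[of "- (t *\<^sub>R m)"] t by (simp add: blinfun.bilinear_simps)
  ultimately have "t * L m = t * norm m" unfolding left_diff_distrib by linarith
  then show Lm: "L m = norm m" using t by simp
  have "norm L * norm m \<ge> 1 * norm m" using norm_blinfun[of L m] Lm by simp
  then have nL: "norm L = 1" using assms(1,3) by simp
  define p where "p = inverse (norm m) *\<^sub>R m"
  have p: "L p = 1" "norm p = 1" using assms(1) Lm by (simp_all add: p_def blinfun.scaleR_right)
  have near: "norm q = 1" if q: "L q = 1" "dist p q < \<rho> / norm m" for q
  proof -
    have "norm (norm m *\<^sub>R (q - p)) < \<rho>"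
      using q(2) assms(1) by (simp add: dist_norm norm_minus_commute pos_less_divide_eq mult.commute)
    then have "norm (m + norm m *\<^sub>R (q - p)) = norm m"
      using lin q(1) p(1) by (simp add: blinfun.bilinear_simps)
    moreover have "m + norm m *\<^sub>R (q - p) = norm m *\<^sub>R q"
      using assms(1) by (simp add: p_def algebra_simps)
    ultimately show "norm q = 1" using assms(1) by simp
  qed
  have "p \<in> face_interior norm L"
    unfolding face_interior_def interior_of_def
  proof (intro CollectI exI[of _ "hyperplane L \<inter> ball p (\<rho> / norm m)"] conjI)
    show "openin (top_of_set (hyperplane L)) (hyperplane L \<inter> ball p (\<rho> / norm m))"
      by (intro openin_open_Int open_ball)
    show "p \<in> hyperplane L \<inter> ball p (\<rho> / norm m)"
      using p assms(1,2) by (simp add: hyperplane_def)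
    show "hyperplane L \<inter> ball p (\<rho> / norm m) \<subseteq> hyperplane L \<inter> unit_ball norm"
      using near by (auto simp: hyperplane_def unit_ball_def)
  qed
  moreover have "hyperplane L \<inter> unit_ball norm \<subseteq> unit_sphere norm"
  proof
    fix q assume "q \<in> hyperplane L \<inter> unit_ball norm"
    then show "q \<in> unit_sphere norm"
      using L_le[of q] by (simp add: hyperplane_def unit_ball_def unit_sphere_def)
  qed
  ultimately show "L \<in> minimal_boundary norm"
    unfolding minimal_boundary_def true_face_def dual_norm_norm using nL by blast
qed

text \<open>Points of local linearity are dense, and the slope at such a point near \<open>y\<close>
  almost attains \<open>norm y\<close>.\<close>

lemma minimal_boundary_norming:
  fixes y :: "'a::banach"
  assumes "polyhedral (norm :: 'a \<Rightarrow> real)" "\<And>f. f \<in> minimal_boundary norm \<Longrightarrow> blinfun_apply f y \<le> 1"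
  shows "norm y \<le> 1"
proof (rule ccontr)
  assume "\<not> ?thesis"
  \<comment> \<open>Passing from \<open>y\<close> to \<open>m\<close> and back costs less than
    \<open>2 r\<close> in total, so a third of the excess leaves \<open>L y\<close> above 1.\<close>
  define r where "r = (norm y - 1) / 3"
  have r: "r > 0" using \<open>\<not> norm y \<le> 1\<close> by (simp add: r_def)
  obtain m \<rho> and L :: "'a \<Rightarrow>\<^sub>L real" where m: "m \<in> ball y r" "\<rho> > 0" "norm L \<le> 1"
    "\<And>h. norm h < \<rho> \<Longrightarrow> norm (m + h) = norm m + L h"
    using polyhedral_locally_linear[OF assms(1) r] by metis
  have "dist y m < r" using m(1) by simp
  then have nm: "norm m > norm y - r"
    using norm_triangle_ineq2[of y m] by (simp add: dist_norm)
  then have "m \<noteq> 0" using r \<open>\<not> norm y \<le> 1\<close> by (auto simp: r_def)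
  note L = locally_linear_in_minimal_boundary[OF this m(2-4)]
  have "norm L * norm (m - y) \<le> 1 * norm (m - y)" by (rule mult_right_mono[OF m(3)]) simp
  then have "L (m - y) < r"
    using norm_blinfun[of L "m - y"] \<open>dist y m < r\<close> by (simp add: dist_norm norm_minus_commute)
  then have "L y > norm y - 2 * r" using L(2) nm by (simp add: blinfun.bilinear_simps)
  moreover have "norm y = 1 + 3 * r" by (simp add: r_def field_simps)
  ultimately have "L y > 1" using r by linarith
  then show False using assms(2)[OF L(1)] by simp
qed

section \<open>Extreme points of the dual ball\<close>

definition sublinear :: "('b::real_vector \<Rightarrow> real) \<Rightarrow> bool" where
  "sublinear p \<longleftrightarrow> (\<forall>x y. p (x + y) \<le> p x + p y) \<and> (\<forall>c\<ge>0. \<forall>x. p (c *\<^sub>R x) = c * p x)"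

lemma sublinearI:
  assumes "\<And>x y. p (x + y) \<le> p x + p y" "p 0 = 0" "\<And>c x. c > 0 \<Longrightarrow> p (c *\<^sub>R x) \<le> c * p x"
  shows "sublinear p"
  unfolding sublinear_def
proof (intro conjI allI impI)
  fix c :: real and x :: 'a
  assume "c \<ge> 0"
  show "p (c *\<^sub>R x) = c * p x"
  proof (cases "c = 0")
    case False
    then have c: "c > 0" using \<open>c \<ge> 0\<close> by simp
    have "p (inverse c *\<^sub>R (c *\<^sub>R x)) \<le> inverse c * p (c *\<^sub>R x)"
      by (rule assms(3)) (use c in simp)
    then have "c * p x \<le> p (c *\<^sub>R x)" using c by (simp add: field_simps)
    then show ?thesis using assms(3)[OF c, of x] by simp
  qed (simp add: assms(2))
qed (rule assms(1))

lemma sublinear_add: "sublinear p \<Longrightarrow> p (x + y) \<le> p x + p y"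
  and sublinear_scale: "sublinear p \<Longrightarrow> 0 \<le> c \<Longrightarrow> p (c *\<^sub>R x) = c * p x"
  by (auto simp: sublinear_def)

lemma sublinear_0: "sublinear p \<Longrightarrow> p 0 = 0"
  using sublinear_scale[of p 0] by simp

lemma sublinear_minus: "sublinear p \<Longrightarrow> - p (- x) \<le> p x"
  using sublinear_add[of p x "- x"] sublinear_0[of p] by simp

text \<open>Zorn's lemma for the reversed pointwise order. The infimum of a chain is finite, because
  a sublinear \<open>q\<close> below \<open>p\<close> satisfies
  \<open>- p (- x) \<le> q x\<close>.\<close>

lemma exists_minimal_sublinear:
  fixes p :: "'b::real_vector \<Rightarrow> real"
  assumes p: "sublinear p"
  obtains m where "sublinear m" "\<And>x. m x \<le> p x"
    "\<And>q. sublinear q \<Longrightarrow> (\<And>x. q x \<le> m x) \<Longrightarrow> q = m"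
proof -
  define A where "A = {q. sublinear q \<and> (\<forall>x. q x \<le> p x)}"
  define P where "P q q' \<longleftrightarrow> (\<forall>x. q' x \<le> q x)" for q q' :: "'b \<Rightarrow> real"
  have "\<exists>m\<in>A. \<forall>a\<in>A. P m a \<longrightarrow> a = m"
  proof (rule predicate_Zorn)
    have "a = b" if "P a b" "P b a" for a b
      using that by (intro ext order_antisym) (auto simp: P_def)
    moreover have "P a c" if "P a b" "P b c" for a b c
      using that by (auto simp: P_def intro: order_trans)
    moreover have "P a a" for a by (simp add: P_def)
    ultimately show "partial_order_on A (relation_of P A)"
      unfolding partial_order_on_def preorder_on_def refl_on_def trans_def antisym_def relation_of_def
      by blast
  next
    fix C assume "C \<in> Chains (relation_of P A)"
    then have C: "C \<subseteq> A" "\<And>q q'. q \<in> C \<Longrightarrow> q' \<in> C \<Longrightarrow> P q q' \<or> P q' q"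
      by (auto simp: Chains_def relation_of_def)
    show "\<exists>u\<in>A. \<forall>a\<in>C. P a u"
    proof (cases "C = {}")
      case True
      then show ?thesis using p by (auto simp: A_def)
    next
      case False
      define u where "u x = (INF q\<in>C. q x)" for x
      have sub: "sublinear q" and le_p: "q x \<le> p x" if "q \<in> C" for q x
        using C(1) that by (auto simp: A_def)
      have "bdd_below ((\<lambda>q. q x) ` C)" for x
      proof (rule bdd_belowI2)
        fix q assume "q \<in> C"
        then show "- p (- x) \<le> q x" using sublinear_minus[OF sub, of q x] le_p[of q "- x"] by simp
      qed
      then have u_le: "u x \<le> q x" if "q \<in> C" for q x
        unfolding u_def by (rule cINF_lower) (use that in simp)
      have u_greatest: "b \<le> u x" if "\<And>q. q \<in> C \<Longrightarrow> b \<le> q x" for b x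
        unfolding u_def by (rule cINF_greatest) (use False that in auto)
      have "sublinear u"
      proof (rule sublinearI)
        fix x y
        \<comment> \<open>The infima at \<open>x\<close> and \<open>y\<close> are approached by
          different members of the chain; the smaller member serves for both.\<close>
        have *: "u (x + y) \<le> q x + q' y" if q: "q \<in> C" "q' \<in> C" for q q'
        proof -
          obtain q'' where "q'' \<in> C" "q'' x \<le> q x" "q'' y \<le> q' y"
            using C(2)[OF q] q by (auto simp: P_def)
          then show ?thesis
            using u_le[of q'' "x + y"] sublinear_add[OF sub, of q'' x y] by simp
        qed
        have "u (x + y) - q' y \<le> u x" if "q' \<in> C" for q'
          by (rule u_greatest) (use *[OF _ that] in \<open>simp add: algebra_simps\<close>)
        then have "u (x + y) - u x \<le> u y"
          by (intro u_greatest) (simp add: algebra_simps)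
        then show "u (x + y) \<le> u x + u y" by simp
      next
        obtain q where "q \<in> C" using False by auto
        then have "u 0 \<le> 0" using u_le[of q 0] sublinear_0[OF sub[OF \<open>q \<in> C\<close>]] by simp
        moreover have "0 \<le> q 0" if "q \<in> C" for q
          using sublinear_0[OF sub[OF that]] by simp
        then have "0 \<le> u 0" by (rule u_greatest)
        ultimately show "u 0 = 0" by simp
      next
        fix c x assume c: "(c::real) > 0"
        have "u (c *\<^sub>R x) / c \<le> u x"
        proof (rule u_greatest)
          fix q assume "q \<in> C"
          then show "u (c *\<^sub>R x) / c \<le> q x"
            using u_le[of q "c *\<^sub>R x"] sublinear_scale[OF sub, of q c x] c by (simp add: field_simps)
        qed
        then show "u (c *\<^sub>R x) \<le> c * u x" using c by (simp add: field_simps)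
      qed
      moreover have "u x \<le> p x" for x
      proof -
        obtain q where "q \<in> C" using False by auto
        then show ?thesis using u_le[of q x] le_p[of q x] by simp
      qed
      ultimately show ?thesis using u_le by (auto simp: A_def P_def)
    qed
  qed
  then obtain m where m: "m \<in> A" "\<And>q. q \<in> A \<Longrightarrow> P m q \<Longrightarrow> q = m" by blast
  show thesis
  proof (rule that)
    show "sublinear m" and m_le: "m x \<le> p x" for x
      using m(1) by (simp_all add: A_def)
    fix q assume q: "sublinear q" "\<And>x. q x \<le> m x"
    then have "q x \<le> p x" for x using m_le[of x] order_trans by blast
    then show "q = m" using q by (intro m(2)) (simp_all add: A_def P_def)
  qed
qed

text \<open>The Hahn-Banach theorem: a minimal sublinear functional is linear.\<close>
theorem sublinear_dominates_linear:
  fixes p :: "'b::real_vector \<Rightarrow> real"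
  assumes "sublinear p"
  obtains g where "linear g" "\<And>x. g x \<le> p x"
proof -
  obtain m where m: "sublinear m" "\<And>x. m x \<le> p x"
    and min: "\<And>q. sublinear q \<Longrightarrow> (\<And>x. q x \<le> m x) \<Longrightarrow> q = m"
    using exists_minimal_sublinear[OF assms] by metis
  have add: "m (y + a) = m y + m a" for y a
  proof -
    \<comment> \<open>The competitor to \<open>m\<close>: it is sublinear, lies below
      \<open>m\<close> by \<open>s = 0\<close>, and \<open>s = 1\<close> bounds it by
      \<open>m (y + a) - m a\<close>. Minimality \<open>q = m\<close> then gives
      superadditivity.\<close>
    define q where "q y = (INF s\<in>{0..}. m (y + s *\<^sub>R a) - s * m a)" for y
    have "bdd_below ((\<lambda>s. m (y + s *\<^sub>R a) - s * m a) ` {0..})" for y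
    proof (rule bdd_belowI2)
      fix s :: real assume "s \<in> {0..}"
      then show "- m (- y) \<le> m (y + s *\<^sub>R a) - s * m a"
        using sublinear_add[OF m(1), of "y + s *\<^sub>R a" "- y"] sublinear_scale[OF m(1), of s a] by simp
    qed
    then have q_le: "q y \<le> m (y + s *\<^sub>R a) - s * m a" if "s \<ge> 0" for y s
      unfolding q_def by (rule cINF_lower) (use that in simp)
    have q_greatest: "b \<le> q y" if "\<And>s. s \<ge> 0 \<Longrightarrow> b \<le> m (y + s *\<^sub>R a) - s * m a" for b y
      unfolding q_def by (rule cINF_greatest) (use that in auto)
    have "sublinear q"
    proof (rule sublinearI)
      fix x y
      have *: "q (x + y) \<le> (m (x + s *\<^sub>R a) - s * m a) + (m (y + t *\<^sub>R a) - t * m a)"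
        if "s \<ge> 0" "t \<ge> 0" for s t
      proof -
        have "q (x + y) \<le> m ((x + s *\<^sub>R a) + (y + t *\<^sub>R a)) - (s + t) * m a"
          using q_le[of "s + t" "x + y"] that by (simp add: algebra_simps)
        then show ?thesis
          using sublinear_add[OF m(1), of "x + s *\<^sub>R a" "y + t *\<^sub>R a"] by (simp add: algebra_simps)
      qed
      have "q (x + y) - (m (y + t *\<^sub>R a) - t * m a) \<le> q x" if "t \<ge> 0" for t
        by (rule q_greatest) (use *[OF _ that] in \<open>simp add: algebra_simps\<close>)
      then have "q (x + y) - q x \<le> q y"
        by (intro q_greatest) (simp add: algebra_simps)
      then show "q (x + y) \<le> q x + q y" by simp
    next
      have "q 0 \<le> 0" using q_le[of 0 0] sublinear_0[OF m(1)] by simp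
      moreover have "0 \<le> q 0" by (rule q_greatest) (simp add: sublinear_scale[OF m(1)])
      ultimately show "q 0 = 0" by simp
    next
      fix c x assume c: "(c::real) > 0"
      have "q (c *\<^sub>R x) / c \<le> q x"
      proof (rule q_greatest)
        fix s :: real assume s: "s \<ge> 0"
        have "q (c *\<^sub>R x) \<le> m (c *\<^sub>R (x + s *\<^sub>R a)) - (c * s) * m a"
          using q_le[of "c * s" "c *\<^sub>R x"] c s by (simp add: scaleR_add_right)
        also have "\<dots> = c * (m (x + s *\<^sub>R a) - s * m a)"
          using sublinear_scale[OF m(1), of c "x + s *\<^sub>R a"] c by (simp add: right_diff_distrib)
        finally show "q (c *\<^sub>R x) / c \<le> m (x + s *\<^sub>R a) - s * m a" using c by (simp add: field_simps)
      qed
      then show "q (c *\<^sub>R x) \<le> c * q x" using c by (simp add: field_simps)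
    qed
    then have "q = m" using min q_le[of 0] by simp
    then have "m y \<le> m (y + a) - m a" using q_le[of 1 y] by simp
    then show ?thesis using sublinear_add[OF m(1), of y a] by simp
  qed
  have minus: "m (- x) = - m x" for x
    using add[of x "- x"] sublinear_0[OF m(1)] by simp
  have "m (c *\<^sub>R x) = c * m x" for c x
    using sublinear_scale[OF m(1), of "\<bar>c\<bar>" x] minus[of "c *\<^sub>R x"] by (cases "c \<ge> 0") auto
  then have "linear m" using add by (intro linearI) auto
  then show thesis using that m(2) by blast
qed

section \<open>Extreme functionals below a maximum of two sublinear functionals\<close>

text \<open>Where \<open>p\<close> is positive one normalises. Where \<open>p y \<le> 0\<close> the
  whole ray through \<open>y\<close> satisfies \<open>p \<le> 1\<close>, which forces
  \<open>G y \<le> 0\<close>; this explains the \<open>max\<close>.\<close>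

lemma linear_le_sublinear:
  fixes G :: "'b::real_vector \<Rightarrow> real"
  assumes "linear G" "sublinear p" "\<And>y. p y \<le> 1 \<Longrightarrow> G y \<le> s"
  shows "G y \<le> s * max (p y) 0"
proof (cases "p y > 0")
  case True
  then have "p (inverse (p y) *\<^sub>R y) = 1" by (simp add: sublinear_scale[OF assms(2)])
  then have "G (inverse (p y) *\<^sub>R y) \<le> s" using assms(3) by simp
  then show ?thesis using True by (simp add: linear_scale[OF assms(1)] field_simps)
next
  case False
  have "c * G y \<le> s" if "c > 0" for c
  proof -
    have "p (c *\<^sub>R y) \<le> 1"
      using False that by (simp add: sublinear_scale[OF assms(2)]) (smt (verit) mult_nonneg_nonpos)
    then show ?thesis using assms(3)[of "c *\<^sub>R y"] by (simp add: linear_scale[OF assms(1)])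
  qed
  moreover have "\<exists>c>0. c * G y > s" if "G y > 0"
    using that by (intro exI[of _ "(\<bar>s\<bar> + 1) / G y"]) auto
  ultimately have "G y \<le> 0" by (meson not_less)
  then show ?thesis using False by simp
qed

text \<open>A nonzero functional that still fits after division by \<open>c < 1\<close> lies
  strictly between 0 and \<open>g / c\<close>.\<close>

lemma extreme_functional_zero:
  fixes N :: "'b::real_normed_vector \<Rightarrow> real"
  assumes N: "\<And>y. 0 \<le> N y"
    and g: "g extreme_point_of {h. \<forall>y. blinfun_apply h y \<le> N y}"
    and c: "0 \<le> c" "c < 1" "\<And>y. blinfun_apply g y \<le> c * N y"
  shows "g = 0"
proof (rule ccontr)
  assume "g \<noteq> 0"
  show False
  proof (cases "c = 0")
    case True
    then have "blinfun_apply g y = 0" for y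
      using c(3)[of y] c(3)[of "- y"] by (simp add: blinfun.minus_right)
    then show False using \<open>g \<noteq> 0\<close> by (auto intro: blinfun_eqI)
  next
    case False
    define h where "h = inverse c *\<^sub>R g"
    have "blinfun_apply h y \<le> N y" for y
      using c False by (simp add: h_def blinfun.scaleR_left field_simps)
    moreover have "g \<in> open_segment 0 h"
      unfolding in_segment using c False \<open>g \<noteq> 0\<close> by (auto simp: h_def intro!: exI[of _ c])
    ultimately show False
      using g N by (auto simp: extreme_point_of_def)
  qed
qed

text \<open>
  The dual ball of \<open>max p1 p2\<close> is the convex hull of the dual balls of \<open>p1\<close> and \<open>p2\<close>, by Hahn-Banach;
  so an extreme point lies in one of the two.
\<close>
lemma extreme_functional_dichotomy:
  fixes N p1 p2 :: "'b::real_normed_vector \<Rightarrow> real"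
  assumes p: "sublinear p1" "sublinear p2"
    and N: "\<And>y. N y = max (p1 y) (p2 y)" "\<And>y. 0 \<le> N y" "\<And>y. N y \<le> C * norm y"
    and x: "p1 x = 1" "p1 (- x) = - 1" "p2 x \<le> d" "0 \<le> d"
    and g: "g extreme_point_of {h. \<forall>y. blinfun_apply h y \<le> N y}"
  shows "blinfun_apply g x = 1 \<or> blinfun_apply g x \<le> d"
proof -
  have gN: "blinfun_apply g y \<le> N y" for y using g by (simp add: extreme_point_of_def)
  \<comment> \<open>Chosen so that \<open>G1 \<le> r\<close> means exactly
    \<open>G1 y1 + (g - G1) y2 \<le> max (p1 y1) (p2 y2)\<close>: a linear functional below
    \<open>r\<close> splits \<open>g\<close> into a part seen by \<open>p1\<close> and a part seen
    by \<open>p2\<close>.\<close>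
  define r where "r y = (INF z. max (p1 (y + z)) (p2 z) - blinfun_apply g z)" for y
  have "bdd_below (range (\<lambda>z. max (p1 (y + z)) (p2 z) - blinfun_apply g z))" for y
  proof (rule bdd_belowI2)
    fix z
    show "- max (p1 (- y)) 0 \<le> max (p1 (y + z)) (p2 z) - blinfun_apply g z"
      using gN[of z] N(1)[of z] sublinear_add[OF p(1), of "y + z" "- y"] by simp
  qed
  then have r_le: "r y \<le> max (p1 (y + z)) (p2 z) - blinfun_apply g z" for y z
    unfolding r_def by (rule cINF_lower) simp
  have r_greatest: "b \<le> r y" if "\<And>z. b \<le> max (p1 (y + z)) (p2 z) - blinfun_apply g z" for b y
    unfolding r_def by (rule cINF_greatest) (use that in auto)
  have "sublinear r"
  proof (rule sublinearI)
    fix y y'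
    have *: "r (y + y') \<le> (max (p1 (y + z)) (p2 z) - blinfun_apply g z) + (max (p1 (y' + z')) (p2 z') - blinfun_apply g z')"
      for z z'
      using r_le[of "y + y'" "z + z'"] sublinear_add[OF p(1), of "y + z" "y' + z'"] sublinear_add[OF p(2), of z z']
      by (simp add: blinfun.add_right add_ac)
    have "r (y + y') - (max (p1 (y' + z')) (p2 z') - blinfun_apply g z') \<le> r y" for z'
      by (rule r_greatest) (use *[of _ z'] in \<open>simp add: algebra_simps\<close>)
    then have "r (y + y') - r y \<le> r y'"
      by (intro r_greatest) (simp add: algebra_simps)
    then show "r (y + y') \<le> r y + r y'" by simp
  next
    have "r 0 \<le> 0" using r_le[of 0 0] sublinear_0[OF p(1)] sublinear_0[OF p(2)] by simp
    moreover have "0 \<le> r 0" by (rule r_greatest) (use gN N(1) in simp)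
    ultimately show "r 0 = 0" by simp
  next
    fix c y assume c: "(c::real) > 0"
    have "r (c *\<^sub>R y) / c \<le> r y"
    proof (rule r_greatest)
      fix z
      have "r (c *\<^sub>R y) \<le> max (p1 (c *\<^sub>R (y + z))) (p2 (c *\<^sub>R z)) - blinfun_apply g (c *\<^sub>R z)"
        using r_le[of "c *\<^sub>R y" "c *\<^sub>R z"] by (simp add: scaleR_add_right)
      also have "\<dots> = c * (max (p1 (y + z)) (p2 z) - blinfun_apply g z)"
        using c by (simp add: sublinear_scale[OF p(1)] sublinear_scale[OF p(2)] blinfun.scaleR_right
            max_mult_distrib_left right_diff_distrib)
      finally show "r (c *\<^sub>R y) / c \<le> max (p1 (y + z)) (p2 z) - blinfun_apply g z"
        using c by (simp add: field_simps)
    qed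
    then show "r (c *\<^sub>R y) \<le> c * r y" using c by (simp add: field_simps)
  qed
  then obtain G1 where G1: "linear G1" "\<And>y. G1 y \<le> r y"
    using sublinear_dominates_linear by blast
  define G2 where "G2 y = blinfun_apply g y - G1 y" for y
  have G2: "linear G2"
    by (rule linearI) (simp_all add: G2_def linear_add[OF G1(1)] linear_scale[OF G1(1)] blinfun.bilinear_simps algebra_simps)
  have G12: "G1 y1 + G2 y2 \<le> max (p1 y1) (p2 y2)" for y1 y2
    using G1(2)[of "y1 - y2"] r_le[of "y1 - y2" y2] by (simp add: G2_def linear_diff[OF G1(1)])
  have G0: "G1 0 = 0" "G2 0 = 0" by (simp_all add: linear_0 G1 G2)
  \<comment> \<open>\<open>s1\<close> and \<open>s2\<close> are the sizes of the two parts. Since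
    \<open>y1\<close> and \<open>y2\<close> vary independently in \<open>G12\<close>, the sizes add
    up to at most 1.\<close>
  define s1 where "s1 = (SUP y\<in>{y. p1 y \<le> 1}. G1 y)"
  define s2 where "s2 = (SUP y\<in>{y. p2 y \<le> 1}. G2 y)"
  have "bdd_above (G1 ` {y. p1 y \<le> 1})"
    by (rule bdd_aboveI2[of _ _ 1]) (use G12[of _ 0] G0 sublinear_0[OF p(2)] in \<open>smt (verit) mem_Collect_eq\<close>)
  then have s1: "G1 y \<le> s1" if "p1 y \<le> 1" for y
    unfolding s1_def by (rule cSUP_upper[rotated]) (use that in simp)
  have "bdd_above (G2 ` {y. p2 y \<le> 1})"
    by (rule bdd_aboveI2[of _ _ 1]) (use G12[of 0] G0 sublinear_0[OF p(1)] in \<open>smt (verit) mem_Collect_eq\<close>)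
  then have s2: "G2 y \<le> s2" if "p2 y \<le> 1" for y
    unfolding s2_def by (rule cSUP_upper[rotated]) (use that in simp)
  have s_nonneg: "0 \<le> s1" "0 \<le> s2"
    using s1[of 0] s2[of 0] G0 sublinear_0[OF p(1)] sublinear_0[OF p(2)] by simp_all
  have "s1 \<le> 1 - G2 y" if "p2 y \<le> 1" for y
    unfolding s1_def
  proof (rule cSUP_least)
    have "0 \<in> {y. p1 y \<le> 1}" using sublinear_0[OF p(1)] by simp
    then show "{y. p1 y \<le> 1} \<noteq> {}" by blast
    fix z assume "z \<in> {y. p1 y \<le> 1}"
    then show "G1 z \<le> 1 - G2 y" using G12[of z y] that by simp
  qed
  note s1_le = this
  have "s2 \<le> 1 - s1"
    unfolding s2_def
  proof (rule cSUP_least)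
    have "0 \<in> {y. p2 y \<le> 1}" using sublinear_0[OF p(2)] by simp
    then show "{y. p2 y \<le> 1} \<noteq> {}" by blast
    fix z assume "z \<in> {y. p2 y \<le> 1}"
    then show "G2 z \<le> 1 - s1" using s1_le[of z] by simp
  qed
  then have s_sum: "s1 + s2 \<le> 1" by simp
  have G1_le: "G1 y \<le> s1 * max (p1 y) 0" for y
    by (rule linear_le_sublinear[OF G1(1) p(1) s1])
  have G2_le: "G2 y \<le> s2 * max (p2 y) 0" for y
    by (rule linear_le_sublinear[OF G2 p(2) s2])
  have pN: "max (p1 y) 0 \<le> N y" "max (p2 y) 0 \<le> N y" for y
    using N(1,2)[of y] by auto
  have G1N: "G1 y \<le> s1 * N y" and G2N: "G2 y \<le> s2 * N y" for y
    using G1_le[of y] G2_le[of y] mult_left_mono[OF pN(1) s_nonneg(1), of y]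
      mult_left_mono[OF pN(2) s_nonneg(2), of y] by linarith+
  have g_sum: "blinfun_apply g y = G1 y + G2 y" for y by (simp add: G2_def)
  have vanish: "G y = 0" if "linear G" "\<And>y. G y \<le> 0" for G :: "'b \<Rightarrow> real" and y
    using that(2)[of y] that(2)[of "- y"] by (simp add: linear_neg[OF that(1)])
  show ?thesis
  proof (cases "s1 = 0 \<or> s2 = 0 \<or> s1 + s2 < 1")
    case True
    then consider "s1 = 0" | "s2 = 0" | "s1 + s2 < 1" by blast
    then show ?thesis
    proof cases
      case 1
      then have "G1 x = 0" using vanish[OF G1(1)] G1_le by simp
      then have "blinfun_apply g x \<le> s2 * max (p2 x) 0" using G2_le[of x] by (simp add: g_sum)
      also have "\<dots> \<le> 1 * d" by (rule mult_mono) (use s_sum s_nonneg x in auto)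
      finally show ?thesis by simp
    next
      case 2
      then have "G2 y = 0" for y using vanish[OF G2] G2_le by simp
      moreover have "s1 * max (p1 y) 0 \<le> 1 * max (p1 y) 0" for y
        by (rule mult_right_mono) (use s_sum s_nonneg in auto)
      ultimately have g_le: "blinfun_apply g y \<le> max (p1 y) 0" for y
        using G1_le[of y] by (simp add: g_sum) (meson order_trans)
      define c where "c = blinfun_apply g x"
      have c: "0 \<le> c" "c \<le> 1"
        using g_le[of x] g_le[of "- x"] x by (simp_all add: c_def blinfun.minus_right)
      \<comment> \<open>The values of \<open>p1\<close> at \<open>x\<close> and \<open>- x\<close>
        make it linear along \<open>x\<close>. Moving from \<open>y\<close> by \<open>- p1 y\<close>
        times \<open>x\<close> reaches a point with \<open>p1 \<le> 0\<close>, where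
        \<open>g \<le> 0\<close>; so \<open>g\<close> is dominated by \<open>c\<close> times
        \<open>p1\<close>, and extremality leaves only \<open>c = 1\<close> or
        \<open>g = 0\<close>.\<close>
      have "blinfun_apply g y \<le> c * p1 y" for y
      proof -
        have "p1 (y + a *\<^sub>R x) \<le> p1 y + a" for a
        proof (cases "a \<ge> 0")
          case True
          then show ?thesis using sublinear_add[OF p(1), of y "a *\<^sub>R x"] sublinear_scale[OF p(1), of a x] x by simp
        next
          case False
          then show ?thesis using sublinear_add[OF p(1), of y "(- a) *\<^sub>R (- x)"] sublinear_scale[OF p(1), of "- a" "- x"] x by simp
        qed
        from this[of "- p1 y"] show ?thesis
          using g_le[of "y + (- p1 y) *\<^sub>R x"] by (simp add: c_def blinfun.bilinear_simps mult.commute)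
      qed
      moreover have "c * p1 y \<le> c * N y" for y
        using mult_left_mono[OF _ c(1), of "p1 y" "N y"] N(1)[of y] by simp
      ultimately have "blinfun_apply g y \<le> c * N y" for y by (meson order_trans)
      then have "c < 1 \<Longrightarrow> g = 0" using extreme_functional_zero[OF N(2) g c(1)] by blast
      then show ?thesis using c x(4) by (cases "c = 1") (auto simp: c_def)
    next
      case 3
      have "blinfun_apply g y \<le> (s1 + s2) * N y" for y
        using G1N[of y] G2N[of y] by (simp add: g_sum distrib_right)
      then have "g = 0" using extreme_functional_zero[OF N(2) g _ 3] s_nonneg by simp
      then show ?thesis using x(4) by simp
    qed
  next
    case False
    then have s: "s1 > 0" "s2 > 0" "s1 + s2 = 1" using s_nonneg s_sum by auto
    have C0: "N y \<le> \<bar>C\<bar> * norm y" for y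
      using N(3)[of y] mult_right_mono[OF abs_ge_self[of C] norm_ge_zero[of y]] by linarith
    have bl: "bounded_linear (\<lambda>y. inverse s * G y)"
      if lin: "linear G" and le: "\<And>y. G y \<le> s * N y" and "0 < s" for G s
    proof (rule bounded_linear_intro[where K = "\<bar>C\<bar>"])
      fix y
      have "G z \<le> s * (\<bar>C\<bar> * norm z)" for z
        using le[of z] mult_left_mono[OF C0[of z], of s] \<open>0 < s\<close> by linarith
      from this[of y] this[of "- y"] have "\<bar>G y\<bar> \<le> s * (\<bar>C\<bar> * norm y)"
        by (simp add: linear_neg[OF lin])
      then show "norm (inverse s * G y) \<le> norm y * \<bar>C\<bar>"
        using \<open>0 < s\<close> by (simp add: abs_mult field_simps)
    qed (simp_all add: linear_add[OF lin] linear_scale[OF lin] algebra_simps)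
    define g1 where "g1 = Blinfun (\<lambda>y. inverse s1 * G1 y)"
    define g2 where "g2 = Blinfun (\<lambda>y. inverse s2 * G2 y)"
    have g1: "blinfun_apply g1 y = inverse s1 * G1 y" and g2: "blinfun_apply g2 y = inverse s2 * G2 y" for y
      using bl[OF G1(1) G1N s(1)] bl[OF G2 G2N s(2)]
      by (simp_all add: g1_def g2_def bounded_linear_Blinfun_apply)
    have g1_in: "blinfun_apply g1 y \<le> N y" and g2_in: "blinfun_apply g2 y \<le> N y" for y
      using G1N[of y] G2N[of y] s by (simp_all add: g1 g2 field_simps)
    have g_eq: "g = (1 - s2) *\<^sub>R g1 + s2 *\<^sub>R g2"
    proof (rule blinfun_eqI)
      fix y
      have "1 - s2 = s1" using s by simp
      then have "blinfun_apply ((1 - s2) *\<^sub>R g1 + s2 *\<^sub>R g2) y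
          = s1 * (inverse s1 * G1 y) + s2 * (inverse s2 * G2 y)"
        by (simp only: blinfun.bilinear_simps g1 g2) simp
      also have "\<dots> = G1 y + G2 y"
        using s(1,2) by (simp flip: mult.assoc)
      finally show "blinfun_apply g y = blinfun_apply ((1 - s2) *\<^sub>R g1 + s2 *\<^sub>R g2) y"
        by (simp add: g_sum)
    qed
    \<comment> \<open>Both parts are nonzero and normalised to the dual ball, so extremality makes
      them equal. Thus \<open>g\<close> is the normalised \<open>p2\<close> part and inherits its
      bound at \<open>x\<close>.\<close>
    have "g1 = g2"
    proof (rule ccontr)
      assume "g1 \<noteq> g2"
      then have "g \<in> open_segment g1 g2"
        unfolding in_segment using s g_eq by auto
      then show False using g g1_in g2_in by (auto simp: extreme_point_of_def)
    qed
    then have "g = g2" using g_eq by (simp flip: scaleR_add_left)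
    then have "blinfun_apply g x \<le> max (p2 x) 0"
      using G2_le[of x] s by (simp add: g2 field_simps)
    then show ?thesis using x by auto
  qed
qed

section \<open>Weak-star compactness\<close>

text \<open>Banach-Alaoglu: evaluation identifies the ball with a closed set \<open>Y\<close> of
  linear functions in a product of compact intervals. The topology is the pullback along evaluation,
  so open covers can be transported to \<open>Y\<close>.\<close>

theorem compactin_dual_ball:
  "compactin strong_operator_topology {g :: 'a::real_normed_vector \<Rightarrow>\<^sub>L real. norm g \<le> 1}"
proof -
  define Y where "Y = {\<phi> :: 'a \<Rightarrow> real. (\<forall>x. \<bar>\<phi> x\<bar> \<le> norm x) \<and> (\<forall>x y. \<phi> (x + y) = \<phi> x + \<phi> y) \<and> (\<forall>c x. \<phi> (c *\<^sub>R x) = c * \<phi> x)}"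
  have Y_eq: "Y = (\<Pi>\<^sub>E x\<in>UNIV. cball 0 (norm x)) \<inter> ((\<Inter>x. \<Inter>y. {\<phi>. \<phi> (x + y) = \<phi> x + \<phi> y}) \<inter> (\<Inter>c. \<Inter>x. {\<phi>. \<phi> (c *\<^sub>R x) = c * \<phi> x}))"
    by (auto simp: Y_def PiE_def Pi_def)
  have "compactin (product_topology (\<lambda>_. euclidean) UNIV) (\<Pi>\<^sub>E x\<in>(UNIV :: 'a set). cball (0::real) (norm x))"
    by (simp add: compactin_PiE)
  then have "compact (\<Pi>\<^sub>E x\<in>(UNIV :: 'a set). cball (0::real) (norm x))"
    by (simp add: euclidean_product_topology)
  moreover have "closed {\<phi> :: 'a \<Rightarrow> real. \<phi> (x + y) = \<phi> x + \<phi> y}"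
    and "closed {\<phi> :: 'a \<Rightarrow> real. \<phi> (c *\<^sub>R x) = c * \<phi> x}" for c x y
    by (intro closed_Collect_eq continuous_intros continuous_on_product_coordinates)+
  ultimately have "compact Y"
    unfolding Y_eq by (intro compact_Int_closed closed_Int closed_INT ballI)
  have Y_image: "Y = blinfun_apply ` {g. norm g \<le> 1}"
  proof
    show "Y \<subseteq> blinfun_apply ` {g. norm g \<le> 1}"
    proof
      fix \<phi> assume \<phi>: "\<phi> \<in> Y"
      then have "bounded_linear \<phi>"
        by (intro bounded_linear_intro[where K = 1]) (simp_all add: Y_def)
      then have eq: "blinfun_apply (Blinfun \<phi>) = \<phi>" by (simp add: bounded_linear_Blinfun_apply)
      then have "norm (Blinfun \<phi>) \<le> 1"
        using \<phi> by (intro norm_blinfun_bound) (simp_all add: Y_def)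
      then show "\<phi> \<in> blinfun_apply ` {g. norm g \<le> 1}" using eq by (metis image_eqI mem_Collect_eq)
    qed
    show "blinfun_apply ` {g. norm g \<le> 1} \<subseteq> Y"
    proof clarify
      fix g :: "'a \<Rightarrow>\<^sub>L real" assume g: "norm g \<le> 1"
      have "\<bar>g x\<bar> \<le> norm x" for x
        using norm_blinfun[of g x] mult_right_mono[OF g norm_ge_zero[of x]] by simp
      then show "blinfun_apply g \<in> Y" by (simp add: Y_def blinfun.bilinear_simps)
    qed
  qed
  show ?thesis
    unfolding compactin_def
  proof (intro conjI allI impI)
    show "{g :: 'a \<Rightarrow>\<^sub>L real. norm g \<le> 1} \<subseteq> topspace strong_operator_topology"
      by (simp add: strong_operator_topology_topspace)
    fix \<U> :: "('a \<Rightarrow>\<^sub>L real) set set"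
    assume \<U>: "(\<forall>U\<in>\<U>. openin strong_operator_topology U) \<and> {g. norm g \<le> 1} \<subseteq> \<Union>\<U>"
    define \<V> where "\<V> = {V. open V \<and> blinfun_apply -` V \<in> \<U>}"
    have "Y \<subseteq> \<Union>\<V>"
    proof
      fix \<phi> assume "\<phi> \<in> Y"
      then obtain g where g: "\<phi> = blinfun_apply g" "norm g \<le> 1" unfolding Y_image by auto
      then obtain U where U: "U \<in> \<U>" "g \<in> U" using \<U> by auto
      then obtain V where "open V" "U = blinfun_apply -` V"
        using \<U> by (auto simp: strong_operator_topology_def openin_pullback_topology)
      then show "\<phi> \<in> \<Union>\<V>" using U g by (auto simp: \<V>_def)
    qed
    moreover have "\<forall>V\<in>\<V>. open V" by (simp add: \<V>_def)
    ultimately obtain \<D> where \<D>: "\<D> \<subseteq> \<V>" "finite \<D>" "Y \<subseteq> \<Union>\<D>"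
      using \<open>compact Y\<close> by (metis compactE)
    show "\<exists>\<F>. finite \<F> \<and> \<F> \<subseteq> \<U> \<and> {g. norm g \<le> 1} \<subseteq> \<Union>\<F>"
    proof (intro exI conjI)
      show "finite ((\<lambda>V. blinfun_apply -` V) ` \<D>)" using \<D> by simp
      show "(\<lambda>V. blinfun_apply -` V) ` \<D> \<subseteq> \<U>" using \<D>(1) by (auto simp: \<V>_def)
      show "{g. norm g \<le> 1} \<subseteq> \<Union>((\<lambda>V. blinfun_apply -` V) ` \<D>)"
        using \<D>(3) unfolding Y_image by blast
    qed
  qed
qed

lemma openin_strong_operator_topology_eval:
  fixes y :: "'a::real_normed_vector"
  assumes "open U"
  shows "openin strong_operator_topology {g :: 'a \<Rightarrow>\<^sub>L real. g y \<in> U}"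
  using strong_operator_topology_basis[of "{()}" "\<lambda>_. U" "\<lambda>_. y"] assms by simp

lemma Hausdorff_strong_operator_topology:
  "Hausdorff_space (strong_operator_topology :: ('a::real_normed_vector \<Rightarrow>\<^sub>L real) topology)"
  unfolding Hausdorff_space_def
proof (intro allI impI)
  fix g h :: "'a \<Rightarrow>\<^sub>L real"
  assume "g \<in> topspace strong_operator_topology \<and> h \<in> topspace strong_operator_topology \<and> g \<noteq> h"
  then obtain y where "g y \<noteq> h y" using blinfun_eqI by blast
  then obtain U V where "open U" "open V" "g y \<in> U" "h y \<in> V" "U \<inter> V = {}"
    by (meson hausdorff)
  then show "\<exists>U V. openin strong_operator_topology U \<and> openin strong_operator_topology V \<and> g \<in> U \<and> h \<in> V \<and> disjnt U V"
    by (intro exI[of _ "{k. blinfun_apply k y \<in> U}"] exI[of _ "{k. blinfun_apply k y \<in> V}"])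
       (auto simp: openin_strong_operator_topology_eval disjnt_def)
qed

text \<open>Each choice avoids the finitely many earlier values, which keeps the range infinite and
  gives it a cluster point later.\<close>

lemma exists_diagonal_sequence:
  fixes \<Phi> :: "nat \<Rightarrow> 'b set"
  assumes "\<And>n. infinite (\<Phi> n)"
  obtains s where "inj s" "\<And>n. s n \<in> \<Phi> n"
proof -
  define P where "P s n r \<longleftrightarrow> r \<in> \<Phi> n \<and> r \<notin> s ` {..<n}" for s :: "nat \<Rightarrow> 'b" and n r
  have "\<exists>s. \<forall>n. P s n (s n)"
  proof (rule dependent_wf_choice[OF wf_less_than])
    fix s s' :: "nat \<Rightarrow> 'b" and n r
    assume "\<And>z. (z, n) \<in> less_than \<Longrightarrow> s z = s' z"
    then have "s ` {..<n} = s' ` {..<n}" by (intro image_cong) auto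
    then show "P s n r = P s' n r" by (simp add: P_def)
  next
    fix n and s :: "nat \<Rightarrow> 'b"
    have "infinite (\<Phi> n - s ` {..<n})" using assms by (simp add: Diff_infinite_finite)
    then obtain r where "r \<in> \<Phi> n - s ` {..<n}" using infinite_imp_nonempty by blast
    then show "\<exists>r. P s n r" by (auto simp: P_def)
  qed
  then obtain s where s: "\<And>n. s n \<in> \<Phi> n" "\<And>n. s n \<notin> s ` {..<n}" unfolding P_def by blast
  have "inj s"
    by (rule linorder_injI) (use s(2) in \<open>metis imageI lessThan_iff\<close>)
  then show thesis using that s(1) by blast
qed

text \<open>Turns (IV) into finiteness and a uniform gap. Otherwise distinct members of
  \<open>\<Phi>\<close> would have values at \<open>x\<close> tending to 1; by compactness they
  would cluster at some \<open>f\<close>, and (IV) gives \<open>f x < 1\<close>, so a neighbourhood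
  of \<open>f\<close> would contain only finitely many of them.\<close>

lemma IV_polyhedral_finite_active:
  fixes x :: "'a::real_normed_vector"
  assumes IV: "IV_polyhedral (norm :: 'a \<Rightarrow> real)" and x: "norm x = 1"
    and \<Phi>: "\<Phi> \<subseteq> ext {g :: 'a \<Rightarrow>\<^sub>L real. dual_norm norm g \<le> 1}"
  obtains d where "d > 0" "finite {f\<in>\<Phi>. blinfun_apply f x = 1}"
    "\<And>f. f \<in> \<Phi> \<Longrightarrow> blinfun_apply f x = 1 \<or> blinfun_apply f x \<le> 1 - d"
proof -
  have ball: "norm f \<le> 1" if "f \<in> \<Phi>" for f
    using \<Phi> that by (auto simp: ext_def extreme_point_of_def dual_norm_norm)
  have le1: "blinfun_apply f x \<le> 1" if "f \<in> \<Phi>" for f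
    using norm_blinfun[of f x] ball[OF that] x by simp
  have "\<exists>n. finite {f\<in>\<Phi>. blinfun_apply f x > 1 - 1 / real (Suc n)}"
  proof (rule ccontr)
    assume "\<not> ?thesis"
    then obtain s where s: "inj s" "\<And>n. s n \<in> {f\<in>\<Phi>. blinfun_apply f x > 1 - 1 / real (Suc n)}"
      using exists_diagonal_sequence[of "\<lambda>n. {f\<in>\<Phi>. blinfun_apply f x > 1 - 1 / real (Suc n)}"] by blast
    have "infinite (range s)" using s(1) by (simp add: finite_image_iff)
    moreover have "range s \<subseteq> {g. norm g \<le> 1}" using s(2) ball by auto
    ultimately obtain f where f: "f \<in> strong_operator_topology derived_set_of (range s)"
      using compactin_imp_Bolzano_Weierstrass[OF compactin_dual_ball] by blast
    have "range s \<subseteq> ext {g. dual_norm norm g \<le> 1}" using s(2) \<Phi> by auto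
    then have "f \<in> weak_star_cluster_points (ext {g. dual_norm norm g \<le> 1})"
      using f derived_set_of_mono unfolding weak_star_cluster_points_def by blast
    then have "blinfun_apply f x < 1" using IV x by (simp add: IV_polyhedral_def unit_sphere_def)
    then obtain n where n: "1 / real (Suc n) < 1 - blinfun_apply f x" using nat_approx_posE by (metis diff_gt_0_iff_gt)
    define U where "U = {g :: 'a \<Rightarrow>\<^sub>L real. g x \<in> {..<1 - 1 / real (Suc n)}}"
    have "openin strong_operator_topology U" unfolding U_def by (rule openin_strong_operator_topology_eval) simp
    moreover have "f \<in> U" using n by (simp add: U_def)
    ultimately have "infinite (range s \<inter> U)"
      using f unfolding derived_set_of_infinite_openin[OF Hausdorff_strong_operator_topology] by blast
    moreover have "range s \<inter> U \<subseteq> s ` {..<n}"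
    proof clarify
      fix m assume "s m \<in> U"
      then have "1 - 1 / real (Suc m) < 1 - 1 / real (Suc n)" using s(2)[of m] by (simp add: U_def)
      then have "m < n" by (simp add: field_simps)
      then show "s m \<in> s ` {..<n}" by simp
    qed
    ultimately show False using finite_subset by blast
  qed
  then obtain n where "finite {f\<in>\<Phi>. blinfun_apply f x > 1 - 1 / real (Suc n)}" (is "finite ?F") by blast
  \<comment> \<open>The first entry serves the functionals outside the finite set; the others are
    the gaps of its finitely many members below 1.\<close>
  define d where "d = Min (insert (1 / real (Suc n)) ((\<lambda>f. 1 - blinfun_apply f x) ` {f\<in>?F. blinfun_apply f x < 1}))"
  have fin_gap: "finite ((\<lambda>f. 1 - blinfun_apply f x) ` {f\<in>?F. blinfun_apply f x < 1})"
    by (intro finite_imageI finite_subset[OF _ \<open>finite ?F\<close>]) auto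
  show thesis
  proof (rule that[of d])
    show "d > 0" unfolding d_def using fin_gap by (subst Min_gr_iff) auto
    show "finite {f\<in>\<Phi>. blinfun_apply f x = 1}" by (rule finite_subset[OF _ \<open>finite ?F\<close>]) auto
    fix f assume f: "f \<in> \<Phi>"
    show "blinfun_apply f x = 1 \<or> blinfun_apply f x \<le> 1 - d"
    proof (cases "blinfun_apply f x = 1 \<or> f \<notin> ?F")
      case True
      moreover have "d \<le> 1 / real (Suc n)" using fin_gap by (simp add: d_def)
      ultimately show ?thesis using f by auto
    next
      case False
      then have "d \<le> 1 - blinfun_apply f x"
        unfolding d_def using fin_gap le1[OF f] f False by (intro Min_le) auto
      then show ?thesis by simp
    qed
  qed
qed

section \<open>True faces and extremality of the minimal boundary\<close>

lemma norm_minimal_boundary: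
  "f \<in> minimal_boundary norm \<Longrightarrow> norm f = 1"
  by (simp add: minimal_boundary_def dual_norm_norm)

lemma face_interiorE:
  assumes "p \<in> face_interior norm f"
  obtains r where "r > 0" "blinfun_apply f p = 1" "norm p \<le> 1"
    "\<And>q. dist p q < r \<Longrightarrow> blinfun_apply f q = 1 \<Longrightarrow> norm q \<le> 1"
proof -
  obtain T where T: "openin (top_of_set (hyperplane f)) T" "p \<in> T" "T \<subseteq> hyperplane f \<inter> unit_ball norm"
    using assms by (auto simp: face_interior_def interior_of_def)
  then obtain r where r: "r > 0" "ball p r \<inter> hyperplane f \<subseteq> T"
    by (metis openin_contains_ball)
  have "norm q \<le> 1" if "dist p q < r" "blinfun_apply f q = 1" for q
    using r(2) T(3) that by (force simp: hyperplane_def unit_ball_def)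
  then show thesis
    using that[OF r(1)] T by (auto simp: hyperplane_def unit_ball_def)
qed

lemma face_interiorD: "p \<in> face_interior norm f \<Longrightarrow> blinfun_apply f p = 1 \<and> norm p \<le> 1"
  by (blast elim: face_interiorE)

text \<open>A face with relative interior determines its functional. If \<open>f\<close> is a proper
  convex combination of functionals in the dual ball, both are 1 on the face, hence both equal
  \<open>f\<close>. This makes (IV) applicable to the minimal boundary.\<close>

lemma minimal_boundary_extreme:
  "minimal_boundary (norm :: 'a::real_normed_vector \<Rightarrow> real) \<subseteq> ext {g. dual_norm norm g \<le> 1}"
proof
  fix f :: "'a \<Rightarrow>\<^sub>L real" assume f: "f \<in> minimal_boundary norm"
  then obtain h where h: "norm h = 1" "hyperplane f \<inter> unit_ball norm = hyperplane h \<inter> unit_ball norm"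
    "face_interior norm h \<noteq> {}" and nf: "norm f = 1"
    by (auto simp: minimal_boundary_def true_face_def dual_norm_norm)
  obtain p r where r: "r > 0" "blinfun_apply h p = 1" "norm p \<le> 1"
    "\<And>q. dist p q < r \<Longrightarrow> blinfun_apply h q = 1 \<Longrightarrow> norm q \<le> 1"
    using h(3) by (metis ex_in_conv face_interiorE)
  have le1: "blinfun_apply g q \<le> 1" if "norm g \<le> 1" "norm q \<le> 1" for g :: "'a \<Rightarrow>\<^sub>L real" and q
    using norm_blinfun[of g q] mult_mono[OF that] by simp
  have determined: "g = h" if g: "\<And>q. blinfun_apply h q = 1 \<Longrightarrow> norm q \<le> 1 \<Longrightarrow> blinfun_apply g q = 1"
    for g :: "'a \<Rightarrow>\<^sub>L real"
  proof (rule blinfun_eqI)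
    fix y
    define k where "k = y - blinfun_apply h y *\<^sub>R p"
    have hk: "blinfun_apply h k = 0" using r(2) by (simp add: k_def blinfun.bilinear_simps)
    have gp: "blinfun_apply g p = 1" using g r by simp
    \<comment> \<open>Scales the component \<open>k\<close> in the kernel of \<open>h\<close> so
      that \<open>p + c k\<close> stays in the region where the hyperplane lies in the ball.\<close>
    define c where "c = r / (2 * (norm k + 1))"
    have pos: "2 * (norm k + 1) > 0" by (simp add: add_nonneg_pos)
    then have c: "c > 0" using r(1) by (simp add: c_def)
    have "norm k / (2 * (norm k + 1)) < 1"
      unfolding pos_divide_less_eq[OF pos] by (smt (verit) norm_ge_zero)
    then have "r * (norm k / (2 * (norm k + 1))) < r * 1" using r(1) by (rule mult_strict_left_mono)
    then have "norm (c *\<^sub>R k) < r" using c r(1) by (simp add: c_def)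
    then have "blinfun_apply g (p + c *\<^sub>R k) = 1"
      using g[of "p + c *\<^sub>R k"] r(4)[of "p + c *\<^sub>R k"] r(2) hk by (simp add: dist_norm blinfun.bilinear_simps)
    then have "blinfun_apply g k = 0" using gp c by (simp add: blinfun.bilinear_simps)
    then show "blinfun_apply g y = blinfun_apply h y"
      using gp by (simp add: k_def blinfun.bilinear_simps)
  qed
  \<comment> \<open>A true face comes with its own functional \<open>h\<close>; it agrees with
    \<open>f\<close> because both cut out the same face.\<close>
  have "f = h"
    using h(2) by (intro determined) (auto simp: hyperplane_def unit_ball_def set_eq_iff)
  show "f \<in> ext {g. dual_norm norm g \<le> 1}"
    unfolding ext_def extreme_point_of_def dual_norm_norm mem_Collect_eq
  proof (intro conjI ballI notI)
    show "norm f \<le> 1" using nf by simp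
    fix a b :: "'a \<Rightarrow>\<^sub>L real"
    assume ab: "a \<in> {g. norm g \<le> 1}" "b \<in> {g. norm g \<le> 1}" and "f \<in> open_segment a b"
    then obtain u where u: "a \<noteq> b" "0 < u" "u < 1" "f = (1 - u) *\<^sub>R a + u *\<^sub>R b"
      by (auto simp: in_segment)
    have "blinfun_apply a q = 1 \<and> blinfun_apply b q = 1" if q: "blinfun_apply h q = 1" "norm q \<le> 1" for q
    proof -
      have "(1 - u) * blinfun_apply a q + u * blinfun_apply b q = 1"
        using q u(4) \<open>f = h\<close> by (simp add: blinfun.bilinear_simps)
      moreover have "(1 - u) * (1 - blinfun_apply a q) \<ge> 0" "u * (1 - blinfun_apply b q) \<ge> 0"
        using le1[of a q] le1[of b q] ab q u by auto
      moreover have "(1 - u) * (1 - blinfun_apply a q) + u * (1 - blinfun_apply b q)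
          = 1 - ((1 - u) * blinfun_apply a q + u * blinfun_apply b q)"
        by (simp add: algebra_simps)
      ultimately have "(1 - u) * (1 - blinfun_apply a q) = 0" "u * (1 - blinfun_apply b q) = 0"
        by linarith+
      then show ?thesis using u by simp
    qed
    then have "a = h" "b = h" by (auto intro: determined)
    then show False using u(1) by simp
  qed
qed

section \<open>Balls with spikes\<close>

lemma equivalent_norm_zero:
  assumes "equivalent_norm N"
  shows "N 0 = 0" "N (- y) = N y" "0 \<le> N y" "N y = 0 \<Longrightarrow> y = 0"
proof -
  have "N ((-1) *\<^sub>R y) = \<bar>-1\<bar> * N y" using assms unfolding equivalent_norm_def by blast
  then show "N (- y) = N y" by simp
qed (use assms in \<open>auto simp: equivalent_norm_def\<close>)

lemma dual_norm_upper:
  assumes N: "equivalent_norm N" and "N y \<le> 1"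
  shows "\<bar>blinfun_apply h y\<bar> \<le> dual_norm N h"
proof -
  obtain m where m: "m > 0" "\<And>y. m * norm y \<le> N y"
    using N by (auto simp: equivalent_norm_def)
  have "bdd_above ((\<lambda>x. \<bar>blinfun_apply h x\<bar>) ` unit_ball N)"
  proof (rule bdd_aboveI2)
    fix x assume "x \<in> unit_ball N"
    then have "m * norm x \<le> 1" using m(2)[of x] by (simp add: unit_ball_def)
    then have "norm x \<le> inverse m" using m(1) by (simp add: field_simps)
    then show "\<bar>blinfun_apply h x\<bar> \<le> norm h * inverse m"
      using norm_blinfun[of h x] mult_left_mono[of "norm x" "inverse m" "norm h"] by simp
  qed
  then show ?thesis
    unfolding dual_norm_def by (rule cSUP_upper[rotated]) (use assms(2) in \<open>simp add: unit_ball_def\<close>)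
qed

text \<open>Removes the absolute value by symmetry of \<open>N\<close>. In this one-sided form the
  dual ball fits the sublinear machinery.\<close>

lemma dual_norm_le_1_iff:
  assumes N: "equivalent_norm N"
  shows "dual_norm N h \<le> 1 \<longleftrightarrow> (\<forall>y. blinfun_apply h y \<le> N y)"
proof
  assume h: "dual_norm N h \<le> 1"
  show "\<forall>y. blinfun_apply h y \<le> N y"
  proof
    fix y
    show "blinfun_apply h y \<le> N y"
    proof (cases "N y = 0")
      case True
      then show ?thesis using equivalent_norm_zero(1,4)[OF N] by fastforce
    next
      case False
      then have pos: "N y > 0" using equivalent_norm_zero(3)[OF N, of y] by simp
      have "N (inverse (N y) *\<^sub>R y) = \<bar>inverse (N y)\<bar> * N y"
        using N unfolding equivalent_norm_def by blast
      then have "N (inverse (N y) *\<^sub>R y) \<le> 1" using pos by simp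
      then have "\<bar>blinfun_apply h (inverse (N y) *\<^sub>R y)\<bar> \<le> 1"
        using dual_norm_upper[OF N] h order_trans by blast
      then have "inverse (N y) * blinfun_apply h y \<le> 1" by (simp add: blinfun.scaleR_right)
      then show ?thesis using pos by (simp add: field_simps)
    qed
  qed
next
  assume h: "\<forall>y. blinfun_apply h y \<le> N y"
  show "dual_norm N h \<le> 1"
    unfolding dual_norm_def
  proof (rule cSUP_least)
    have "0 \<in> unit_ball N" using equivalent_norm_zero(1)[OF N] by (simp add: unit_ball_def)
    then show "unit_ball N \<noteq> {}" by blast
    fix y assume "y \<in> unit_ball N"
    then show "\<bar>blinfun_apply h y\<bar> \<le> 1"
      using h[rule_format, of y] h[rule_format, of "- y"] equivalent_norm_zero(2)[OF N, of y]
      by (simp add: unit_ball_def blinfun.minus_right)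
  qed
qed

lemma V_polyhedralI:
  assumes N: "equivalent_norm N"
    and gap: "\<And>x. N x = 1 \<Longrightarrow> \<exists>c<1. \<forall>h. h extreme_point_of {h. \<forall>y. blinfun_apply h y \<le> N y} \<longrightarrow>
      blinfun_apply h x = 1 \<or> blinfun_apply h x \<le> c"
  shows "V_polyhedral N"
  unfolding V_polyhedral_def
proof
  fix x assume "x \<in> unit_sphere N"
  then have x: "N x = 1" by (simp add: unit_sphere_def)
  obtain c where c: "c < 1" "\<And>h. h extreme_point_of {h. \<forall>y. blinfun_apply h y \<le> N y} \<Longrightarrow>
      blinfun_apply h x = 1 \<or> blinfun_apply h x \<le> c"
    using gap[OF x] by blast
  have "(SUP h\<in>ext {g. dual_norm N g \<le> 1} - D N x. ereal (blinfun_apply h x)) \<le> ereal c"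
  proof (rule SUP_least)
    fix h assume h: "h \<in> ext {g. dual_norm N g \<le> 1} - D N x"
    then have "h extreme_point_of {h. \<forall>y. blinfun_apply h y \<le> N y}" and le: "dual_norm N h \<le> 1"
      using dual_norm_le_1_iff[OF N] by (auto simp: ext_def extreme_point_of_def)
    moreover have "blinfun_apply h x \<noteq> 1"
    proof
      assume hx: "blinfun_apply h x = 1"
      then have "dual_norm N h = 1" using dual_norm_upper[OF N, of x h] le x by simp
      then show False using h hx by (simp add: D_def)
    qed
    ultimately show "ereal (blinfun_apply h x) \<le> ereal c" using c(2) by auto
  qed
  also have "\<dots> < 1" using c(1) by simp
  finally show "(SUP h\<in>ext {g. dual_norm N g \<le> 1} - D N x. ereal (blinfun_apply h x)) < 1" .
qed

text \<open>
  The data behind the new ball: every functional \<open>\<phi>\<close> of a symmetric norming family is pushed beyond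
  its value on the old ball at a single point \<open>v \<phi>\<close>.
\<close>
locale spiked_ball =
  fixes \<Phi> :: "('a::banach \<Rightarrow>\<^sub>L real) set"
    and v :: "('a \<Rightarrow>\<^sub>L real) \<Rightarrow> 'a"
    and t \<nu> :: "('a \<Rightarrow>\<^sub>L real) \<Rightarrow> real"
    and \<epsilon> :: real
  assumes minus_in: "\<phi> \<in> \<Phi> \<Longrightarrow> - \<phi> \<in> \<Phi>"
    and v_minus: "\<phi> \<in> \<Phi> \<Longrightarrow> v (- \<phi>) = - v \<phi>"
    and t_minus: "\<phi> \<in> \<Phi> \<Longrightarrow> t (- \<phi>) = t \<phi>"
    and t_pos: "\<phi> \<in> \<Phi> \<Longrightarrow> 0 < t \<phi>"
    and t_less: "\<phi> \<in> \<Phi> \<Longrightarrow> t \<phi> < \<epsilon>"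
    and t_nu: "\<phi> \<in> \<Phi> \<Longrightarrow> t \<phi> + \<nu> \<phi> < 1"
    and v_self: "\<phi> \<in> \<Phi> \<Longrightarrow> blinfun_apply \<phi> (v \<phi>) = 1 + t \<phi>"
    and v_other: "\<phi> \<in> \<Phi> \<Longrightarrow> \<psi> \<in> \<Phi> \<Longrightarrow> \<psi> \<noteq> \<phi> \<Longrightarrow> \<psi> \<noteq> - \<phi> \<Longrightarrow> \<bar>blinfun_apply \<psi> (v \<phi>)\<bar> \<le> \<nu> \<phi>"
    and norming: "(\<And>\<phi>. \<phi> \<in> \<Phi> \<Longrightarrow> blinfun_apply \<phi> y \<le> 1) \<Longrightarrow> norm y \<le> 1"
    and norm_le: "\<phi> \<in> \<Phi> \<Longrightarrow> norm \<phi> \<le> 1"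
    and nonempty: "\<Phi> \<noteq> {}"
    and other: "\<phi> \<in> \<Phi> \<Longrightarrow> \<exists>\<psi>\<in>\<Phi>. \<psi> \<noteq> \<phi> \<and> \<psi> \<noteq> - \<phi>"
    and cball_subset: "cball 0 1 \<subseteq> closure (convex hull (v ` \<Phi>))"
begin

text \<open>The edge from \<open>\<phi>\<close> to \<open>- \<phi>\<close> is left out: its cut
  would be \<open>\<phi> / (1 + t \<phi>)\<close>, and the corresponding inequality follows from two
  other cuts by \<open>two_cuts\<close>.\<close>

definition pairs :: "(('a \<Rightarrow>\<^sub>L real) \<times> ('a \<Rightarrow>\<^sub>L real)) set" where
  "pairs = {(\<phi>, h). \<phi> \<in> \<Phi> \<and> h \<in> \<Phi> \<and> h \<noteq> \<phi> \<and> h \<noteq> - \<phi>}"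

text \<open>The solution \<open>a\<close> of
  \<open>a (1 + t \<phi>) + (1 - a) h (v \<phi>) = 1\<close>.\<close>

definition \<alpha> :: "('a \<Rightarrow>\<^sub>L real) \<Rightarrow> ('a \<Rightarrow>\<^sub>L real) \<Rightarrow> real" where
  "\<alpha> \<phi> h = (1 - blinfun_apply h (v \<phi>)) / (1 + t \<phi> - blinfun_apply h (v \<phi>))"

text \<open>
  Cutting off the vertex \<open>\<phi>\<close> of the old dual ball by the hyperplane of functionals with value \<open>1\<close>
  at \<open>v \<phi>\<close> creates the vertex \<open>cut \<phi> h\<close> on the edge from \<open>\<phi>\<close> to \<open>h\<close>.
\<close>
definition cut :: "('a \<Rightarrow>\<^sub>L real) \<Rightarrow> ('a \<Rightarrow>\<^sub>L real) \<Rightarrow> ('a \<Rightarrow>\<^sub>L real)" where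
  "cut \<phi> h = \<alpha> \<phi> h *\<^sub>R \<phi> + (1 - \<alpha> \<phi> h) *\<^sub>R h"

definition body :: "'a set" where
  "body = closure (convex hull (v ` \<Phi>))"

text \<open>A support function in place of the Minkowski gauge: sublinearity and the later splitting
  into two maxima are then direct. \<open>unit_ball_N\<close> shows that it has the right
  ball.\<close>

definition N :: "'a \<Rightarrow> real" where
  "N y = (SUP (\<phi>, h)\<in>pairs. blinfun_apply (cut \<phi> h) y)"

lemma pairsD: "(\<phi>, h) \<in> pairs \<Longrightarrow> \<phi> \<in> \<Phi> \<and> h \<in> \<Phi> \<and> h \<noteq> \<phi> \<and> h \<noteq> - \<phi> \<and> \<phi> \<noteq> h \<and> \<phi> \<noteq> - h"
  by (auto simp: pairs_def)

lemma cut_apply: "blinfun_apply (cut \<phi> h) y = \<alpha> \<phi> h * blinfun_apply \<phi> y + (1 - \<alpha> \<phi> h) * blinfun_apply h y"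
  by (simp add: cut_def blinfun.bilinear_simps)

lemma pairs_minus: "(\<phi>, h) \<in> pairs \<Longrightarrow> (- \<phi>, - h) \<in> pairs" "(\<phi>, h) \<in> pairs \<Longrightarrow> (\<phi>, - h) \<in> pairs"
  by (auto simp: pairs_def minus_in)

lemma pairs_ex: "\<phi> \<in> \<Phi> \<Longrightarrow> \<exists>h. (\<phi>, h) \<in> pairs"
  using other by (auto simp: pairs_def)

lemma pairs_nonempty: "pairs \<noteq> {}"
  using nonempty pairs_ex by blast

lemma cut_minus: "(\<phi>, h) \<in> pairs \<Longrightarrow> cut (- \<phi>) (- h) = - cut \<phi> h"
  by (simp add: cut_def \<alpha>_def pairs_def v_minus t_minus blinfun.bilinear_simps)

lemma abs_le_norm: "\<phi> \<in> \<Phi> \<Longrightarrow> \<bar>blinfun_apply \<phi> y\<bar> \<le> norm y"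
  using norm_blinfun[of \<phi> y] mult_right_mono[OF norm_le norm_ge_zero[of y], of \<phi>] by simp

lemma le_norm: "\<phi> \<in> \<Phi> \<Longrightarrow> blinfun_apply \<phi> y \<le> norm y"
  using abs_le_norm[of \<phi> y] by simp

lemma nu_nonneg: "\<phi> \<in> \<Phi> \<Longrightarrow> 0 \<le> \<nu> \<phi>"
  using other[of \<phi>] v_other[of \<phi>] abs_ge_zero order_trans by blast

text \<open>With \<open>s = h (v \<phi>)\<close>, the bound 1/2 is equivalent to
  \<open>t \<phi> \<le> 1 - s\<close>, a consequence of \<open>t + \<nu> < 1\<close>. The 3 bounds
  the denominator \<open>1 + t \<phi> - s\<close>, as \<open>t \<phi> < 1\<close> and
  \<open>s \<ge> - 1\<close>.\<close>

lemma \<alpha>_bounds: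
  assumes "(\<phi>, h) \<in> pairs"
  shows "1 / 2 \<le> \<alpha> \<phi> h" "\<alpha> \<phi> h < 1" "t \<phi> / 3 \<le> 1 - \<alpha> \<phi> h"
proof -
  define s where "s = blinfun_apply h (v \<phi>)"
  have "\<bar>s\<bar> \<le> \<nu> \<phi>" unfolding s_def using pairsD[OF assms] by (intro v_other) auto
  then have s: "s < 1 - t \<phi>" "- 1 \<le> s" "t \<phi> < 1"
    using t_nu[of \<phi>] t_pos[of \<phi>] nu_nonneg[of \<phi>] pairsD[OF assms] by auto
  have t: "t \<phi> > 0" using t_pos pairsD[OF assms] by simp
  have \<alpha>: "\<alpha> \<phi> h = (1 - s) / (1 + t \<phi> - s)" by (simp add: \<alpha>_def s_def)
  have pos: "1 + t \<phi> - s > 0" using s t by simp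
  show "1 / 2 \<le> \<alpha> \<phi> h" "\<alpha> \<phi> h < 1" using pos s t by (simp_all add: \<alpha> field_simps)
  have "1 - \<alpha> \<phi> h = t \<phi> / (1 + t \<phi> - s)" using pos by (simp add: \<alpha> field_simps)
  moreover have "t \<phi> / 3 \<le> t \<phi> / (1 + t \<phi> - s)"
    by (rule divide_left_mono) (use pos s t in auto)
  ultimately show "t \<phi> / 3 \<le> 1 - \<alpha> \<phi> h" by simp
qed

lemma cut_self:
  assumes "(\<phi>, h) \<in> pairs"
  shows "blinfun_apply (cut \<phi> h) (v \<phi>) = 1"
proof -
  define s where "s = blinfun_apply h (v \<phi>)"
  have "\<bar>s\<bar> \<le> \<nu> \<phi>" unfolding s_def using pairsD[OF assms] by (intro v_other) auto
  then have pos: "1 + t \<phi> - s > 0" using t_nu[of \<phi>] t_pos[of \<phi>] pairsD[OF assms] by simp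
  have \<alpha>: "\<alpha> \<phi> h * (1 + t \<phi> - s) = 1 - s" using pos by (simp add: \<alpha>_def s_def)
  have "blinfun_apply (cut \<phi> h) (v \<phi>) = \<alpha> \<phi> h * (1 + t \<phi> - s) + s"
    using pairsD[OF assms] by (simp add: cut_apply v_self s_def algebra_simps)
  then show ?thesis using \<alpha> by simp
qed

lemma cut_le_max:
  assumes "(\<phi>, h) \<in> pairs" "blinfun_apply \<phi> y \<le> c" "blinfun_apply h y \<le> c"
  shows "blinfun_apply (cut \<phi> h) y \<le> c"
proof -
  have "\<alpha> \<phi> h * blinfun_apply \<phi> y + (1 - \<alpha> \<phi> h) * blinfun_apply h y \<le> \<alpha> \<phi> h * c + (1 - \<alpha> \<phi> h) * c"
    by (intro add_mono mult_left_mono) (use assms(2,3) \<alpha>_bounds[OF assms(1)] in auto)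
  then show ?thesis by (simp add: cut_apply algebra_simps)
qed

lemma cut_le_norm: "(\<phi>, h) \<in> pairs \<Longrightarrow> blinfun_apply (cut \<phi> h) y \<le> norm y"
  using cut_le_max le_norm pairsD by blast

text \<open>The delicate spike is that of \<open>h\<close>, where \<open>h\<close> has value
  \<open>1 + t h\<close>. There \<open>\<phi>\<close> is at most \<open>1 - t h\<close>, and its
  weight of at least 1/2 compensates the excess.\<close>

lemma cut_v_le:
  assumes "(\<phi>, h) \<in> pairs" "\<xi> \<in> \<Phi>"
  shows "blinfun_apply (cut \<phi> h) (v \<xi>) \<le> 1"
proof -
  note p = pairsD[OF assms(1)]
  have \<nu>: "\<nu> \<xi> < 1 - t \<xi>" "t \<xi> > 0" using t_nu[OF assms(2)] t_pos[OF assms(2)] by auto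
  have bound: "blinfun_apply \<psi> (v \<xi>) \<le> 1 - t \<xi>" if "\<psi> \<in> \<Phi>" "\<psi> \<noteq> \<xi>" for \<psi>
  proof (cases "\<psi> = - \<xi>")
    case True
    then show ?thesis using v_self[OF assms(2)] by (simp add: blinfun.minus_left)
  next
    case False
    then show ?thesis using v_other[OF assms(2) that(1)] that(2) \<nu> by simp
  qed
  consider "\<xi> = \<phi>" | "\<xi> = h" | "\<phi> \<noteq> \<xi>" "h \<noteq> \<xi>" by blast
  then show ?thesis
  proof cases
    case 1
    then show ?thesis using cut_self[OF assms(1)] by simp
  next
    case 2
    then have "blinfun_apply \<phi> (v \<xi>) \<le> 1 - t \<xi>" using bound[of \<phi>] p by simp
    then have "\<alpha> \<phi> h * blinfun_apply \<phi> (v \<xi>) \<le> \<alpha> \<phi> h * (1 - t \<xi>)"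
      by (rule mult_left_mono) (use \<alpha>_bounds[OF assms(1)] in simp)
    then have "blinfun_apply (cut \<phi> h) (v \<xi>) \<le> \<alpha> \<phi> h * (1 - t \<xi>) + (1 - \<alpha> \<phi> h) * (1 + t \<xi>)"
      using 2 v_self[OF assms(2)] by (simp add: cut_apply)
    also have "\<dots> = 1 - (2 * \<alpha> \<phi> h - 1) * t \<xi>" by (simp add: algebra_simps)
    also have "\<dots> \<le> 1" using \<alpha>_bounds[OF assms(1)] \<nu> by simp
    finally show ?thesis .
  next
    case 3
    then show ?thesis
      using cut_le_max[OF assms(1), of "v \<xi>" "1 - t \<xi>"] bound p \<nu> by force
  qed
qed

lemma convex_body: "convex body"
  by (simp add: body_def convex_closure)

lemma v_in_body: "\<phi> \<in> \<Phi> \<Longrightarrow> v \<phi> \<in> body"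
  unfolding body_def by (meson closure_subset hull_subset imageI subsetD)

lemma cball_in_body: "norm y \<le> 1 \<Longrightarrow> y \<in> body"
  using cball_subset by (auto simp: body_def)

lemma cut_body_le:
  assumes "(\<phi>, h) \<in> pairs" "y \<in> body"
  shows "blinfun_apply (cut \<phi> h) y \<le> 1"
proof -
  have "body \<subseteq> {y. blinfun_apply (cut \<phi> h) y \<le> 1}"
    unfolding body_def
  proof (rule closure_minimal)
    show "closed {y. blinfun_apply (cut \<phi> h) y \<le> 1}"
      by (intro closed_Collect_le continuous_intros)
    have "convex {y. blinfun_apply (cut \<phi> h) y \<le> 1}"
    proof (rule convexI)
      fix x y u w assume *: "x \<in> {y. blinfun_apply (cut \<phi> h) y \<le> 1}" "y \<in> {y. blinfun_apply (cut \<phi> h) y \<le> 1}"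
        "0 \<le> u" "0 \<le> w" "u + w = (1::real)"
      have "u * blinfun_apply (cut \<phi> h) x + w * blinfun_apply (cut \<phi> h) y \<le> u * 1 + w * 1"
        by (intro add_mono mult_left_mono) (use * in auto)
      then show "u *\<^sub>R x + w *\<^sub>R y \<in> {y. blinfun_apply (cut \<phi> h) y \<le> 1}"
        using * by (simp add: blinfun.bilinear_simps)
    qed
    then show "convex hull v ` \<Phi> \<subseteq> {y. blinfun_apply (cut \<phi> h) y \<le> 1}"
      by (intro hull_minimal) (use cut_v_le[OF assms(1)] in auto)
  qed
  then show ?thesis using assms(2) by auto
qed

lemma eq_if_equal_on_\<Phi>:
  assumes "\<And>\<psi>. \<psi> \<in> \<Phi> \<Longrightarrow> blinfun_apply \<psi> x = blinfun_apply \<psi> y"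
  shows "x = y"
proof (rule ccontr)
  assume "x \<noteq> y"
  have "norm ((2 / norm (x - y)) *\<^sub>R (x - y)) \<le> 1"
    by (rule norming) (use assms in \<open>simp add: blinfun.bilinear_simps\<close>)
  then show False using \<open>x \<noteq> y\<close> by simp
qed

lemma norm_v_le:
  assumes "\<phi> \<in> \<Phi>"
  shows "norm (v \<phi>) \<le> 1 + t \<phi>"
proof -
  have pos: "1 + t \<phi> > 0" "\<nu> \<phi> \<le> 1 + t \<phi>" using t_pos[OF assms] t_nu[OF assms] by auto
  have "norm (inverse (1 + t \<phi>) *\<^sub>R v \<phi>) \<le> 1"
  proof (rule norming)
    fix \<psi> assume \<psi>: "\<psi> \<in> \<Phi>"
    have "blinfun_apply \<psi> (v \<phi>) \<le> 1 + t \<phi>"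
      using v_other[OF assms \<psi>] v_self[OF assms] pos
      by (cases "\<psi> = \<phi>"; cases "\<psi> = - \<phi>") (auto simp: blinfun.minus_left)
    then show "blinfun_apply \<psi> (inverse (1 + t \<phi>) *\<^sub>R v \<phi>) \<le> 1"
      using pos by (simp add: blinfun.scaleR_right field_simps)
  qed
  then show ?thesis using pos by (simp add: field_simps)
qed

text \<open>A positive combination of the two inequalities eliminates \<open>h\<close>.\<close>
lemma two_cuts:
  assumes "(\<phi>, h) \<in> pairs"
    and "blinfun_apply (cut \<phi> h) y \<le> 1" "blinfun_apply (cut \<phi> (- h)) y \<le> 1"
  shows "blinfun_apply \<phi> y \<le> 1 + t \<phi>"
    "blinfun_apply \<phi> y = 1 + t \<phi> \<Longrightarrow> blinfun_apply h y = blinfun_apply h (v \<phi>)"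
proof -
  define P where "P = blinfun_apply \<phi> y - (1 + t \<phi>)"
  define Q where "Q = blinfun_apply h y - blinfun_apply h (v \<phi>)"
  define a where "a = \<alpha> \<phi> h"
  define b where "b = \<alpha> \<phi> (- h)"
  have a: "a > 0" "a < 1" and b: "b > 0" "b < 1"
    using \<alpha>_bounds[OF assms(1)] \<alpha>_bounds[OF pairs_minus(2)[OF assms(1)]] by (auto simp: a_def b_def)
  have "\<phi> \<in> \<Phi>" using pairsD[OF assms(1)] by simp
  have 1: "a * P + (1 - a) * Q \<le> 0"
    using assms(2) cut_self[OF assms(1)] v_self[OF \<open>\<phi> \<in> \<Phi>\<close>]
    by (simp add: cut_apply P_def Q_def a_def algebra_simps)
  have 2: "b * P - (1 - b) * Q \<le> 0"
    using assms(3) cut_self[OF pairs_minus(2)[OF assms(1)]] v_self[OF \<open>\<phi> \<in> \<Phi>\<close>]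
    by (simp add: cut_apply P_def Q_def b_def blinfun.minus_left algebra_simps)
  have "(1 - b) * (a * P + (1 - a) * Q) + (1 - a) * (b * P - (1 - b) * Q) \<le> 0"
    using mult_nonneg_nonpos[of "1 - b"] mult_nonneg_nonpos[of "1 - a"] 1 2 a b
    by (smt (verit))
  then have "((1 - b) * a + (1 - a) * b) * P \<le> 0" by (simp add: algebra_simps)
  moreover have "(1 - b) * a + (1 - a) * b > 0" using a b by (simp add: add_pos_pos)
  ultimately have "P \<le> 0" by (simp add: mult_le_0_iff)
  then show "blinfun_apply \<phi> y \<le> 1 + t \<phi>" by (simp add: P_def)
  assume "blinfun_apply \<phi> y = 1 + t \<phi>"
  then have "P = 0" by (simp add: P_def)
  then have "Q = 0" using 1 2 a b by (simp add: mult_le_0_iff zero_le_mult_iff)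
  then show "blinfun_apply h y = blinfun_apply h (v \<phi>)" by (simp add: Q_def)
qed

text \<open>\<open>b\<close> is the projection of \<open>y\<close> from the apex
  \<open>v \<phi>\<close> to the hyperplane where \<open>\<phi>\<close> is 1. A cut starting at
  \<open>\<phi>\<close> equals 1 at the apex, so its inequality passes from \<open>y\<close> to
  \<open>b\<close>; since \<open>\<phi> b = 1\<close>, it reduces there to
  \<open>\<psi> b \<le> 1\<close>.\<close>

lemma spike_decomposition:
  assumes y: "\<And>\<phi> h. (\<phi>, h) \<in> pairs \<Longrightarrow> blinfun_apply (cut \<phi> h) y \<le> 1"
    and \<phi>: "\<phi> \<in> \<Phi>" "blinfun_apply \<phi> y > 1"
  obtains a b where "0 < a" "a \<le> 1" "norm b \<le> 1" "blinfun_apply \<phi> b = 1" "y = a *\<^sub>R v \<phi> + (1 - a) *\<^sub>R b"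
proof -
  have t: "t \<phi> > 0" by (rule t_pos[OF \<phi>(1)])
  define a where "a = (blinfun_apply \<phi> y - 1) / t \<phi>"
  have \<phi>y: "blinfun_apply \<phi> y = 1 + a * t \<phi>" using t by (simp add: a_def)
  have le: "blinfun_apply \<phi> y \<le> 1 + t \<phi>"
    using pairs_ex[OF \<phi>(1)] two_cuts(1) y pairs_minus(2) by blast
  have "0 < a" using \<phi>(2) t by (simp add: a_def)
  have "a \<le> 1" using le t by (simp add: a_def field_simps)
  show thesis
  proof (cases "a = 1")
    case True
    \<comment> \<open>At the apex the projection is undefined. The equality case of
      \<open>two_cuts\<close> identifies \<open>y\<close>, and any point of the face, such as the
      rescaled apex, can be taken for \<open>b\<close>.\<close>
    have "y = v \<phi>"
    proof (rule eq_if_equal_on_\<Phi>)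
      fix \<psi> assume \<psi>: "\<psi> \<in> \<Phi>"
      consider "\<psi> = \<phi>" | "\<psi> = - \<phi>" | "(\<phi>, \<psi>) \<in> pairs" using \<psi> \<phi>(1) by (auto simp: pairs_def)
      then show "blinfun_apply \<psi> y = blinfun_apply \<psi> (v \<phi>)"
      proof cases
        case 3
        then show ?thesis using two_cuts(2)[OF 3 y[OF 3] y[OF pairs_minus(2)[OF 3]]] \<phi>y True by simp
      qed (use \<phi>y True v_self[OF \<phi>(1)] in \<open>auto simp: blinfun.minus_left\<close>)
    qed
    moreover have "norm (inverse (1 + t \<phi>) *\<^sub>R v \<phi>) \<le> 1"
      using norm_v_le[OF \<phi>(1)] t by (simp add: field_simps)
    ultimately show thesis
      using that[of 1 "inverse (1 + t \<phi>) *\<^sub>R v \<phi>"] v_self[OF \<phi>(1)] t by (simp add: blinfun.scaleR_right)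
  next
    case False
    then have a1: "1 - a > 0" using \<open>a \<le> 1\<close> by simp
    define b where "b = inverse (1 - a) *\<^sub>R (y - a *\<^sub>R v \<phi>)"
    have yb: "y = a *\<^sub>R v \<phi> + (1 - a) *\<^sub>R b" using a1 by (simp add: b_def)
    have \<phi>b: "blinfun_apply \<phi> b = 1"
    proof -
      have "blinfun_apply \<phi> y = a * (1 + t \<phi>) + (1 - a) * blinfun_apply \<phi> b"
        by (subst yb) (simp add: blinfun.bilinear_simps v_self[OF \<phi>(1)])
      then have "(1 - a) * blinfun_apply \<phi> b = (1 - a) * 1" using \<phi>y by (simp add: algebra_simps)
      then show ?thesis using a1 by simp
    qed
    moreover have "norm b \<le> 1"
    proof (rule norming)
      fix \<psi> assume \<psi>: "\<psi> \<in> \<Phi>"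
      consider "\<psi> = \<phi>" | "\<psi> = - \<phi>" | "(\<phi>, \<psi>) \<in> pairs" using \<psi> \<phi>(1) by (auto simp: pairs_def)
      then show "blinfun_apply \<psi> b \<le> 1"
      proof cases
        case 3
        have "blinfun_apply (cut \<phi> \<psi>) y = a + (1 - a) * blinfun_apply (cut \<phi> \<psi>) b"
          by (subst yb) (simp add: blinfun.bilinear_simps cut_self[OF 3])
        then have "(1 - a) * blinfun_apply (cut \<phi> \<psi>) b \<le> (1 - a) * 1" using y[OF 3] by simp
        then have "blinfun_apply (cut \<phi> \<psi>) b \<le> 1" using a1 by (simp only: mult_le_cancel_left_pos)
        then have "(1 - \<alpha> \<phi> \<psi>) * blinfun_apply \<psi> b \<le> (1 - \<alpha> \<phi> \<psi>) * 1" using \<phi>b by (simp add: cut_apply)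
        moreover have "1 - \<alpha> \<phi> \<psi> > 0" using \<alpha>_bounds[OF 3] by simp
        ultimately show ?thesis by (simp only: mult_le_cancel_left_pos)
      qed (use \<phi>b in \<open>auto simp: blinfun.minus_left\<close>)
    qed
    ultimately show thesis using that[OF \<open>0 < a\<close> \<open>a \<le> 1\<close>] yb by blast
  qed
qed

lemma in_body_iff: "y \<in> body \<longleftrightarrow> (\<forall>(\<phi>, h)\<in>pairs. blinfun_apply (cut \<phi> h) y \<le> 1)"
proof
  assume "\<forall>(\<phi>, h)\<in>pairs. blinfun_apply (cut \<phi> h) y \<le> 1"
  then have y: "\<And>\<phi> h. (\<phi>, h) \<in> pairs \<Longrightarrow> blinfun_apply (cut \<phi> h) y \<le> 1" by auto
  show "y \<in> body"
  proof (cases "\<exists>\<phi>\<in>\<Phi>. blinfun_apply \<phi> y > 1")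
    case True
    then obtain \<phi> where \<phi>: "\<phi> \<in> \<Phi>" "blinfun_apply \<phi> y > 1" by blast
    obtain a b where ab: "0 < a" "a \<le> 1" "norm b \<le> 1" "y = a *\<^sub>R v \<phi> + (1 - a) *\<^sub>R b"
      by (rule spike_decomposition[OF y \<phi>])
    show ?thesis
      unfolding ab(4) by (rule convexD[OF convex_body]) (use ab v_in_body[OF \<phi>(1)] cball_in_body in auto)
  next
    case False
    then have "norm y \<le> 1" by (intro norming) (auto simp: not_less)
    then show ?thesis by (rule cball_in_body)
  qed
qed (use cut_body_le in auto)

lemma cut_le_N: "(\<phi>, h) \<in> pairs \<Longrightarrow> blinfun_apply (cut \<phi> h) y \<le> N y"
proof -
  assume "(\<phi>, h) \<in> pairs"
  moreover have "bdd_above ((\<lambda>(\<phi>, h). blinfun_apply (cut \<phi> h) y) ` pairs)"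
    by (rule bdd_aboveI2[of _ _ "norm y"]) (use cut_le_norm in auto)
  ultimately show ?thesis
    unfolding N_def using cSUP_upper[of "(\<phi>, h)" pairs "\<lambda>(\<phi>, h). blinfun_apply (cut \<phi> h) y"] by simp
qed

lemma N_least: "(\<And>\<phi> h. (\<phi>, h) \<in> pairs \<Longrightarrow> blinfun_apply (cut \<phi> h) y \<le> c) \<Longrightarrow> N y \<le> c"
  unfolding N_def by (rule cSUP_least[OF pairs_nonempty]) auto

lemma unit_ball_N: "unit_ball N = body"
proof -
  have "N y \<le> 1 \<longleftrightarrow> (\<forall>(\<phi>, h)\<in>pairs. blinfun_apply (cut \<phi> h) y \<le> 1)" for y
    using cut_le_N[of _ _ y] N_least[of y 1] order_trans by blast
  then show ?thesis by (simp add: unit_ball_def in_body_iff set_eq_iff)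
qed

lemma N_le_norm: "N y \<le> norm y"
  by (rule N_least) (rule cut_le_norm)

lemma sublinear_N: "sublinear N"
proof (rule sublinearI)
  show "N (x + y) \<le> N x + N y" for x y
    by (rule N_least) (use cut_le_N[of _ _ x] cut_le_N[of _ _ y] in \<open>simp add: blinfun.add_right add_mono\<close>)
  have "(0::real) \<le> N 0" using pairs_nonempty cut_le_N[of _ _ 0] by auto
  then show "N 0 = 0" using N_le_norm[of 0] by simp
  show "N (c *\<^sub>R x) \<le> c * N x" if "c > 0" for c x
    by (rule N_least) (use cut_le_N[of _ _ x] that in \<open>simp add: blinfun.scaleR_right\<close>)
qed

lemma N_minus: "N (- y) = N y"
proof -
  have "N (- y) \<le> N y" for y
  proof (rule N_least)
    fix \<phi> h assume "(\<phi>, h) \<in> pairs"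
    then show "blinfun_apply (cut \<phi> h) (- y) \<le> N y"
      using cut_le_N[OF pairs_minus(1), of \<phi> h y] cut_minus[of \<phi> h]
      by (simp add: blinfun.minus_left blinfun.minus_right)
  qed
  from this[of y] this[of "- y"] show ?thesis by simp
qed

lemma N_scale: "N (c *\<^sub>R y) = \<bar>c\<bar> * N y"
  using sublinear_scale[OF sublinear_N, of "\<bar>c\<bar>" y] N_minus[of "c *\<^sub>R y"]
  by (cases "c \<ge> 0") auto

lemma N_nonneg: "0 \<le> N y"
  using sublinear_minus[OF sublinear_N, of y] N_minus[of y] by simp

lemma eps_pos: "0 < \<epsilon>"
  using nonempty t_pos t_less order_less_trans by blast

lemma body_norm_le: "y \<in> body \<Longrightarrow> norm y \<le> 1 + \<epsilon>"
proof -
  have "v \<phi> \<in> cball 0 (1 + \<epsilon>)" if "\<phi> \<in> \<Phi>" for \<phi>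
    using norm_v_le[OF that] t_less[OF that] by simp
  then have "convex hull (v ` \<Phi>) \<subseteq> cball 0 (1 + \<epsilon>)"
    by (intro hull_minimal) auto
  then have "body \<subseteq> cball 0 (1 + \<epsilon>)" unfolding body_def by (rule closure_minimal) simp
  then show "y \<in> body \<Longrightarrow> norm y \<le> 1 + \<epsilon>" by auto
qed

lemma norm_le_N: "norm y \<le> (1 + \<epsilon>) * N y"
proof -
  have bd: "N z \<le> 1 \<Longrightarrow> norm z \<le> 1 + \<epsilon>" for z
    using body_norm_le[of z] unit_ball_N by (auto simp: unit_ball_def)
  show ?thesis
  proof (cases "N y = 0")
    case True
    \<comment> \<open>For \<open>y \<noteq> 0\<close> this vector would have norm
      \<open>2 + \<epsilon>\<close>.\<close>
    have "norm (((2 + \<epsilon>) / norm y) *\<^sub>R y) \<le> 1 + \<epsilon>" by (rule bd) (simp add: N_scale True)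
    then show ?thesis using True eps_pos by (cases "y = 0") auto
  next
    case False
    then have pos: "N y > 0" using N_nonneg[of y] by simp
    have "norm (inverse (N y) *\<^sub>R y) \<le> 1 + \<epsilon>" by (rule bd) (use pos in \<open>simp add: N_scale\<close>)
    then show ?thesis using pos by (simp add: field_simps)
  qed
qed

lemma equivalent_norm_N: "equivalent_norm N"
  unfolding equivalent_norm_def
proof (intro conjI allI)
  show "N y = 0 \<longleftrightarrow> y = 0" for y
    using norm_le_N[of y] sublinear_0[OF sublinear_N] by auto
  show "\<exists>m>0. \<exists>M>0. \<forall>x. m * norm x \<le> N x \<and> N x \<le> M * norm x"
  proof -
    have "inverse (1 + \<epsilon>) * norm x \<le> N x" for x
      using norm_le_N[of x] eps_pos by (simp add: field_simps)
    moreover have "N x \<le> 1 * norm x" for x using N_le_norm by simp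
    moreover have "inverse (1 + \<epsilon>) > 0" using eps_pos by simp
    ultimately show ?thesis using zero_less_one by blast
  qed
qed (use N_nonneg N_scale sublinear_add[OF sublinear_N] in auto)

lemma eps_equivalent_renorming_N: "eps_equivalent_renorming \<epsilon> N"
  unfolding eps_equivalent_renorming_def
proof (intro conjI subsetI)
  show "equivalent_norm N" by (rule equivalent_norm_N)
  show "y \<in> cball 0 1 \<Longrightarrow> y \<in> unit_ball N" for y
    using cball_in_body by (simp add: unit_ball_N)
  fix y assume "y \<in> unit_ball N"
  then have "norm y \<le> 1 + \<epsilon>" using body_norm_le by (simp add: unit_ball_N)
  then show "y \<in> (\<lambda>x. (1 + \<epsilon>) *\<^sub>R x) ` cball 0 1"
    using eps_pos by (intro image_eqI[of _ _ "inverse (1 + \<epsilon>) *\<^sub>R y"]) (auto simp: field_simps)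
qed

text \<open>\<open>\<phi>\<close> exposes \<open>v \<phi>\<close>: its maximum on the body is
  \<open>1 + t \<phi>\<close>, and where it is attained \<open>two_cuts\<close> fixes the values of
  all other functionals.\<close>

lemma v_extreme:
  assumes \<phi>: "\<phi> \<in> \<Phi>"
  shows "v \<phi> extreme_point_of body"
  unfolding extreme_point_of_def
proof (intro conjI ballI notI)
  show "v \<phi> \<in> body" by (rule v_in_body[OF \<phi>])
  fix a b assume ab: "a \<in> body" "b \<in> body" "v \<phi> \<in> open_segment a b"
  then obtain u where u: "a \<noteq> b" "0 < u" "u < 1" "v \<phi> = (1 - u) *\<^sub>R a + u *\<^sub>R b"
    by (auto simp: in_segment)
  have le: "blinfun_apply \<phi> z \<le> 1 + t \<phi>" if "z \<in> body" for z
    using pairs_ex[OF \<phi>] two_cuts(1) cut_body_le[OF _ that] pairs_minus(2) by blast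
  have "(1 - u) * blinfun_apply \<phi> a + u * blinfun_apply \<phi> b = 1 + t \<phi>"
    using v_self[OF \<phi>] by (simp add: u(4) blinfun.bilinear_simps)
  moreover have "(1 - u) * (1 + t \<phi> - blinfun_apply \<phi> a) \<ge> 0" "u * (1 + t \<phi> - blinfun_apply \<phi> b) \<ge> 0"
    using le[OF ab(1)] le[OF ab(2)] u by auto
  moreover have "(1 - u) * (1 + t \<phi> - blinfun_apply \<phi> a) + u * (1 + t \<phi> - blinfun_apply \<phi> b)
      = 1 + t \<phi> - ((1 - u) * blinfun_apply \<phi> a + u * blinfun_apply \<phi> b)"
    by (simp add: algebra_simps)
  ultimately have "(1 - u) * (1 + t \<phi> - blinfun_apply \<phi> a) = 0" "u * (1 + t \<phi> - blinfun_apply \<phi> b) = 0"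
    by linarith+
  then have max: "blinfun_apply \<phi> a = 1 + t \<phi>" "blinfun_apply \<phi> b = 1 + t \<phi>" using u by auto
  have "z = v \<phi>" if z: "z \<in> body" "blinfun_apply \<phi> z = 1 + t \<phi>" for z
  proof (rule eq_if_equal_on_\<Phi>)
    fix \<psi> assume \<psi>: "\<psi> \<in> \<Phi>"
    consider "\<psi> = \<phi>" | "\<psi> = - \<phi>" | "(\<phi>, \<psi>) \<in> pairs" using \<psi> \<phi> by (auto simp: pairs_def)
    then show "blinfun_apply \<psi> z = blinfun_apply \<psi> (v \<phi>)"
    proof cases
      case 3
      then show ?thesis
        using two_cuts(2)[OF 3] cut_body_le[OF 3 z(1)] cut_body_le[OF pairs_minus(2)[OF 3] z(1)] z(2) by blast
    qed (use z v_self[OF \<phi>] in \<open>auto simp: blinfun.minus_left\<close>)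
  qed
  then show False using ab max u(1) by metis
qed

lemma body_eq_closure_ext: "body = closure (convex hull (ext body))"
proof
  have "v ` \<Phi> \<subseteq> ext body" using v_extreme by (auto simp: ext_def)
  then show "body \<subseteq> closure (convex hull (ext body))"
    using closure_mono[OF hull_mono] by (subst (1) body_def) blast
  have "ext body \<subseteq> body" by (auto simp: ext_def extreme_point_of_def)
  then have "convex hull (ext body) \<subseteq> body" by (simp add: hull_minimal convex_body)
  then show "closure (convex hull (ext body)) \<subseteq> body"
    by (rule closure_minimal) (simp add: body_def)
qed

end

section \<open>Polyhedrality and (V)-polyhedrality of the spiked norm\<close>

context spiked_ball
begin

text \<open>Over the spike of \<open>\<phi>\<close> only \<open>\<phi>\<close> exceeds 1, since the
  others are at most 1 both at the apex and at the base point. Division by \<open>\<phi> y\<close>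
  gives a point of the old ball in the same subspace at which \<open>\<phi>\<close> alone is active,
  which lets old sections tell spikes apart.\<close>

lemma unique_active:
  assumes y: "y \<in> body" and \<phi>: "\<phi> \<in> \<Phi>" "blinfun_apply \<phi> y > 1"
  obtains z where "z \<in> span {y}" "norm z \<le> 1" "blinfun_apply \<phi> z = 1"
    "\<And>\<psi>. \<psi> \<in> \<Phi> \<Longrightarrow> \<psi> \<noteq> \<phi> \<Longrightarrow> blinfun_apply \<psi> z < 1"
proof -
  obtain a b where ab: "0 < a" "a \<le> 1" "norm b \<le> 1" "blinfun_apply \<phi> b = 1" "y = a *\<^sub>R v \<phi> + (1 - a) *\<^sub>R b"
    using spike_decomposition[OF cut_body_le[OF _ y] \<phi>] by blast
  define z where "z = inverse (blinfun_apply \<phi> y) *\<^sub>R y"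
  have less: "blinfun_apply \<psi> y \<le> 1" if \<psi>: "\<psi> \<in> \<Phi>" "\<psi> \<noteq> \<phi>" for \<psi>
  proof (cases "\<psi> = - \<phi>")
    case True
    then show ?thesis using \<phi>(2) by (simp add: blinfun.minus_left)
  next
    case False
    have "blinfun_apply \<psi> (v \<phi>) \<le> 1"
      using v_other[OF \<phi>(1) \<psi> False] t_nu[OF \<phi>(1)] t_pos[OF \<phi>(1)] by simp
    then have "a * blinfun_apply \<psi> (v \<phi>) + (1 - a) * blinfun_apply \<psi> b \<le> a * 1 + (1 - a) * 1"
      by (intro add_mono mult_left_mono) (use ab le_norm[OF \<psi>(1), of b] in auto)
    then show ?thesis by (simp add: ab(5) blinfun.bilinear_simps)
  qed
  have z\<psi>: "blinfun_apply \<psi> z < 1" if "\<psi> \<in> \<Phi>" "\<psi> \<noteq> \<phi>" for \<psi>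
    using less[OF that] \<phi>(2) by (simp add: z_def blinfun.scaleR_right field_simps)
  have z\<phi>: "blinfun_apply \<phi> z = 1" using \<phi>(2) by (simp add: z_def blinfun.scaleR_right)
  have "norm z \<le> 1" by (rule norming) (use z\<psi> z\<phi> in force)
  moreover have "z \<in> span {y}" by (simp add: z_def span_scale span_base)
  ultimately show thesis using that z\<psi> z\<phi> by blast
qed

text \<open>
  A spike meeting \<open>span b\<close> is determined by the vertices of the old section at which its functional
  equals \<open>1\<close>.
\<close>
lemma finite_spikes:
  assumes W: "finite W" "cball 0 1 \<inter> span b = convex hull W"
  shows "finite {\<phi>\<in>\<Phi>. \<exists>y\<in>body \<inter> span b. blinfun_apply \<phi> y > 1}" (is "finite ?S")
proof -
  define I where "I \<phi> = {w\<in>W. blinfun_apply \<phi> w = 1}" for \<phi> :: "'a \<Rightarrow>\<^sub>L real"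
  have "inj_on I ?S"
  proof (rule inj_onI)
    fix \<phi> \<psi> assume \<phi>: "\<phi> \<in> ?S" and \<psi>: "\<psi> \<in> ?S" and eq: "I \<phi> = I \<psi>"
    from \<phi> obtain y where y: "\<phi> \<in> \<Phi>" "y \<in> body" "y \<in> span b" "blinfun_apply \<phi> y > 1" by auto
    obtain z where z: "z \<in> span {y}" "norm z \<le> 1" "blinfun_apply \<phi> z = 1"
      "\<And>\<psi>. \<psi> \<in> \<Phi> \<Longrightarrow> \<psi> \<noteq> \<phi> \<Longrightarrow> blinfun_apply \<psi> z < 1"
      by (rule unique_active[OF y(2,1,4)]) blast
    have "span {y} \<subseteq> span b" using y(3) by (simp add: span_minimal)
    then have "z \<in> convex hull W" using z(1,2) W(2) by auto
    from this[unfolded convex_hull_finite[OF W(1)]]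
    obtain u where u: "\<forall>w\<in>W. 0 \<le> u w" "sum u W = 1" "(\<Sum>w\<in>W. u w *\<^sub>R w) = z" by blast
    have W_le: "blinfun_apply \<phi> w \<le> 1" if "w \<in> W" for w
    proof -
      have "w \<in> cball 0 1 \<inter> span b" unfolding W(2) by (rule hull_inc[OF that])
      then show ?thesis using le_norm[OF y(1), of w] by simp
    qed
    have at_z: "blinfun_apply f z = (\<Sum>w\<in>W. u w * blinfun_apply f w)" for f :: "'a \<Rightarrow>\<^sub>L real"
      by (simp flip: u(3) add: blinfun.sum_right blinfun.scaleR_right)
    have "(\<Sum>w\<in>W. u w * (1 - blinfun_apply \<phi> w)) = 0"
      using z(3) u(2) at_z[of \<phi>] by (simp add: right_diff_distrib sum_subtractf)
    moreover have "\<forall>w\<in>W. 0 \<le> u w * (1 - blinfun_apply \<phi> w)" using u W_le by simp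
    ultimately have "\<forall>w\<in>W. u w * (1 - blinfun_apply \<phi> w) = 0"
      using sum_nonneg_eq_0_iff[OF W(1), of "\<lambda>w. u w * (1 - blinfun_apply \<phi> w)"] by simp
    \<comment> \<open>Every vertex carrying weight in \<open>z\<close> is active for
      \<open>\<phi>\<close>, hence for \<open>\<psi>\<close>. So \<open>\<psi>\<close> is active at
      \<open>z\<close>, where only \<open>\<phi>\<close> is.\<close>
    then have "(\<Sum>w\<in>W. u w * blinfun_apply \<psi> w) = sum u W"
      using eq by (intro sum.cong refl) (auto simp: I_def set_eq_iff)
    then have "blinfun_apply \<psi> z = 1"
      using u(2) at_z[of \<psi>] by simp
    then show "\<phi> = \<psi>" using z(4)[of \<psi>] \<psi> by force
  qed
  moreover have "finite (I ` ?S)"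
    by (rule finite_subset[of _ "Pow W"]) (auto simp: I_def W(1))
  ultimately show ?thesis by (simp add: finite_image_iff)
qed

text \<open>A spike can meet \<open>span b\<close> while its apex lies outside. The relevant apexes
  are therefore adjoined first: in the larger space \<open>G\<close> one takes the hull
  \<open>K\<close> of the old section and these apexes, then cuts back to \<open>span b\<close>.
  Base points stay in \<open>G\<close>, being combinations of \<open>y\<close> and an apex.\<close>

lemma polyhedral_N:
  assumes "polyhedral (norm :: 'a \<Rightarrow> real)"
  shows "polyhedral N"
  unfolding polyhedral_def
proof (intro allI impI)
  fix b :: "'a set" assume b: "finite b"
  have sect: "polytope (cball 0 1 \<inter> span c)" if "finite c" for c :: "'a set"
    using assms that by (simp add: polyhedral_def unit_ball_norm)
  define S where "S = {\<phi>\<in>\<Phi>. \<exists>y\<in>body \<inter> span b. blinfun_apply \<phi> y > 1}"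
  have "finite S"
    using sect[OF b] finite_spikes unfolding polytope_def S_def by blast
  define G where "G = span (b \<union> v ` S)"
  have "polytope (cball 0 1 \<inter> G)"
    unfolding G_def using b \<open>finite S\<close> by (intro sect) simp
  then obtain W where W: "finite W" "cball 0 1 \<inter> G = convex hull W" by (auto simp: polytope_def)
  define K where "K = convex hull (W \<union> v ` S)"
  have "W \<subseteq> cball 0 1 \<inter> G" unfolding W(2) by (rule hull_subset)
  have "polytope K" unfolding K_def polytope_def using W(1) \<open>finite S\<close>
    by (intro exI[of _ "W \<union> v ` S"]) simp
  moreover have "K \<subseteq> G"
    unfolding K_def
  proof (rule hull_minimal)
    show "W \<union> v ` S \<subseteq> G" using \<open>W \<subseteq> _\<close> by (auto simp: G_def intro: span_base)
    show "convex G" unfolding G_def by (rule subspace_imp_convex[OF subspace_span])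
  qed
  ultimately have "polytope (K \<inter> span b)"
    unfolding G_def using \<open>finite S\<close> by (intro polytope_Int_span[of "v ` S"]) auto
  moreover have "body \<inter> span b = K \<inter> span b"
  proof (intro equalityI subsetI)
    have "W \<union> v ` S \<subseteq> body"
      using \<open>W \<subseteq> _\<close> cball_in_body v_in_body by (auto simp: S_def)
    then have "K \<subseteq> body" unfolding K_def by (intro hull_minimal convex_body)
    then show "y \<in> body \<inter> span b" if "y \<in> K \<inter> span b" for y using that by auto
  next
    fix y assume y: "y \<in> body \<inter> span b"
    have cballK: "cball 0 1 \<inter> G \<subseteq> K" unfolding W(2) K_def by (rule hull_mono) simp
    have bG: "span b \<subseteq> G" unfolding G_def by (rule span_mono) simp
    have "y \<in> K"
    proof (cases "\<exists>\<phi>\<in>\<Phi>. blinfun_apply \<phi> y > 1")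
      case True
      then obtain \<phi> where \<phi>: "\<phi> \<in> \<Phi>" "blinfun_apply \<phi> y > 1" by blast
      then have "\<phi> \<in> S" using y by (auto simp: S_def)
      then have vK: "v \<phi> \<in> K" and vG: "v \<phi> \<in> G"
        by (auto simp: K_def G_def intro: hull_inc span_base)
      obtain a c where ac: "0 < a" "a \<le> 1" "norm c \<le> 1" "y = a *\<^sub>R v \<phi> + (1 - a) *\<^sub>R c"
        using spike_decomposition[OF cut_body_le \<phi>] y by (metis IntD1)
      show ?thesis
      proof (cases "a = 1")
        case True
        then show ?thesis using ac(4) vK by simp
      next
        case False
        have "c = inverse (1 - a) *\<^sub>R (y - a *\<^sub>R v \<phi>)" using ac(4) False by simp
        moreover have "y \<in> G" using y bG by auto
        ultimately have "c \<in> G" unfolding G_def using vG[unfolded G_def] by (simp add: span_diff span_scale)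
        then have "c \<in> K" using cballK ac(3) by auto
        then show ?thesis
          unfolding ac(4) using ac(1,2) vK by (intro convexD) (auto simp: K_def)
      qed
    next
      case False
      then have "norm y \<le> 1" by (intro norming) (auto simp: not_less)
      then show ?thesis using cballK bG y by auto
    qed
    then show "y \<in> K \<inter> span b" using y by simp
  qed
  ultimately show "polytope (unit_ball N \<inter> span b)" by (simp add: unit_ball_N)
qed

text \<open>The gap of \<open>\<Phi>\<close> passes to the cuts if the weights in them are bounded
  below. The weight of \<open>\<phi>\<close> is at least 1/2; that of \<open>h\<close> is only known
  to be at least \<open>t \<phi> / 3\<close>, and finiteness of the active set bounds this below for
  the active \<open>\<phi>\<close>.\<close>

lemma cut_gap_on_sphere:
  assumes x: "norm x \<le> 1"
    and d: "d > 0" "finite {f\<in>\<Phi>. blinfun_apply f x = 1}"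
      "\<And>f. f \<in> \<Phi> \<Longrightarrow> blinfun_apply f x = 1 \<or> blinfun_apply f x \<le> 1 - d"
  obtains c where "c < 1" "\<And>\<phi> h. (\<phi>, h) \<in> pairs \<Longrightarrow>
    blinfun_apply (cut \<phi> h) x = 1 \<or> blinfun_apply (cut \<phi> h) x \<le> c"
proof -
  define s where "s = Min (insert 1 (t ` {f\<in>\<Phi>. blinfun_apply f x = 1}))"
  have fin: "finite (insert 1 (t ` {f\<in>\<Phi>. blinfun_apply f x = 1}))" using d(2) by simp
  have s_pos: "s > 0" unfolding s_def using fin t_pos by (subst Min_gr_iff) auto
  have s_le: "s \<le> t \<phi>" if "\<phi> \<in> \<Phi>" "blinfun_apply \<phi> x = 1" for \<phi>
    unfolding s_def using that by (intro Min_le[OF fin]) auto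
  \<comment> \<open>First term: \<open>\<phi>\<close> is not active and loses \<open>d\<close> with
    weight at least 1/2. Second term: \<open>\<phi>\<close> is active and \<open>h\<close> is not,
    with weight at least \<open>s / 3\<close>.\<close>
  define c where "c = max (1 - d / 2) (1 - s / 3 * d)"
  have "c < 1" using d(1) s_pos by (simp add: c_def)
  moreover have "blinfun_apply (cut \<phi> h) x = 1 \<or> blinfun_apply (cut \<phi> h) x \<le> c"
    if p: "(\<phi>, h) \<in> pairs" for \<phi> h
  proof -
    note in\<Phi> = pairsD[OF p] and \<alpha> = \<alpha>_bounds[OF p]
    have hx: "blinfun_apply h x \<le> 1" using le_norm[of h x] in\<Phi> x by simp
    show ?thesis
    proof (cases "blinfun_apply \<phi> x = 1")
      case True
      show ?thesis
      proof (cases "blinfun_apply h x = 1")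
        case True
        then show ?thesis using \<open>blinfun_apply \<phi> x = 1\<close> by (simp add: cut_apply)
      next
        case False
        then have "d \<le> 1 - blinfun_apply h x" using d(3)[of h] in\<Phi> by auto
        moreover have "s / 3 \<le> 1 - \<alpha> \<phi> h" using s_le[of \<phi>] True in\<Phi> \<alpha>(3) by simp
        ultimately have "s / 3 * d \<le> (1 - \<alpha> \<phi> h) * (1 - blinfun_apply h x)"
          by (intro mult_mono) (use s_pos d(1) in auto)
        moreover have "blinfun_apply (cut \<phi> h) x = 1 - (1 - \<alpha> \<phi> h) * (1 - blinfun_apply h x)"
          using True by (simp add: cut_apply algebra_simps)
        ultimately have "blinfun_apply (cut \<phi> h) x \<le> 1 - s / 3 * d" by linarith
        then show ?thesis by (simp add: c_def le_max_iff_disj)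
      qed
    next
      case False
      then have "blinfun_apply \<phi> x \<le> 1 - d" using d(3)[of \<phi>] in\<Phi> by auto
      then have "\<alpha> \<phi> h * blinfun_apply \<phi> x + (1 - \<alpha> \<phi> h) * blinfun_apply h x \<le> \<alpha> \<phi> h * (1 - d) + (1 - \<alpha> \<phi> h) * 1"
        by (intro add_mono mult_left_mono) (use \<alpha> hx in auto)
      also have "\<dots> = 1 - \<alpha> \<phi> h * d" by (simp add: algebra_simps)
      also have "\<dots> \<le> 1 - d / 2" using mult_right_mono[OF \<alpha>(1), of d] d(1) by simp
      finally show ?thesis by (simp add: cut_apply c_def le_max_iff_disj)
    qed
  qed
  ultimately show thesis using that by blast
qed

text \<open>Only \<open>\<phi>\<close> exceeds 1 at \<open>x\<close>, so cuts are sorted by whether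
  they start at \<open>\<phi>\<close>, end at it, or avoid it. The one small weight to be bounded
  below belongs to this single \<open>\<phi>\<close>.\<close>

lemma cut_gap_on_spike:
  assumes \<phi>: "\<phi> \<in> \<Phi>"
    and x: "0 < a" "a \<le> 1" "norm b \<le> 1" "blinfun_apply \<phi> b = 1" "x = a *\<^sub>R v \<phi> + (1 - a) *\<^sub>R b"
    and d: "d > 0" "\<And>f. f \<in> \<Phi> \<Longrightarrow> blinfun_apply f b = 1 \<or> blinfun_apply f b \<le> 1 - d"
  obtains c where "c < 1" "\<And>\<xi> h. (\<xi>, h) \<in> pairs \<Longrightarrow>
    blinfun_apply (cut \<xi> h) x = 1 \<or> blinfun_apply (cut \<xi> h) x \<le> c"
proof -
  have nu: "t \<phi> > 0" "t \<phi> + \<nu> \<phi> < 1" "\<nu> \<phi> \<ge> 0" using t_pos t_nu nu_nonneg \<phi> by auto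
  \<comment> \<open>\<open>c1\<close> bounds every other functional of the family at
    \<open>x\<close>. \<open>c2\<close> serves the cuts starting at \<open>\<phi>\<close>, which
    inherit the gap at \<open>b\<close> with factor \<open>1 - a\<close>; if \<open>a = 1\<close>
    they equal 1 at \<open>x\<close>, and 0 is a filler. \<open>c3\<close> is the mean of
    \<open>c1\<close> and \<open>\<phi> x = 1 + a * t \<phi>\<close>, for cuts giving
    \<open>\<phi>\<close> at most half the weight.\<close>
  define c1 where "c1 = 1 - a * (1 - \<nu> \<phi>)"
  define c2 where "c2 = (if a = 1 then 0 else 1 - (1 - a) * (t \<phi> / 3 * d))"
  define c3 where "c3 = 1 - a * (1 - \<nu> \<phi> - t \<phi>) / 2"
  define c where "c = max c1 (max c2 c3)"
  have "c < 1" using nu x d by (auto simp: c_def c1_def c2_def c3_def)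
  moreover have "blinfun_apply (cut \<xi> h) x = 1 \<or> blinfun_apply (cut \<xi> h) x \<le> c"
    if p: "(\<xi>, h) \<in> pairs" for \<xi> h
  proof -
    note in\<Phi> = pairsD[OF p] and \<alpha> = \<alpha>_bounds[OF p]
    have x\<phi>: "blinfun_apply \<phi> x = 1 + a * t \<phi>"
      using x(4) v_self[OF \<phi>] by (simp add: x(5) blinfun.bilinear_simps algebra_simps)
    have below: "blinfun_apply \<psi> x \<le> c1" if \<psi>: "\<psi> \<in> \<Phi>" "\<psi> \<noteq> \<phi>" for \<psi>
    proof (cases "\<psi> = - \<phi>")
      case True
      have "a * (1 - \<nu> \<phi>) \<le> 1 * 1" by (rule mult_mono) (use x nu in auto)
      moreover have "0 \<le> a * t \<phi>" using x(1) nu(1) by simp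
      ultimately show ?thesis using x\<phi> True by (simp add: c1_def blinfun.minus_left)
    next
      case False
      have "blinfun_apply \<psi> (v \<phi>) \<le> \<nu> \<phi>" using v_other[OF \<phi> \<psi> False] by simp
      then have "a * blinfun_apply \<psi> (v \<phi>) + (1 - a) * blinfun_apply \<psi> b \<le> a * \<nu> \<phi> + (1 - a) * 1"
        by (intro add_mono mult_left_mono) (use x le_norm[OF \<psi>(1), of b] in auto)
      then show ?thesis by (simp add: x(5) c1_def blinfun.bilinear_simps algebra_simps)
    qed
    consider "\<xi> = \<phi>" | "h = \<phi>" | "\<xi> \<noteq> \<phi>" "h \<noteq> \<phi>" by blast
    then show ?thesis
    proof cases
      case 1
      have cx: "blinfun_apply (cut \<xi> h) x = 1 - (1 - a) * (1 - \<alpha> \<xi> h) * (1 - blinfun_apply h b)"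
      proof -
        have "blinfun_apply (cut \<xi> h) x = a * blinfun_apply (cut \<xi> h) (v \<xi>) + (1 - a) * blinfun_apply (cut \<xi> h) b"
          using 1 by (simp only: x(5) blinfun.bilinear_simps) simp
        also have "\<dots> = a * 1 + (1 - a) * (1 - (1 - \<alpha> \<xi> h) * (1 - blinfun_apply h b))"
          using x(4) 1 unfolding cut_self[OF p] cut_apply[of _ _ b] by (simp add: algebra_simps)
        finally show ?thesis by (simp add: algebra_simps)
      qed
      show ?thesis
      proof (cases "a = 1 \<or> blinfun_apply h b = 1")
        case True
        then show ?thesis using cx by auto
      next
        case False
        then have "d \<le> 1 - blinfun_apply h b" using d(2)[of h] in\<Phi> by auto
        then have "t \<phi> / 3 * d \<le> (1 - \<alpha> \<xi> h) * (1 - blinfun_apply h b)"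
          by (intro mult_mono) (use \<alpha> 1 nu d in auto)
        then have "(1 - a) * (t \<phi> / 3 * d) \<le> (1 - a) * ((1 - \<alpha> \<xi> h) * (1 - blinfun_apply h b))"
          by (rule mult_left_mono) (use x(2) in simp)
        then have "blinfun_apply (cut \<xi> h) x \<le> c2" using cx False by (simp add: c2_def mult.assoc)
        then show ?thesis by (simp add: c_def le_max_iff_disj)
      qed
    next
      case 2
      then have "blinfun_apply \<xi> x \<le> c1" using below[of \<xi>] in\<Phi> by simp
      moreover have c1_le: "c1 \<le> 1 + a * t \<phi>"
      proof -
        have "0 \<le> a * (1 - \<nu> \<phi>)" "0 \<le> a * t \<phi>" using x(1) nu by simp_all
        then show ?thesis by (simp add: c1_def)
      qed
      ultimately have "\<alpha> \<xi> h * blinfun_apply \<xi> x + (1 - \<alpha> \<xi> h) * blinfun_apply h x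
          \<le> \<alpha> \<xi> h * c1 + (1 - \<alpha> \<xi> h) * (1 + a * t \<phi>)"
        using 2 x\<phi> \<alpha> by (intro add_mono mult_left_mono) auto
      also have "\<dots> = (c1 + (1 + a * t \<phi>)) / 2 - (\<alpha> \<xi> h - 1 / 2) * ((1 + a * t \<phi>) - c1)"
        by (simp add: field_simps)
      also have "\<dots> \<le> (c1 + (1 + a * t \<phi>)) / 2"
        using mult_nonneg_nonneg[of "\<alpha> \<xi> h - 1 / 2" "(1 + a * t \<phi>) - c1"] \<alpha>(1) c1_le by linarith
      also have "\<dots> = c3" by (simp add: c1_def c3_def field_simps)
      finally show ?thesis by (simp add: cut_apply c_def le_max_iff_disj)
    next
      case 3
      then show ?thesis
        using cut_le_max[OF p, of x c1] below in\<Phi> by (simp add: c_def le_max_iff_disj)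
    qed
  qed
  ultimately show thesis using that by blast
qed

text \<open>An extreme functional is not known to be a cut. The cuts are split by their value at
  \<open>x\<close>: those in \<open>M1\<close> all equal 1 there, so their supremum takes the values
  1 and -1 at \<open>x\<close> and \<open>- x\<close>, as the dichotomy requires.\<close>

lemma extreme_functional_gap:
  assumes x: "N x = 1"
    and c: "c < 1" "\<And>\<phi> h. (\<phi>, h) \<in> pairs \<Longrightarrow> blinfun_apply (cut \<phi> h) x = 1 \<or> blinfun_apply (cut \<phi> h) x \<le> c"
    and g: "g extreme_point_of {h. \<forall>y. blinfun_apply h y \<le> N y}"
  shows "blinfun_apply g x = 1 \<or> blinfun_apply g x \<le> max c 0"
proof -
  define M1 where "M1 = {p\<in>pairs. blinfun_apply (cut (fst p) (snd p)) x = 1}"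
  define M2 where "M2 = pairs - M1"
  define p where "p M y = (SUP r\<in>M. blinfun_apply (cut (fst r) (snd r)) y)" for M y
  have upper: "blinfun_apply (cut (fst r) (snd r)) y \<le> p M y" if "r \<in> M" "M \<subseteq> pairs" for r M y
  proof -
    have "bdd_above ((\<lambda>r. blinfun_apply (cut (fst r) (snd r)) y) ` M)"
      by (rule bdd_aboveI2[of _ _ "norm y"]) (use cut_le_norm that in auto)
    then show ?thesis unfolding p_def by (rule cSUP_upper[rotated]) (rule that(1))
  qed
  have least: "p M y \<le> e" if "M \<noteq> {}" "\<And>r. r \<in> M \<Longrightarrow> blinfun_apply (cut (fst r) (snd r)) y \<le> e" for M y e
    unfolding p_def by (rule cSUP_least) (use that in auto)
  have sublinear: "sublinear (p M)" if M: "M \<noteq> {}" "M \<subseteq> pairs" for M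
  proof (rule sublinearI)
    show "p M (y + z) \<le> p M y + p M z" for y z
      by (rule least[OF M(1)]) (use upper[OF _ M(2)] in \<open>simp add: blinfun.add_right add_mono\<close>)
    obtain r where "r \<in> M" using M by blast
    then have "(0::real) \<le> p M 0" using upper[OF _ M(2), of r 0] by simp
    moreover have "p M 0 \<le> 0" by (rule least[OF M(1)]) simp
    ultimately show "p M 0 = 0" by simp
    show "p M (k *\<^sub>R y) \<le> k * p M y" if "k > 0" for k y
      by (rule least[OF M(1)]) (use upper[OF _ M(2)] that in \<open>simp add: blinfun.scaleR_right\<close>)
  qed
  have M: "M1 \<subseteq> pairs" "M2 \<subseteq> pairs" by (auto simp: M1_def M2_def)
  have "M1 \<noteq> {}"
  proof
    assume "M1 = {}"
    then have "N x \<le> c" using c(2) by (intro N_least) (force simp: M1_def)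
    then show False using x c(1) by simp
  qed
  then obtain \<phi> h where \<phi>h: "(\<phi>, h) \<in> M1" by auto
  \<comment> \<open>The opposite cut has value -1 at \<open>x\<close>.\<close>
  then have "(- \<phi>, - h) \<in> M2"
    using cut_minus[of \<phi> h] by (auto simp: M1_def M2_def pairs_minus blinfun.minus_left)
  then have "M2 \<noteq> {}" by auto
  show ?thesis
  proof (rule extreme_functional_dichotomy[OF sublinear sublinear _ N_nonneg _ _ _ _ _ g])
    show "M1 \<noteq> {}" "M1 \<subseteq> pairs" "M2 \<noteq> {}" "M2 \<subseteq> pairs" by fact+
    show "N y = max (p M1 y) (p M2 y)" for y
    proof (rule antisym)
      show "N y \<le> max (p M1 y) (p M2 y)"
      proof (rule N_least)
        fix \<phi> h assume "(\<phi>, h) \<in> pairs"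
        then have "(\<phi>, h) \<in> M1 \<or> (\<phi>, h) \<in> M2" by (auto simp: M2_def)
        then show "blinfun_apply (cut \<phi> h) y \<le> max (p M1 y) (p M2 y)"
          using upper[OF _ M(1), of "(\<phi>, h)" y] upper[OF _ M(2), of "(\<phi>, h)" y] by auto
      qed
      show "max (p M1 y) (p M2 y) \<le> N y"
        by (rule max.boundedI; rule least) (use \<open>M1 \<noteq> {}\<close> \<open>M2 \<noteq> {}\<close> M cut_le_N in auto)
    qed
    show "N y \<le> 1 * norm y" for y using N_le_norm by simp
    show "p M1 x = 1"
      using upper[OF \<phi>h M(1), of x] least[OF \<open>M1 \<noteq> {}\<close>, of x 1] \<phi>h by (force simp: M1_def)
    have "p M1 (- x) \<le> - 1" by (rule least[OF \<open>M1 \<noteq> {}\<close>]) (simp add: M1_def blinfun.minus_right)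
    moreover have "- 1 \<le> p M1 (- x)"
      using upper[OF \<phi>h M(1), of "- x"] \<phi>h by (simp add: M1_def blinfun.minus_right)
    ultimately show "p M1 (- x) = - 1" by simp
    have "p M2 x \<le> c"
    proof (rule least[OF \<open>M2 \<noteq> {}\<close>])
      fix r assume "r \<in> M2"
      then show "blinfun_apply (cut (fst r) (snd r)) x \<le> c"
        using c(2)[of "fst r" "snd r"] by (auto simp: M1_def M2_def)
    qed
    then show "p M2 x \<le> max c 0" by simp
    show "0 \<le> max c 0" by simp
  qed
qed

text \<open>A point of the new sphere lies on the old sphere or over a spike. In the second case the
  gap is taken at the base point \<open>b\<close>, which has norm 1 because
  \<open>\<phi> b = 1\<close>.\<close>

lemma V_polyhedral_N:
  assumes active: "\<And>x. norm x = 1 \<Longrightarrow> \<exists>d>0. finite {f\<in>\<Phi>. blinfun_apply f x = 1} \<and>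
    (\<forall>f\<in>\<Phi>. blinfun_apply f x = 1 \<or> blinfun_apply f x \<le> 1 - d)"
  shows "V_polyhedral N"
proof (rule V_polyhedralI[OF equivalent_norm_N])
  fix x assume x: "N x = 1"
  obtain c where c: "c < 1" "\<And>\<phi> h. (\<phi>, h) \<in> pairs \<Longrightarrow>
    blinfun_apply (cut \<phi> h) x = 1 \<or> blinfun_apply (cut \<phi> h) x \<le> c"
  proof (cases "\<exists>\<phi>\<in>\<Phi>. blinfun_apply \<phi> x > 1")
    case True
    then obtain \<phi> where \<phi>: "\<phi> \<in> \<Phi>" "blinfun_apply \<phi> x > 1" by blast
    have "blinfun_apply (cut \<psi> h) x \<le> 1" if "(\<psi>, h) \<in> pairs" for \<psi> h
      using cut_le_N[OF that, of x] x by simp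
    then obtain a b where ab: "0 < a" "a \<le> 1" "norm b \<le> 1" "blinfun_apply \<phi> b = 1" "x = a *\<^sub>R v \<phi> + (1 - a) *\<^sub>R b"
      using spike_decomposition[OF _ \<phi>] by blast
    have "norm b = 1" using ab(3,4) le_norm[OF \<phi>(1), of b] by simp
    then obtain d where d: "d > 0" "\<forall>f\<in>\<Phi>. blinfun_apply f b = 1 \<or> blinfun_apply f b \<le> 1 - d"
      using active by blast
    show thesis
      by (rule cut_gap_on_spike[OF \<phi>(1) ab d(1)]) (use d(2) in blast, rule that)
  next
    case False
    then have nx: "norm x \<le> 1" by (intro norming) (auto simp: not_less)
    then have "norm x = 1" using N_le_norm[of x] x by simp
    then obtain d where d: "d > 0" "finite {f\<in>\<Phi>. blinfun_apply f x = 1}"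
      "\<forall>f\<in>\<Phi>. blinfun_apply f x = 1 \<or> blinfun_apply f x \<le> 1 - d"
      using active by blast
    show thesis
      by (rule cut_gap_on_sphere[OF nx d(1,2)]) (use d(3) in blast, rule that)
  qed
  show "\<exists>c<1. \<forall>h. h extreme_point_of {h. \<forall>y. blinfun_apply h y \<le> N y} \<longrightarrow>
      blinfun_apply h x = 1 \<or> blinfun_apply h x \<le> c"
    using extreme_functional_gap[OF x c] c(1) by (intro exI[of _ "max c 0"]) auto
qed

end

section \<open>The construction\<close>

context renorming_construction
begin

lemma Well_order_\<Gamma>: "Well_order \<Gamma>"
  using Gamma(1) by (rule card_order_on_well_order_on)

text \<open>On a finite index set the infimum of the positive function \<open>\<theta>\<close> would
  be attained, against \<open>theta_inf\<close>.\<close>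

lemma infinite_Field: "infinite (Field \<Gamma>)"
proof
  assume fin: "finite (Field \<Gamma>)"
  have "(0::'a) \<in> closure (x ` Field \<Gamma>)" using x_dense by auto
  then obtain \<eta> where \<eta>: "\<eta> \<in> Field \<Gamma>" by fastforce
  define S where "S = {\<gamma>. (\<eta>, \<gamma>) \<in> \<Gamma>}"
  have S: "S \<subseteq> Field \<Gamma>" by (auto simp: S_def Field_def)
  have "(\<eta>, \<eta>) \<in> \<Gamma>"
    using Well_order_\<Gamma> \<eta> by (simp add: order_on_defs refl_on_def)
  then have "finite (\<theta> ` S)" "\<theta> ` S \<noteq> {}" using fin S finite_subset by (auto simp: S_def)
  then have "Inf (\<theta> ` S) \<in> \<theta> ` S" by (simp add: cInf_eq_Min)
  then have "0 < Inf (\<theta> ` S)" using S theta_range by auto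
  then show False using theta_inf[OF \<eta>] by (simp add: S_def)
qed

lemma J_subset: "J \<subseteq> Field \<Gamma>"
  by (auto simp: J_def)

lemma underS_mono: "(\<gamma>, \<gamma>') \<in> \<Gamma> \<Longrightarrow> underS \<Gamma> \<gamma> \<subseteq> underS \<Gamma> \<gamma>'"
  using Well_order_\<Gamma> by (intro underS_incr) (auto simp: order_on_defs)

lemma no_max: "\<eta> \<in> Field \<Gamma> \<Longrightarrow> \<exists>\<gamma>\<in>Field \<Gamma>. \<eta> \<in> underS \<Gamma> \<gamma>"
  using infinite_Card_order_limit[OF Gamma(1) infinite_Field] by (fastforce simp: underS_def)

lemma Restr_ordLeq: "(\<gamma>, \<gamma>') \<in> \<Gamma> \<Longrightarrow> Restr \<Gamma> (underS \<Gamma> \<gamma>) \<le>o Restr \<Gamma> (underS \<Gamma> \<gamma>')"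
  using ofilter_subset_ordLeq[OF Well_order_\<Gamma>] underS_mono
    wo_rel.underS_ofilter[unfolded wo_rel_def, OF Well_order_\<Gamma>] by blast

lemma J_upward: "\<gamma> \<in> J \<Longrightarrow> (\<gamma>, \<gamma>') \<in> \<Gamma> \<Longrightarrow> \<gamma>' \<in> J"
  using underS_mono[of \<gamma> \<gamma>'] Restr_ordLeq[of \<gamma> \<gamma>'] ordLess_ordLeq_trans
  by (fastforce simp: J_def Field_def split: if_splits)

lemma J_cofinal:
  assumes \<eta>: "\<eta> \<in> Field \<Gamma>"
  shows "\<exists>\<gamma>\<in>J. \<eta> \<in> underS \<Gamma> \<gamma>"
proof (cases "\<Gamma> =o natLeq")
  case True
  obtain \<gamma> where "\<gamma> \<in> Field \<Gamma>" "\<eta> \<in> underS \<Gamma> \<gamma>" using no_max[OF \<eta>] by blast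
  then show ?thesis using True by (auto simp: J_def)
next
  case False
  have "natLeq \<le>o |Field \<Gamma>|" using infinite_Field infinite_iff_natLeq_ordLeq by blast
  then have "natLeq \<le>o \<Gamma>" using card_of_Field_ordIso[OF Gamma(1)] ordLeq_ordIso_trans by blast
  then have "natLeq <o \<Gamma>"
    using False ordLeq_iff_ordLess_or_ordIso ordIso_symmetric by blast
  \<comment> \<open>\<open>\<beta>\<close> plays the role of the ordinal \<omega>. \<open>J\<close>
    starts strictly after it, so an index beyond both \<open>\<beta>\<close> and
    \<open>\<eta>\<close> is needed.\<close>
  then obtain \<beta> where \<beta>: "\<beta> \<in> Field \<Gamma>" "natLeq =o Restr \<Gamma> (underS \<Gamma> \<beta>)"
    using ordLess_iff_ordIso_Restr[OF Well_order_\<Gamma> natLeq_Well_order] by blast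
  have "(\<beta>, \<eta>) \<in> \<Gamma> \<or> (\<eta>, \<beta>) \<in> \<Gamma>"
    using Well_order_\<Gamma> \<beta>(1) \<eta> by (cases "\<beta> = \<eta>") (auto simp: order_on_defs total_on_def refl_on_def)
  then obtain \<delta> where \<delta>: "\<delta> \<in> Field \<Gamma>" "(\<beta>, \<delta>) \<in> \<Gamma>" "(\<eta>, \<delta>) \<in> \<Gamma>"
    using Well_order_\<Gamma> \<beta>(1) \<eta> by (auto simp: order_on_defs refl_on_def)
  obtain \<gamma> where \<gamma>: "\<gamma> \<in> Field \<Gamma>" "\<delta> \<in> underS \<Gamma> \<gamma>" using no_max[OF \<delta>(1)] by blast
  have under: "\<xi> \<in> underS \<Gamma> \<gamma>" if "(\<xi>, \<delta>) \<in> \<Gamma>" for \<xi>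
    using that \<gamma>(2) Well_order_\<Gamma> by (auto simp: underS_def order_on_defs dest: transD antisymD)
  have "underS \<Gamma> \<beta> \<subset> underS \<Gamma> \<gamma>"
    using underS_mono[of \<beta> \<gamma>] under[OF \<delta>(2)] by (auto simp: underS_def)
  then have "Restr \<Gamma> (underS \<Gamma> \<beta>) <o Restr \<Gamma> (underS \<Gamma> \<gamma>)"
    using ofilter_subset_ordLess[OF Well_order_\<Gamma>]
      wo_rel.underS_ofilter[unfolded wo_rel_def, OF Well_order_\<Gamma>] by blast
  then have "\<gamma> \<in> J" using False \<gamma>(1) ordIso_ordLess_trans[OF \<beta>(2)] by (simp add: J_def)
  then show ?thesis using under[OF \<delta>(3)] by blast
qed

lemma W_mono: "(\<gamma>, \<gamma>') \<in> \<Gamma> \<Longrightarrow> W \<gamma> \<subseteq> W \<gamma>'"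
  using underS_mono[of \<gamma> \<gamma>'] by (fastforce simp: W_def)

lemma A_total_subset: "A_total \<subseteq> Field \<Gamma>"
  using Aset_finite by (fastforce simp: A_total_def A_stage_def)

text \<open>The union of all \<open>W \<gamma>\<close>. As these sets increase and \<open>J\<close>
  is upward closed, each member is available for approximation at all late stages.\<close>

definition W_total :: "'a set" where
  "W_total = x ` Field \<Gamma> \<union> (\<Union>\<delta>\<in>J. E_stage \<delta>)"

lemma W_total_stage:
  assumes "p \<in> W_total"
  shows "\<exists>\<gamma>\<in>J. p \<in> W \<gamma>"
proof -
  consider \<eta> where "\<eta> \<in> Field \<Gamma>" "p = x \<eta>" | \<delta> where "\<delta> \<in> J" "p \<in> E_stage \<delta>"
    using assms by (auto simp: W_total_def)
  then show ?thesis
  proof cases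
    case 1
    then show ?thesis using J_cofinal[of \<eta>] by (auto simp: W_def)
  next
    case 2
    then show ?thesis using J_cofinal[of \<delta>] J_subset by (fastforce simp: W_def)
  qed
qed

lemma in_W_total: "w \<in> A_total \<Longrightarrow> ep w \<in> W_total" "w \<in> A_total \<Longrightarrow> em w \<in> W_total"
  by (auto simp: A_total_def W_total_def E_stage_def)

lemma e_on_face:
  assumes "\<gamma> \<in> Field \<Gamma>"
  shows "blinfun_apply (f \<gamma>) (e \<gamma>) = 1" "norm (e \<gamma>) \<le> 1"
proof -
  consider "\<gamma> \<notin> A_total" | "\<gamma> \<in> A_total" "lm \<gamma> \<le> lp \<gamma>" | "\<gamma> \<in> A_total" "lp \<gamma> < lm \<gamma>"
    by fastforce
  then have "blinfun_apply (f \<gamma>) (e \<gamma>) = 1 \<and> norm (e \<gamma>) \<le> 1"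
  proof cases
    case 1
    then show ?thesis using e_other assms face_interiorD by blast
  next
    case 2
    then show ?thesis using e_plus points face_interiorD by metis
  next
    case 3
    then show ?thesis using e_minus[of \<gamma>] points[of \<gamma>] face_interiorD[of "em \<gamma>" "- f \<gamma>"]
      by (simp add: blinfun.bilinear_simps)
  qed
  then show "blinfun_apply (f \<gamma>) (e \<gamma>) = 1" "norm (e \<gamma>) \<le> 1" by auto
qed

text \<open>The hull of the unstretched points, the target of the approximation; stretching by
  \<open>1 + \<tau> \<gamma>\<close> only enlarges it to \<open>B\<close>.\<close>

definition C :: "'a set" where
  "C = closure (convex hull (e ` Field \<Gamma> \<union> (\<lambda>\<gamma>. - e \<gamma>) ` Field \<Gamma>))"

lemma convex_C: "convex C"
  by (simp add: C_def convex_closure)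

lemma e_in_C: "\<gamma> \<in> Field \<Gamma> \<Longrightarrow> e \<gamma> \<in> C" "\<gamma> \<in> Field \<Gamma> \<Longrightarrow> - e \<gamma> \<in> C"
  unfolding C_def by (meson UnI1 UnI2 closure_subset hull_subset imageI subsetD)+

lemma zero_in_C: "0 \<in> C"
proof -
  obtain \<gamma> where "\<gamma> \<in> Field \<Gamma>" using infinite_Field infinite_imp_nonempty by blast
  then have "(1/2) *\<^sub>R e \<gamma> + (1/2) *\<^sub>R (- e \<gamma>) \<in> C" by (intro convexD convex_C e_in_C) auto
  then show ?thesis by simp
qed

text \<open>
  At least half of the mass of each convex combination approximating a point of \<open>W_total\<close> sits on
  points \<open>\<plusminus> e \<gamma>\<close>, the rest on points of \<open>W_total\<close> which can be approximated in turn.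
\<close>
lemma approximation_step:
  assumes s: "s > 0" and close: "\<And>p. p \<in> W_total \<Longrightarrow> \<exists>c\<in>C. dist p c \<le> s"
    and p: "p \<in> W_total"
  shows "\<exists>c\<in>C. dist p c \<le> 3 / 4 * s"
proof -
  obtain c where c: "\<And>p. p \<in> W_total \<Longrightarrow> c p \<in> C" "\<And>p. p \<in> W_total \<Longrightarrow> dist p (c p) \<le> s"
    using close by metis
  obtain \<gamma>0 where \<gamma>0: "\<gamma>0 \<in> J" "p \<in> W \<gamma>0" using W_total_stage[OF p] by blast
  have "(\<gamma>0, \<gamma>0) \<in> \<Gamma>"
    using Well_order_\<Gamma> J_subset \<gamma>0(1) by (auto simp: order_on_defs refl_on_def)
  then have "\<theta> ` {\<gamma>. (\<gamma>0, \<gamma>) \<in> \<Gamma>} \<noteq> {}" by blast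
  moreover have "Inf (\<theta> ` {\<gamma>. (\<gamma>0, \<gamma>) \<in> \<Gamma>}) < s / 4"
    using theta_inf[OF subsetD[OF J_subset \<gamma>0(1)]] s by simp
  ultimately obtain k where "k \<in> \<theta> ` {\<gamma>. (\<gamma>0, \<gamma>) \<in> \<Gamma>}" "k < s / 4"
    by (rule cInf_lessD[elim_format]) blast
  then obtain \<gamma> where \<gamma>: "(\<gamma>0, \<gamma>) \<in> \<Gamma>" "\<theta> \<gamma> < s / 4" by blast
  have "\<gamma> \<in> J" using J_upward \<gamma>0(1) \<gamma>(1) by blast
  moreover have "p \<in> W \<gamma>" using W_mono[OF \<gamma>(1)] \<gamma>0(2) by blast
  ultimately obtain \<eta> where \<eta>: "\<eta> \<in> underS \<Gamma> (\<kappa> \<gamma>)" "p = z \<gamma> \<eta>"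
    using enumeration[of \<gamma>] by blast
  define A where "A = Aset \<gamma> \<eta>"
  have A: "finite A" using Aset_finite[OF \<open>\<gamma> \<in> J\<close> \<eta>(1)] by (simp add: A_def)
  have A_total: "A \<subseteq> A_total" using \<open>\<gamma> \<in> J\<close> \<eta>(1) by (auto simp: A_def A_total_def A_stage_def)
  have l: "0 \<le> lp w" "0 \<le> lm w" if "w \<in> A" for w using coefficients_nonneg that A_total by blast+
  \<comment> \<open>Of each pair \<open>ep w\<close>, \<open>em w\<close> the one with the larger
    coefficient is itself \<open>e w\<close> or \<open>- e w\<close> up to the choice made for ties,
    and is kept; the other is replaced by its approximant in \<open>C\<close>. The error is at most
    \<open>s / 2\<close>, and \<open>\<theta> \<gamma> < s / 4\<close> accounts for the rest of the
    factor 3/4.\<close>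
  define P where "P w = (if lm w \<le> lp w then ep w else c (ep w))" for w
  define Q where "Q w = (if lm w \<le> lp w then c (em w) else em w)" for w
  have PQ: "P w \<in> C" "Q w \<in> C" if "w \<in> A" for w
  proof -
    have w: "w \<in> A_total" "w \<in> Field \<Gamma>" using that A_total A_total_subset by auto
    show "P w \<in> C"
      using e_in_C(1)[OF w(2)] e_plus[OF w(1)] c(1)[OF in_W_total(1)[OF w(1)]] by (auto simp: P_def)
    have "lp w < lm w \<Longrightarrow> em w = - e w" using e_minus[OF w(1)] by simp
    then show "Q w \<in> C"
      using e_in_C(2)[OF w(2)] c(1)[OF in_W_total(2)[OF w(1)]] by (auto simp: Q_def)
  qed
  define q where "q = (\<Sum>w\<in>A. lp w *\<^sub>R P w) + (\<Sum>w\<in>A. lm w *\<^sub>R Q w)"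
  have sum1: "sum lp A + sum lm A = 1"
    using coefficients_sum[OF \<open>\<gamma> \<in> J\<close> \<eta>(1)] by (simp add: A_def sum.distrib)
  have "q \<in> C"
    unfolding q_def by (rule convex_two_sums[OF convex_C A A _ _ sum1]) (use PQ l in auto)
  define r where "r = (\<Sum>w\<in>A. lp w *\<^sub>R ep w + lm w *\<^sub>R em w)"
  have "r - q = (\<Sum>w\<in>A. lp w *\<^sub>R (ep w - P w) + lm w *\<^sub>R (em w - Q w))"
    by (simp add: r_def q_def sum.distrib sum_subtractf scaleR_diff_right algebra_simps)
  then have "norm (r - q) \<le> (\<Sum>w\<in>A. norm (lp w *\<^sub>R (ep w - P w) + lm w *\<^sub>R (em w - Q w)))"
    by (simp add: norm_sum)
  also have "\<dots> \<le> (\<Sum>w\<in>A. (lp w + lm w) * (s / 2))"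
  proof (rule sum_mono)
    fix w assume w: "w \<in> A"
    then have W: "ep w \<in> W_total" "em w \<in> W_total" using A_total in_W_total by auto
    show "norm (lp w *\<^sub>R (ep w - P w) + lm w *\<^sub>R (em w - Q w)) \<le> (lp w + lm w) * (s / 2)"
    proof (cases "lm w \<le> lp w")
      case True
      then have "norm (lp w *\<^sub>R (ep w - P w) + lm w *\<^sub>R (em w - Q w)) = lm w * dist (em w) (c (em w))"
        using l[OF w] by (simp add: P_def Q_def dist_norm)
      also have "\<dots> \<le> lm w * s" using l[OF w] c(2)[OF W(2)] by (simp add: mult_left_mono)
      also have "\<dots> \<le> (lp w + lm w) / 2 * s" using True s by (intro mult_right_mono) auto
      finally show ?thesis by simp
    next
      case False
      then have "norm (lp w *\<^sub>R (ep w - P w) + lm w *\<^sub>R (em w - Q w)) = lp w * dist (ep w) (c (ep w))"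
        using l[OF w] by (simp add: P_def Q_def dist_norm)
      also have "\<dots> \<le> lp w * s" using l[OF w] c(2)[OF W(1)] by (simp add: mult_left_mono)
      also have "\<dots> \<le> (lp w + lm w) / 2 * s" using False s by (intro mult_right_mono) auto
      finally show ?thesis by simp
    qed
  qed
  also have "\<dots> = (sum lp A + sum lm A) * (s / 2)"
    by (simp only: sum_distrib_right[symmetric] sum.distrib)
  also have "\<dots> = s / 2" by (simp add: sum1)
  finally have "dist r q \<le> s / 2" by (simp add: dist_norm)
  moreover have "dist r p \<le> \<theta> \<gamma>"
    using approximation[OF \<open>\<gamma> \<in> J\<close> \<eta>(1)] \<eta>(2) by (simp add: r_def A_def)
  ultimately have "dist p q \<le> 3 / 4 * s"
    using \<gamma>(2) dist_triangle3[of p q r] by simp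
  then show ?thesis using \<open>q \<in> C\<close> by blast
qed

text \<open>The contraction is iterated from the trivial estimate 1, the distance to
  \<open>0\<close> in \<open>C\<close>; the limit stays in the closed set \<open>C\<close>.\<close>

lemma W_total_subset: "W_total \<subseteq> C"
proof
  fix p assume "p \<in> W_total"
  have norm_le: "norm p \<le> 1" if "p \<in> W_total" for p
  proof -
    consider \<eta> where "\<eta> \<in> Field \<Gamma>" "p = x \<eta>" | w where "w \<in> A_total" "p = ep w \<or> p = em w"
      using \<open>p \<in> W_total\<close> by (auto simp: W_total_def E_stage_def A_total_def)
    then show ?thesis
    proof cases
      case 1
      then show ?thesis using x_in by auto
    next
      case 2
      then show ?thesis using points[of w] face_interiorD by blast
    qed
  qed
  have "\<forall>p\<in>W_total. \<exists>c\<in>C. dist p c \<le> (3 / 4) ^ n" for n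
  proof (induction n)
    case 0
    then show ?case using norm_le zero_in_C by (intro ballI bexI[of _ 0]) auto
  next
    case (Suc n)
    then show ?case using approximation_step[of "(3 / 4) ^ n"] by simp
  qed
  then have close: "\<exists>c\<in>C. dist p c \<le> (3 / 4) ^ n" for n using \<open>p \<in> W_total\<close> by blast
  have "\<exists>c\<in>C. dist c p < d" if "d > 0" for d
  proof -
    obtain n where n: "(3 / 4) ^ n < d" using real_arch_pow_inv[of d "3/4"] \<open>d > 0\<close> by auto
    obtain c where "c \<in> C" "dist p c \<le> (3 / 4) ^ n" using close by blast
    then show ?thesis using n by (intro bexI[of _ c]) (auto simp: dist_commute)
  qed
  then have "p \<in> closure C" by (simp add: closure_approachable)
  then show "p \<in> C" by (simp add: C_def)
qed

lemma cball_subset_B: "cball 0 1 \<subseteq> B"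
proof -
  have "cball 0 1 \<subseteq> closure (x ` Field \<Gamma>)" by (rule x_dense)
  also have "\<dots> \<subseteq> C"
    by (rule closure_minimal) (use W_total_subset in \<open>auto simp: W_total_def C_def\<close>)
  also have "C \<subseteq> B"
  proof -
    define U where "U = (\<lambda>\<gamma>. (1 + \<tau> \<gamma>) *\<^sub>R e \<gamma>) ` Field \<Gamma> \<union> (\<lambda>\<gamma>. - ((1 + \<tau> \<gamma>) *\<^sub>R e \<gamma>)) ` Field \<Gamma>"
    have segment: "k *\<^sub>R e \<gamma> \<in> convex hull U" if \<gamma>: "\<gamma> \<in> Field \<Gamma>" and "\<bar>k\<bar> \<le> 1" for \<gamma> k
    proof -
      \<comment> \<open>\<open>k e\<close> divides the segment between the two opposite spikes;
        \<open>u\<close> is determined by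
        \<open>(2 u - 1) (1 + \<tau> \<gamma>) = k\<close>.\<close>
      define K where "K = k / (1 + \<tau> \<gamma>)"
      define u where "u = (1 + K) / 2"
      have pos: "1 + \<tau> \<gamma> > 0" "\<bar>k\<bar> \<le> 1 + \<tau> \<gamma>" using tau_range[OF \<gamma>] that(2) by auto
      then have "\<bar>k / (1 + \<tau> \<gamma>)\<bar> \<le> 1" by (simp only: abs_divide) (simp add: divide_le_eq)
      then have "- 1 \<le> K" "K \<le> 1" unfolding K_def by linarith+
      then have u: "0 \<le> u" "u \<le> 1" by (auto simp: u_def)
      have "u *\<^sub>R ((1 + \<tau> \<gamma>) *\<^sub>R e \<gamma>) + (1 - u) *\<^sub>R (- ((1 + \<tau> \<gamma>) *\<^sub>R e \<gamma>)) \<in> convex hull U"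
        by (rule convexD) (use u \<gamma> in \<open>auto simp: U_def intro!: hull_inc\<close>)
      moreover have "u *\<^sub>R ((1 + \<tau> \<gamma>) *\<^sub>R e \<gamma>) + (1 - u) *\<^sub>R (- ((1 + \<tau> \<gamma>) *\<^sub>R e \<gamma>)) = k *\<^sub>R e \<gamma>"
      proof -
        have "2 * u - 1 = K" by (simp add: u_def field_simps)
        then have k_eq: "(2 * u - 1) * (1 + \<tau> \<gamma>) = k" using pos by (simp add: K_def)
        have eq:  "u *\<^sub>R y + (1 - u) *\<^sub>R (- y) = (2 * u - 1) *\<^sub>R y" for y :: 'a
          by (simp flip: scaleR_diff_left)
        show ?thesis unfolding eq by (simp only: scaleR_scaleR k_eq)
      qed
      ultimately show ?thesis by simp
    qed
    have "e ` Field \<Gamma> \<union> (\<lambda>\<gamma>. - e \<gamma>) ` Field \<Gamma> \<subseteq> convex hull U"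
      using segment[of _ 1] segment[of _ "- 1"] by auto
    then have "convex hull (e ` Field \<Gamma> \<union> (\<lambda>\<gamma>. - e \<gamma>) ` Field \<Gamma>) \<subseteq> convex hull U"
      by (simp add: hull_minimal)
    then show "C \<subseteq> B" unfolding C_def B_def U_def[symmetric] by (rule closure_mono)
  qed
  finally show ?thesis .
qed

end

section \<open>The construction as an instance of a spiked ball\<close>

context renorming_construction
begin

text \<open>The spiked ball is indexed by functionals, the construction by ordinals.
  \<open>index\<close> inverts \<open>f\<close> up to sign, and \<open>spike\<close> restores the
  sign.\<close>

definition index :: "('a \<Rightarrow>\<^sub>L real) \<Rightarrow> 'i" where
  "index \<phi> = inv_into (Field \<Gamma>) f (if \<phi> \<in> f ` Field \<Gamma> then \<phi> else - \<phi>)"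

definition spike :: "('a \<Rightarrow>\<^sub>L real) \<Rightarrow> 'a" where
  "spike \<phi> = (if \<phi> \<in> f ` Field \<Gamma> then 1 else - 1) *\<^sub>R ((1 + \<tau> (index \<phi>)) *\<^sub>R e (index \<phi>))"

lemma minus_notin: "\<gamma> \<in> Field \<Gamma> \<Longrightarrow> - f \<gamma> \<notin> f ` Field \<Gamma>"
  using f_disjoint by blast

lemma index_f [simp]: "\<gamma> \<in> Field \<Gamma> \<Longrightarrow> index (f \<gamma>) = \<gamma>" "\<gamma> \<in> Field \<Gamma> \<Longrightarrow> index (- f \<gamma>) = \<gamma>"
  using minus_notin f_inj by (auto simp: index_def)

lemma spike_f [simp]:
  "\<gamma> \<in> Field \<Gamma> \<Longrightarrow> spike (f \<gamma>) = (1 + \<tau> \<gamma>) *\<^sub>R e \<gamma>"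
  "\<gamma> \<in> Field \<Gamma> \<Longrightarrow> spike (- f \<gamma>) = - ((1 + \<tau> \<gamma>) *\<^sub>R e \<gamma>)"
  using minus_notin by (auto simp: spike_def algebra_simps)

lemma boundary_cases:
  assumes "\<phi> \<in> minimal_boundary norm"
  obtains \<gamma> where "\<gamma> \<in> Field \<Gamma>" "\<phi> = f \<gamma>" | \<gamma> where "\<gamma> \<in> Field \<Gamma>" "\<phi> = - f \<gamma>"
  using assms f_range by blast

lemma f_in_boundary: "\<gamma> \<in> Field \<Gamma> \<Longrightarrow> f \<gamma> \<in> minimal_boundary norm" "\<gamma> \<in> Field \<Gamma> \<Longrightarrow> - f \<gamma> \<in> minimal_boundary norm"
  using f_range by blast+

lemma \<mu>_upper:
  assumes "\<gamma> \<in> Field \<Gamma>" "\<xi> \<in> Field \<Gamma>" "\<xi> \<noteq> \<gamma>"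
  shows "\<bar>blinfun_apply (f \<xi>) (e \<gamma>)\<bar> \<le> \<mu> \<gamma>"
proof -
  have "bdd_above ((\<lambda>\<xi>. \<bar>blinfun_apply (f \<xi>) (e \<gamma>)\<bar>) ` (Field \<Gamma> - {\<gamma>}))"
  proof (rule bdd_aboveI2)
    fix \<xi> assume "\<xi> \<in> Field \<Gamma> - {\<gamma>}"
    then have "norm (f \<xi>) = 1" using norm_minimal_boundary f_in_boundary by blast
    then show "\<bar>blinfun_apply (f \<xi>) (e \<gamma>)\<bar> \<le> 1"
      using norm_blinfun[of "f \<xi>" "e \<gamma>"] e_on_face(2)[OF assms(1)] by simp
  qed
  then show ?thesis unfolding \<mu>_def by (rule cSUP_upper[rotated]) (use assms in simp)
qed

lemma spike_image: "spike ` minimal_boundary norm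
  = (\<lambda>\<gamma>. (1 + \<tau> \<gamma>) *\<^sub>R e \<gamma>) ` Field \<Gamma> \<union> (\<lambda>\<gamma>. - ((1 + \<tau> \<gamma>) *\<^sub>R e \<gamma>)) ` Field \<Gamma>"
  unfolding f_range[symmetric] image_Un image_image by simp

text \<open>Stretching by \<open>1 + \<tau>\<close> also stretches the bound \<open>\<mu>\<close>,
  so \<open>t + \<nu> < 1\<close> becomes \<open>\<tau> + \<mu> + \<tau> * \<mu> < 1\<close>, the
  condition \<open>tau_mu\<close>.\<close>

lemma spiked_ball_construction:
  assumes "polyhedral (norm :: 'a \<Rightarrow> real)"
  shows "spiked_ball (minimal_boundary (norm :: 'a \<Rightarrow> real)) spike (\<lambda>\<phi>. \<tau> (index \<phi>))
    (\<lambda>\<phi>. (1 + \<tau> (index \<phi>)) * \<mu> (index \<phi>)) \<epsilon>"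
proof
  fix \<phi> :: "'a \<Rightarrow>\<^sub>L real" assume \<phi>: "\<phi> \<in> minimal_boundary norm"
  show "- \<phi> \<in> minimal_boundary norm" "spike (- \<phi>) = - spike \<phi>" "\<tau> (index (- \<phi>)) = \<tau> (index \<phi>)"
    "0 < \<tau> (index \<phi>)" "\<tau> (index \<phi>) < \<epsilon>"
    using \<phi> tau_range by (auto elim!: boundary_cases simp: f_in_boundary)
  show "\<tau> (index \<phi>) + (1 + \<tau> (index \<phi>)) * \<mu> (index \<phi>) < 1"
    using \<phi> tau_mu by (auto elim!: boundary_cases simp: algebra_simps)
  show "blinfun_apply \<phi> (spike \<phi>) = 1 + \<tau> (index \<phi>)"
    using \<phi> e_on_face(1) by (auto elim!: boundary_cases simp: blinfun.bilinear_simps)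
  show "norm \<phi> \<le> 1" using norm_minimal_boundary[OF \<phi>] by simp
  obtain \<gamma> where \<gamma>: "\<gamma> \<in> Field \<Gamma>" "\<phi> = f \<gamma> \<or> \<phi> = - f \<gamma>" using \<phi> by (auto elim: boundary_cases)
  have "infinite (Field \<Gamma> - {\<gamma>})" using infinite_Field by simp
  then obtain \<xi> where \<xi>: "\<xi> \<in> Field \<Gamma>" "\<xi> \<noteq> \<gamma>" using infinite_imp_nonempty by blast
  have "f \<xi> \<noteq> f \<gamma>" using f_inj \<gamma>(1) \<xi> by (auto dest: inj_onD)
  moreover have "f \<xi> \<noteq> - f \<gamma>" using minus_notin[OF \<gamma>(1)] \<xi>(1) by (metis imageI)
  ultimately show "\<exists>\<psi>\<in>minimal_boundary norm. \<psi> \<noteq> \<phi> \<and> \<psi> \<noteq> - \<phi>"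
    using \<gamma>(2) f_in_boundary(1)[OF \<xi>(1)] by (intro bexI[of _ "f \<xi>"]) auto
  fix \<psi> :: "'a \<Rightarrow>\<^sub>L real" assume \<psi>: "\<psi> \<in> minimal_boundary norm" "\<psi> \<noteq> \<phi>" "\<psi> \<noteq> - \<phi>"
  obtain \<delta> where \<delta>: "\<delta> \<in> Field \<Gamma>" "\<psi> = f \<delta> \<or> \<psi> = - f \<delta>" using \<psi>(1) by (auto elim: boundary_cases)
  have "\<delta> \<noteq> \<gamma>" using \<psi>(2,3) \<gamma>(2) \<delta>(2) by auto
  then have "\<bar>blinfun_apply (f \<delta>) (e \<gamma>)\<bar> \<le> \<mu> \<gamma>" by (rule \<mu>_upper[OF \<gamma>(1) \<delta>(1)])
  then have "(1 + \<tau> \<gamma>) * \<bar>blinfun_apply (f \<delta>) (e \<gamma>)\<bar> \<le> (1 + \<tau> \<gamma>) * \<mu> \<gamma>"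
    by (rule mult_left_mono) (use tau_range[OF \<gamma>(1)] in simp)
  then have "\<bar>blinfun_apply (f \<delta>) ((1 + \<tau> \<gamma>) *\<^sub>R e \<gamma>)\<bar> \<le> (1 + \<tau> \<gamma>) * \<mu> \<gamma>"
    using tau_range[OF \<gamma>(1)] by (simp add: blinfun.scaleR_right abs_mult)
  then show "\<bar>blinfun_apply \<psi> (spike \<phi>)\<bar> \<le> (1 + \<tau> (index \<phi>)) * \<mu> (index \<phi>)"
    using \<gamma> \<delta>(2) by (auto simp: blinfun.minus_left blinfun.minus_right)
next
  fix y :: 'a assume "\<And>\<phi>. \<phi> \<in> minimal_boundary norm \<Longrightarrow> blinfun_apply \<phi> y \<le> 1"
  then show "norm y \<le> 1" by (rule minimal_boundary_norming[OF assms])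
next
  show "minimal_boundary (norm :: 'a \<Rightarrow> real) \<noteq> {}"
    using infinite_imp_nonempty[OF infinite_Field] f_in_boundary by blast
  show "cball 0 1 \<subseteq> closure (convex hull (spike ` minimal_boundary norm))"
    using cball_subset_B by (simp add: spike_image B_def)
qed

end

theorem theorem6p2:
  fixes \<epsilon> :: real
    and \<Gamma> :: "'i rel"
    and f :: "'i \<Rightarrow> ('a::banach \<Rightarrow>\<^sub>L real)"
    and \<theta> \<tau> lp lm :: "'i \<Rightarrow> real"
    and x ep em e :: "'i \<Rightarrow> 'a"
    and \<kappa> :: "'i \<Rightarrow> 'i"
    and z :: "'i \<Rightarrow> 'i \<Rightarrow> 'a"
    and Aset :: "'i \<Rightarrow> 'i \<Rightarrow> 'i set"
  assumes infinite_dimensional: "\<nexists>b :: 'a set. finite b \<and> span b = UNIV"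
    and polyhedral_E: "polyhedral (norm :: 'a \<Rightarrow> real)"
    and starstar_E: "property_starstar (norm :: 'a \<Rightarrow> real)"
    and eps: "\<epsilon> > 0"
    and construction: "renorming_construction \<epsilon> \<Gamma> f \<theta> x \<kappa> z Aset ep em lp lm e \<tau>"
  shows "\<exists>N :: 'a \<Rightarrow> real.
           unit_ball N = renorming_data.B \<Gamma> e \<tau> \<and>
           eps_equivalent_renorming \<epsilon> N \<and>
           polyhedral N \<and>
           unit_ball N = closure (convex hull (ext (unit_ball N))) \<and>
           (IV_polyhedral (norm :: 'a \<Rightarrow> real) \<longrightarrow> V_polyhedral N)"
proof -
  interpret renorming_construction \<epsilon> \<Gamma> f \<theta> x \<kappa> z Aset ep em lp lm e \<tau> by (rule construction)
  interpret X: spiked_ball "minimal_boundary (norm :: 'a \<Rightarrow> real)" spike "\<lambda>\<phi>. \<tau> (index \<phi>)"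
    "\<lambda>\<phi>. (1 + \<tau> (index \<phi>)) * \<mu> (index \<phi>)" \<epsilon>
    by (rule spiked_ball_construction[OF polyhedral_E])
  have "V_polyhedral X.N" if IV: "IV_polyhedral (norm :: 'a \<Rightarrow> real)"
  proof (rule X.V_polyhedral_N)
    fix y :: 'a assume y: "norm y = 1"
    obtain d where "d > 0" "finite {h\<in>minimal_boundary norm. blinfun_apply h y = 1}"
      "\<And>h. h \<in> minimal_boundary norm \<Longrightarrow> blinfun_apply h y = 1 \<or> blinfun_apply h y \<le> 1 - d"
      by (rule IV_polyhedral_finite_active[OF IV y minimal_boundary_extreme]) blast
    then show "\<exists>d>0. finite {h\<in>minimal_boundary norm. blinfun_apply h y = 1} \<and>
        (\<forall>h\<in>minimal_boundary norm. blinfun_apply h y = 1 \<or> blinfun_apply h y \<le> 1 - d)"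
      by blast
  qed
  moreover have "unit_ball X.N = B"
    by (simp add: X.unit_ball_N X.body_def B_def spike_image)
  moreover have "unit_ball X.N = closure (convex hull (ext (unit_ball X.N)))"
    unfolding X.unit_ball_N by (rule X.body_eq_closure_ext)
  ultimately show ?thesis
    using X.eps_equivalent_renorming_N X.polyhedral_N[OF polyhedral_E] by blast
qed

end
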